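(* Let $-A$ be the generator of a bounded $C_0$-semigroup $(e^{-tA})_{t\ge0}$ on a Banach space $X$, where $A$ has dense range. Let $B$ and $A^{-1}B$ be bounded linear operators on $X$, and denote $$\|B\|=a\qquad\text{and}\qquad \|A^{-1}B\|=b.$$ Then for any Stieltjes function $f$ the operator $f(A)B$ is bounded and $$\|f(A)B\|\le 2(1+M_0)\,a\,f(a/b),$$ where $M_0:=\sup_{t\ge0}\|e^{-tA}\|$.
   Context: Since $A$ has dense range, it is injective; "$A^{-1}B$ is a bounded linear operator on $X$" means $\operatorname{ran}(B)\subset\operatorname{ran}(A)$ and $A^{-1}B$ is bounded. A Stieltjes function is a function $f:(0,\infty)\to[0,\infty)$ of the form $f(z)=\frac{c_0}{z}+c_1+\int_{(0,\infty)}\frac{\nu(ds)}{z+s}$ with $c_0,c_1\ge0$ and $\nu$ a positive Radon measure on $(0,\infty)$ with $\int_{(0,\infty)}\frac{\nu(ds)}{1+s}<\infty$; it extends analytically to $\mathbb C\setminus(-\infty,0]$. $f(A)$ is defined by the extended Hille-Phillips calculus: for a Laplace transform $g(z)=\int_0^\infty e^{-sz}\mu(ds)$ of a bounded Radon measure $\mu$ on $[0,\infty)$ put $g(A):=\int_0^\infty e^{-sA}\mu(ds)$ (strong integral); if $f$ is holomorphic on $\{\operatorname{Re}z>0\}$ and there is such a Laplace transform $e$ with $ef$ again such a Laplace transform and $e(A)$ injective, then $f(A):=e(A)^{-1}(ef)(A)$ with domain $\{x:(ef)(A)x\in\operatorname{ran}(e(A))\}$ (independent of $e$). Stieltjes functions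 are covered by this definition for injective $A$ (e.g. with $e(z)=z/(z+1)$). *)

theory Defs
  imports "HOL-Analysis.Analysis"
begin

section \<open>Complex Banach spaces and operators\<close>

class complex_banach = banach +
  fixes scaleC :: "complex \<Rightarrow> 'a \<Rightarrow> 'a"  (infixr "*\<^sub>C" 75)
  assumes scaleC_add_right: "c *\<^sub>C (x + y) = c *\<^sub>C x + c *\<^sub>C y"
    and scaleC_add_left: "(c + d) *\<^sub>C x = c *\<^sub>C x + d *\<^sub>C x"
    and scaleC_scaleC: "c *\<^sub>C d *\<^sub>C x = (c * d) *\<^sub>C x"
    and scaleC_one: "1 *\<^sub>C x = x"
    and scaleR_scaleC: "r *\<^sub>R x = complex_of_real r *\<^sub>C x"
    and norm_scaleC: "norm (c *\<^sub>C x) = cmod c * norm x"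

instantiation complex :: complex_banach
begin

definition scaleC_complex :: "complex \<Rightarrow> complex \<Rightarrow> complex"
  where "scaleC_complex c x = c * x"

instance
  by standard (simp_all add: scaleC_complex_def algebra_simps norm_mult scaleR_conv_of_real)

end

definition bounded_clinear :: "('a::complex_banach \<Rightarrow> 'a) \<Rightarrow> bool"
  where "bounded_clinear B \<longleftrightarrow> bounded_linear B \<and> (\<forall>c x. B (c *\<^sub>C x) = c *\<^sub>C B x)"

text \<open>
  Unbounded operators are identified with their graphs, so that the inverse of an injective
  operator \<open>R\<close> is the converse relation \<open>R\<inverse>\<close>. The value of \<open>op_comp R B\<close> at \<open>x\<close>
  is meaningful only if \<open>R\<close> is single-valued and \<open>B x\<close> is in the domain of \<open>R\<close>.
\<close>

definition op_comp :: "('a \<times> 'b) set \<Rightarrow> ('c \<Rightarrow> 'a) \<Rightarrow> 'c \<Rightarrow> 'b"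
  where "op_comp R B x = (THE y. (B x, y) \<in> R)"

definition bounded_op_comp ::
    "('a::complex_banach \<times> 'a) set \<Rightarrow> ('a \<Rightarrow> 'a) \<Rightarrow> bool"
  where "bounded_op_comp R B \<longleftrightarrow> range B \<subseteq> Domain R \<and> bounded_clinear (op_comp R B)"


section \<open>Semigroups\<close>

text \<open>Only the values \<open>T t\<close> with \<open>t \<ge> 0\<close> matter.\<close>

definition bounded_C0_semigroup :: "(real \<Rightarrow> 'a::complex_banach \<Rightarrow> 'a) \<Rightarrow> bool"
  where "bounded_C0_semigroup T \<longleftrightarrow>
    (\<forall>t\<ge>0. bounded_clinear (T t)) \<and>
    (\<forall>x. T 0 x = x) \<and>
    (\<forall>s\<ge>0. \<forall>t\<ge>0. \<forall>x. T (s + t) x = T s (T t x)) \<and>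
    (\<forall>x. ((\<lambda>t. T t x) \<longlongrightarrow> x) (at_right 0)) \<and>
    bdd_above ((\<lambda>t. onorm (T t)) ` {0..})"

definition semigroup_generator ::
    "(real \<Rightarrow> 'a::complex_banach \<Rightarrow> 'a) \<Rightarrow> ('a \<times> 'a) set"
  where "semigroup_generator T =
    {(x, y). ((\<lambda>t. (1 / t) *\<^sub>R (T t x - x)) \<longlongrightarrow> y) (at_right 0)}"

definition op_uminus :: "('a::complex_banach \<times> 'a) set \<Rightarrow> ('a \<times> 'a) set"
  where "op_uminus A = {(x, - y) | x y. (x, y) \<in> A}"


section \<open>Stieltjes functions\<close>

text \<open>
  The measure lives on the space \<open>{0<..}\<close>. A Borel measure there that is finite on compact sets
  is automatically regular.
\<close>

definition stieltjes :: "(real \<Rightarrow> real) \<Rightarrow> bool"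
  where "stieltjes f \<longleftrightarrow>
    (\<exists>c0 c1. \<exists>\<nu> :: real measure.
      c0 \<ge> 0 \<and> c1 \<ge> 0 \<and>
      sets \<nu> = sets (restrict_space borel {0<..}) \<and>
      (\<forall>K. compact K \<longrightarrow> K \<subseteq> {0<..} \<longrightarrow> emeasure \<nu> K < \<infinity>) \<and>
      (\<integral>\<^sup>+ s. ennreal (1 / (1 + s)) \<partial>\<nu>) < \<infinity> \<and>
      (\<forall>z>0. f z = c0 / z + c1 + (LINT s|\<nu>. 1 / (z + s))))"

text \<open>
  The holomorphic extension from \<open>{0<..}\<close> to the cut plane; it is unique there by the identity
  theorem, and arbitrary on the cut.
\<close>

definition cut_plane_extension :: "(real \<Rightarrow> real) \<Rightarrow> complex \<Rightarrow> complex"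
  where "cut_plane_extension f =
    (SOME F. F holomorphic_on (- \<real>\<^sub>\<le>\<^sub>0) \<and> (\<forall>x>0. F (complex_of_real x) = complex_of_real (f x)))"


section \<open>The extended Hille-Phillips calculus\<close>

text \<open>
  The library's \<^const>\<open>has_bochner_integral\<close> is restricted to second countable target spaces. The
  following is the same definition without that restriction. (The \<open>L\<^sup>1\<close> approximation by
  simple functions forces \<open>f\<close> to be almost everywhere separably valued.)
\<close>

definition has_strong_integral ::
    "'s measure \<Rightarrow> ('s \<Rightarrow> 'a::banach) \<Rightarrow> 'a \<Rightarrow> bool"
  where "has_strong_integral M f y \<longleftrightarrow>
    f \<in> borel_measurable M \<and>
    (\<exists>s. (\<forall>i. Bochner_Integration.simple_bochner_integrable M (s i)) \<and>
      (\<lambda>i::nat. \<integral>\<^sup>+ x. ennreal (norm (f x - s i x)) \<partial>M) \<longlonglongrightarrow> 0 \<and>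
      (\<lambda>i. Bochner_Integration.simple_bochner_integral M (s i)) \<longlonglongrightarrow> y)"

text \<open>
  A bounded (complex) Radon measure \<open>\<mu>\<close> on \<open>{0..}\<close> is given as \<open>\<mu>(ds) = h(s) m(ds)\<close>, with a
  finite positive Borel measure \<open>m\<close> on \<open>{0..}\<close> and an \<open>m\<close>-integrable density \<open>h\<close>. By polar
  decomposition (\<open>m = |\<mu>|\<close>, \<open>|h| = 1\<close>) every complex Borel measure on \<open>{0..}\<close> is of this form,
  and every such measure is Radon.
\<close>

definition bounded_radon_measure :: "real measure \<Rightarrow> (real \<Rightarrow> complex) \<Rightarrow> bool"
  where "bounded_radon_measure m h \<longleftrightarrow>
    finite_measure m \<and> sets m = sets (restrict_space borel {0..}) \<and> integrable m h"

definition laplace_transform_of ::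
    "real measure \<Rightarrow> (real \<Rightarrow> complex) \<Rightarrow> (complex \<Rightarrow> complex) \<Rightarrow> bool"
  where "laplace_transform_of m h g \<longleftrightarrow>
    bounded_radon_measure m h \<and>
    (\<forall>z. Re z > 0 \<longrightarrow> g z = (LINT s|m. exp (- (complex_of_real s * z)) * h s))"

definition hp_operator ::
    "(real \<Rightarrow> 'a::complex_banach \<Rightarrow> 'a) \<Rightarrow> real measure \<Rightarrow> (real \<Rightarrow> complex) \<Rightarrow> 'a \<Rightarrow> 'a"
  where "hp_operator T m h x = (THE y. has_strong_integral m (\<lambda>s. h s *\<^sub>C T s x) y)"

text \<open>
  The graph of \<open>f(A)\<close>, where \<open>-A\<close> is the generator of \<open>T\<close>: with \<open>e\<close> the Laplace transform of
  \<open>h\<cdot>m\<close> and \<open>e f\<close> that of \<open>k\<cdot>n\<close>, the condition \<open>y = e(A)\<inverse> (e f)(A) x\<close> reads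
  \<open>(e f)(A) x = e(A) y\<close>. All admissible \<open>e\<close>, with all their representing measures, give the same
  pairs \<open>(x, y)\<close>.
\<close>

definition hp_calculus ::
    "(real \<Rightarrow> 'a::complex_banach \<Rightarrow> 'a) \<Rightarrow> (complex \<Rightarrow> complex) \<Rightarrow> ('a \<times> 'a) set"
  where "hp_calculus T f =
    {(x, y). f holomorphic_on {z. Re z > 0} \<and>
      (\<exists>e m h n k.
        laplace_transform_of m h e \<and>
        laplace_transform_of n k (\<lambda>z. e z * f z) \<and>
        inj (hp_operator T m h) \<and>
        hp_operator T n k x = hp_operator T m h y)}"

end

theory Submission
  imports Defs "HOL-Complex_Analysis.Complex_Analysis" "HOL-Real_Asymp.Real_Asymp"
begin

text \<open>
  Write \<open>f(z) = c0 / z + c1 + \<integral> (1 + s) / (z + s) \<nu>(ds)\<close> with a finite measure \<open>\<nu>\<close>. For \<open>x = A w\<close> the vector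
  \<open>y = c0 w + c1 x + \<integral> (1 + s) (s + A)\<inverse> x \<nu>(ds)\<close> is \<open>f(A) x\<close>: whenever \<open>e\<close> and \<open>e f\<close> are Laplace transforms
  of bounded measures, \<open>(e f)(A) x = e(A) y\<close>. This identity between integrals of orbits is clear for exponential
  orbits \<open>t \<mapsto> exp (- z t) v\<close>. By a vector-valued Weierstrass theorem these approximate \<open>exp (- \<epsilon> t) T t x\<close>
  in a norm for which both sides are continuous, and then \<open>\<epsilon>\<close> tends to \<open>0\<close>. With \<open>x = B v\<close> and
  \<open>w = A\<inverse> B v\<close>, the bound follows from
  \<open>norm ((s + A)\<inverse> B v) \<le> min (M0 a / s) ((1 + M0) b) * norm v \<le> 2 (1 + M0) a / (a / b + s) * norm v\<close>.
\<close>

text \<open>The graph of \<open>f(A)\<close> admits every \<open>e\<close> with every choice of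
  representing measures. Multiplicativity of the calculus would call for convolutions, Fubini for
  orbits and uniqueness of Laplace transforms; comparing both sides along exponentials replaces all
  this by the values of the two transforms at real \<open>z > 0\<close>. Uniform approximation on
  the half-line requires orbits that vanish at infinity, hence \<open>A + \<epsilon>\<close>. One
  half of the damping \<open>exp (- \<epsilon> t)\<close> makes the orbit vanish, the other half
  stays as a weight on the error, which keeps the error integrable under every resolvent, even the
  one at \<open>0\<close> that belongs to \<open>c0 / z\<close>. The limit is taken along
  \<open>(A + \<epsilon>) w\<close> instead of \<open>A w\<close>: the inverse of
  \<open>A + \<epsilon>\<close> maps it to \<open>w\<close> exactly, which settles the term with
  \<open>c0\<close>. This determines \<open>y\<close> once some \<open>e\<close> is admissible. That
  one exists is a separate matter: it has to vanish at \<open>0\<close> against the pole of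
  \<open>c0 / z\<close>, and \<open>e f\<close> has to be inverted explicitly. The space need not be
  separable, so measurability means being a limit of simple functions.\<close>

lemma bounded_bilinear_scaleC:
  "bounded_bilinear (scaleC :: complex \<Rightarrow> 'a::complex_banach \<Rightarrow> 'a)"
proof
  fix a a' :: complex and b b' :: 'a and r :: real
  show "(a + a') *\<^sub>C b = a *\<^sub>C b + a' *\<^sub>C b" by (rule scaleC_add_left)
  show "a *\<^sub>C (b + b') = a *\<^sub>C b + a *\<^sub>C b'" by (rule scaleC_add_right)
  show "(r *\<^sub>R a) *\<^sub>C b = r *\<^sub>R (a *\<^sub>C b)"
    by (simp only: scaleR_conv_of_real scaleR_scaleC[of r "a *\<^sub>C b"] scaleC_scaleC)
  show "a *\<^sub>C r *\<^sub>R b = r *\<^sub>R (a *\<^sub>C b)"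
    by (simp add: scaleR_scaleC scaleC_scaleC mult.commute)
  show "\<exists>K. \<forall>a (b::'a). norm (a *\<^sub>C b) \<le> norm a * norm b * K"
    by (rule exI[of _ 1]) (simp add: norm_scaleC)
qed

interpretation scaleC: bounded_bilinear "scaleC :: complex \<Rightarrow> 'a::complex_banach \<Rightarrow> 'a"
  by (rule bounded_bilinear_scaleC)

declare scaleC.zero_left [simp] scaleC.zero_right [simp]

section \<open>Strong integrals\<close>

abbreviation "sb_integrable \<equiv> Bochner_Integration.simple_bochner_integrable"
abbreviation "sb_integral \<equiv> Bochner_Integration.simple_bochner_integral"

text \<open>Strong measurability. Sums of Borel functions may fail to be Borel in a non-separable
  space, while pointwise limits of simple functions are stable under all operations used
  below.\<close>

definition smeas :: "'s measure \<Rightarrow> ('s \<Rightarrow> 'b::real_normed_vector) \<Rightarrow> bool"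
  where "smeas M F \<longleftrightarrow>
    (\<exists>s. (\<forall>i. simple_function M (s i)) \<and> (\<forall>x\<in>space M. (\<lambda>i::nat. s i x) \<longlonglongrightarrow> F x))"

text \<open>The same description as in \<open>hp_operator\<close>, which therefore unfolds to
  it.\<close>

definition sint :: "'s measure \<Rightarrow> ('s \<Rightarrow> 'b::banach) \<Rightarrow> 'b"
  where "sint M F = (THE y. has_strong_integral M F y)"

definition sintegrable :: "'s measure \<Rightarrow> ('s \<Rightarrow> 'b::banach) \<Rightarrow> bool"
  where "sintegrable M F \<longleftrightarrow> smeas M F \<and> (\<integral>\<^sup>+ x. ennreal (norm (F x)) \<partial>M) < \<infinity>"

lemma smeas_borel:
  assumes "smeas M F" shows "F \<in> borel_measurable M"
proof -
  obtain s where s: "\<And>i. simple_function M (s i)" "\<And>x. x \<in> space M \<Longrightarrow> (\<lambda>i::nat. s i x) \<longlonglongrightarrow> F x"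
    using assms unfolding smeas_def by blast
  show ?thesis
    by (rule borel_measurable_LIMSEQ_metric[where f=s])
       (use s in \<open>auto intro: borel_measurable_simple_function\<close>)
qed

lemma smeas_simple: "simple_function M F \<Longrightarrow> smeas M F"
  unfolding smeas_def by (rule exI[of _ "\<lambda>_. F"]) auto

lemma smeas_const [simp]: "smeas M (\<lambda>_. c)"
  by (intro smeas_simple) simp

lemma smeas_compose2:
  assumes "smeas M F" "smeas M G"
    and "\<And>s t x y. s \<longlonglongrightarrow> x \<Longrightarrow> t \<longlonglongrightarrow> y \<Longrightarrow> (\<lambda>i. p (s i) (t i)) \<longlonglongrightarrow> p x y"
  shows "smeas M (\<lambda>x. p (F x) (G x))"
proof -
  obtain s where s: "\<And>i. simple_function M (s i)" "\<And>x. x \<in> space M \<Longrightarrow> (\<lambda>i::nat. s i x) \<longlonglongrightarrow> F x"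
    using assms unfolding smeas_def by blast
  obtain t where t: "\<And>i. simple_function M (t i)" "\<And>x. x \<in> space M \<Longrightarrow> (\<lambda>i::nat. t i x) \<longlonglongrightarrow> G x"
    using assms unfolding smeas_def by blast
  show ?thesis
    unfolding smeas_def
    by (rule exI[of _ "\<lambda>i x. p (s i x) (t i x)"])
       (use s t assms(3) in \<open>auto intro: simple_function_compose2\<close>)
qed

lemma smeas_add: "smeas M F \<Longrightarrow> smeas M G \<Longrightarrow> smeas M (\<lambda>x. F x + G x)"
  by (rule smeas_compose2) (auto intro: tendsto_add)

lemma smeas_diff: "smeas M F \<Longrightarrow> smeas M G \<Longrightarrow> smeas M (\<lambda>x. F x - G x)"
  by (rule smeas_compose2) (auto intro: tendsto_diff)

lemma smeas_scaleR: "smeas M F \<Longrightarrow> smeas M G \<Longrightarrow> smeas M (\<lambda>x. F x *\<^sub>R G x)"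
  by (rule smeas_compose2) (auto intro: tendsto_scaleR)

lemma smeas_scaleC: "smeas M F \<Longrightarrow> smeas M G \<Longrightarrow> smeas M (\<lambda>x. F x *\<^sub>C G x)"
  by (rule smeas_compose2) (auto intro: scaleC.tendsto)

lemma smeas_bounded_linear:
  assumes "bounded_linear L" "smeas M F" shows "smeas M (\<lambda>x. L (F x))"
  by (rule smeas_compose2[where p="\<lambda>x y. L x" and G="F"])
     (use assms in \<open>auto intro: bounded_linear.tendsto\<close>)

lemma smeas_of_borel:
  fixes F :: "'s \<Rightarrow> 'b::{real_normed_vector, second_countable_topology}"
  assumes "F \<in> borel_measurable M" shows "smeas M F"
  using borel_measurable_implies_sequence_metric[OF assms, of 0] unfolding smeas_def by blast

lemma smeas_compose:
  assumes "smeas M F" "\<phi> \<in> measurable N M" shows "smeas N (\<lambda>x. F (\<phi> x))"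
proof -
  obtain s where s: "\<And>i. simple_function M (s i)" "\<And>x. x \<in> space M \<Longrightarrow> (\<lambda>i::nat. s i x) \<longlonglongrightarrow> F x"
    using assms unfolding smeas_def by blast
  show ?thesis
    unfolding smeas_def
  proof (rule exI[of _ "\<lambda>i x. s i (\<phi> x)"], intro conjI allI ballI)
    show "simple_function N (\<lambda>x. s i (\<phi> x))" for i
      using simple_function_comp[OF assms(2) s(1)] by (simp add: comp_def)
    show "(\<lambda>i. s i (\<phi> x)) \<longlonglongrightarrow> F (\<phi> x)" if "x \<in> space N" for x
      using s(2) measurable_space[OF assms(2) that] by auto
  qed
qed

lemma smeas_cong:
  assumes "\<And>x. x \<in> space M \<Longrightarrow> F x = G x" "smeas M F" shows "smeas M G"
  using assms unfolding smeas_def by auto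

text \<open>The ceiling approximates from the right, so that the sample points stay in \<open>S\<close>.\<close>
lemma smeas_continuous:
  fixes G :: "real \<Rightarrow> 'b::real_normed_vector"
  assumes S: "S \<subseteq> {0..}" "\<And>t u. t \<in> S \<Longrightarrow> t \<le> u \<Longrightarrow> u \<in> S"
    and G: "continuous_on S G" and M: "sets M = sets (restrict_space borel S)"
  shows "smeas M G"
proof -
  define s where "s i t = (if t \<le> real i then G (real_of_int \<lceil>real (Suc i) * t\<rceil> / real (Suc i)) else 0)"
    for i :: nat and t :: real
  have space: "space M = S"
    using sets_eq_imp_space_eq[OF M] by (simp add: space_restrict_space)
  have id: "(\<lambda>x. x) \<in> borel_measurable M"
    unfolding measurable_cong_sets[OF M refl] by (rule measurable_restrict_space1) simp
  show ?thesis
    unfolding smeas_def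
  proof (rule exI[of _ s], intro conjI allI ballI)
    fix i
    have m1: "(\<lambda>t. \<lceil>real (Suc i) * t\<rceil>) \<in> measurable M (count_space UNIV)"
      using id by measurable
    have m: "s i \<in> measurable M (count_space UNIV)"
      unfolding s_def
    proof (rule measurable_If)
      show "(\<lambda>t. G (real_of_int \<lceil>real (Suc i) * t\<rceil> / real (Suc i))) \<in> measurable M (count_space UNIV)"
        by (rule measurable_compose[OF m1]) simp
      show "{t \<in> space M. t \<le> real i} \<in> sets M"
        using id by measurable
    qed simp
    \<comment> \<open>Up to the cutoff \<open>t \<le> i\<close> the samples are taken at grid points
      \<open>k / (i + 1)\<close> with \<open>0 \<le> k \<le> (i + 1) i\<close> only, so the range is
      finite.\<close>
    have "s i ` space M \<subseteq> insert 0 ((\<lambda>k. G (real_of_int k / real (Suc i))) ` {0..int (Suc i * i)})"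
    proof safe
      fix t assume t: "t \<in> space M"
        "s i t \<notin> (\<lambda>k. G (real_of_int k / real (Suc i))) ` {0..int (Suc i * i)}"
      then have "0 \<le> t" using space S by auto
      show "s i t = 0"
      proof (cases "t \<le> real i")
        case True
        have "real (Suc i) * t \<le> real_of_int (int (Suc i * i))"
          unfolding of_nat_mult of_int_mult of_int_of_nat_eq using True by (intro mult_left_mono) auto
        then have "\<lceil>real (Suc i) * t\<rceil> \<le> int (Suc i * i)"
          by (simp only: ceiling_le_iff)
        moreover have "0 \<le> \<lceil>real (Suc i) * t\<rceil>"
          using mult_nonneg_nonneg[OF of_nat_0_le_iff \<open>0 \<le> t\<close>, of "Suc i"] by linarith
        ultimately show ?thesis using t(2) True unfolding s_def by auto
      qed (simp add: s_def)
    qed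
    then have "finite (s i ` space M)"
      by (rule finite_subset) auto
    then show "simple_function M (s i)"
      using m unfolding simple_function_def by (auto dest: measurable_sets)
  next
    fix t assume "t \<in> space M"
    then have t: "t \<in> S" "0 \<le> t" using space S by auto
    define u where "u i = real_of_int \<lceil>real (Suc i) * t\<rceil> / real (Suc i)" for i
    have u: "t \<le> u i \<and> u i \<le> t + 1 / real (Suc i)" for i
    proof -
      have "real (Suc i) * t \<le> real_of_int \<lceil>real (Suc i) * t\<rceil>"
        "real_of_int \<lceil>real (Suc i) * t\<rceil> \<le> real (Suc i) * t + 1" by linarith+
      then have "real (Suc i) * t / real (Suc i) \<le> u i" "u i \<le> (real (Suc i) * t + 1) / real (Suc i)"
        unfolding u_def by (intro divide_right_mono; simp del: of_nat_Suc)+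
      then show ?thesis by (simp add: add_divide_distrib del: of_nat_Suc)
    qed
    have "u \<longlonglongrightarrow> t"
    proof (rule tendsto_sandwich[of "\<lambda>_. t" u _ "\<lambda>i. t + 1 / real (Suc i)"])
      show "(\<lambda>i. t + 1 / real (Suc i)) \<longlonglongrightarrow> t"
        using tendsto_add[OF tendsto_const LIMSEQ_inverse_real_of_nat, of t]
        by (simp add: inverse_eq_divide)
    qed (use u in auto)
    moreover have "u i \<in> S" for i using S(2)[OF t(1)] u by auto
    ultimately have "(\<lambda>i. G (u i)) \<longlonglongrightarrow> G t"
      using G t unfolding continuous_on_sequentially by (auto simp: comp_def)
    moreover have "\<forall>\<^sub>F i in sequentially. G (u i) = s i t"
    proof -
      obtain n where "t \<le> real n" using real_arch_simple by blast
      then show ?thesis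
        by (intro eventually_sequentiallyI[of n]) (auto simp: s_def u_def)
    qed
    ultimately show "(\<lambda>i. s i t) \<longlonglongrightarrow> G t"
      by (rule Lim_transform_eventually)
  qed
qed

text \<open>A triangle inequality through two limit functions. \<open>G = F\<close> gives the Cauchy
  property of approximating integrals, general \<open>G\<close> the distance of two
  integrals.\<close>

lemma simple_bochner_integral_dist_le:
  assumes F: "smeas M F" and s: "sb_integrable M s"
    and t: "sb_integrable M t"
    and G: "smeas M G"
  shows "ennreal (norm (sb_integral M s
      - sb_integral M t)) \<le>
    (\<integral>\<^sup>+ x. norm (F x - s x) \<partial>M) + (\<integral>\<^sup>+ x. norm (F x - G x) \<partial>M) + (\<integral>\<^sup>+ x. norm (G x - t x) \<partial>M)"
    (is "ennreal (norm (?s - ?t)) \<le> _")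
proof -
  have sm: "smeas M s" "smeas M t"
    using s t by (auto intro!: smeas_simple elim: simple_bochner_integrable.cases)
  have [measurable]: "(\<lambda>x. F x - s x) \<in> borel_measurable M" "(\<lambda>x. G x - t x) \<in> borel_measurable M"
     "(\<lambda>x. F x - G x) \<in> borel_measurable M"
    by (intro smeas_borel smeas_diff F G sm)+
  have "ennreal (norm (?s - ?t)) = norm (sb_integral M (\<lambda>x. s x - t x))"
    using s t by (subst simple_bochner_integral_diff) auto
  also have "\<dots> \<le> sb_integral M (\<lambda>x. norm (s x - t x))"
    using simple_bochner_integrable_compose2[of "(-)" M "s" "t"] s t
    by (auto intro!: simple_bochner_integral_norm_bound)
  also have "\<dots> = (\<integral>\<^sup>+x. norm (s x - t x) \<partial>M)"
    using simple_bochner_integrable_compose2[of "\<lambda>x y. norm (x - y)" M "s" "t"] s t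
    by (auto intro!: simple_bochner_integral_eq_nn_integral)
  also have "\<dots> \<le> (\<integral>\<^sup>+x. ennreal (norm (F x - s x)) + ennreal (norm (F x - G x))
      + ennreal (norm (G x - t x)) \<partial>M)"
  proof (rule nn_integral_mono)
    fix x
    have "norm (s x - t x) \<le> norm (F x - s x) + norm (F x - G x) + norm (G x - t x)"
      by (smt (verit, best) add_diff_cancel_left' diff_add_cancel norm_minus_commute norm_triangle_sub
          norm_diff_triangle_le)
    then show "ennreal (norm (s x - t x)) \<le> ennreal (norm (F x - s x)) + ennreal (norm (F x - G x))
      + ennreal (norm (G x - t x))"
      by (simp flip: ennreal_plus)
  qed
  also have "\<dots> = (\<integral>\<^sup>+x. norm (F x - s x) \<partial>M) + (\<integral>\<^sup>+ x. norm (F x - G x) \<partial>M) + (\<integral>\<^sup>+x. norm (G x - t x) \<partial>M)"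
   by (simp add: nn_integral_add)
  finally show ?thesis .
qed

text \<open>The case \<open>F = G\<close> is uniqueness of the integral, on which the definite
  description in \<open>sint\<close> rests.\<close>

lemma has_strong_integral_dist_le:
  assumes "smeas M F" "smeas M G" "has_strong_integral M F y" "has_strong_integral M G z"
  shows "ennreal (norm (y - z)) \<le> (\<integral>\<^sup>+ x. norm (F x - G x) \<partial>M)"
proof -
  obtain s where s: "\<And>i. sb_integrable M (s i)"
      "(\<lambda>i::nat. \<integral>\<^sup>+ x. ennreal (norm (F x - s i x)) \<partial>M) \<longlonglongrightarrow> 0"
      "(\<lambda>i. sb_integral M (s i)) \<longlonglongrightarrow> y"
    using assms(3) unfolding has_strong_integral_def by blast
  obtain t where t: "\<And>i. sb_integrable M (t i)"
      "(\<lambda>i::nat. \<integral>\<^sup>+ x. ennreal (norm (G x - t i x)) \<partial>M) \<longlonglongrightarrow> 0"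
      "(\<lambda>i. sb_integral M (t i)) \<longlonglongrightarrow> z"
    using assms(4) unfolding has_strong_integral_def by blast
  have l: "(\<lambda>i. ennreal (norm (sb_integral M (s i)
      - sb_integral M (t i)))) \<longlonglongrightarrow> ennreal (norm (y - z))"
    by (intro tendsto_ennrealI tendsto_intros s t)
  have r: "(\<lambda>i. (\<integral>\<^sup>+ x. norm (F x - s i x) \<partial>M) + (\<integral>\<^sup>+ x. norm (F x - G x) \<partial>M)
      + (\<integral>\<^sup>+ x. norm (G x - t i x) \<partial>M)) \<longlonglongrightarrow> 0 + (\<integral>\<^sup>+ x. norm (F x - G x) \<partial>M) + 0"
    by (intro tendsto_add tendsto_const s t)
  show ?thesis
    using LIMSEQ_le[OF l r] simple_bochner_integral_dist_le[OF assms(1) s(1) t(1) assms(2)] by simp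
qed

lemma sint_eqI:
  assumes "smeas M F" "has_strong_integral M F y" shows "sint M F = y"
  unfolding sint_def
proof (rule the_equality)
  fix z assume "has_strong_integral M F z"
  from has_strong_integral_dist_le[OF assms(1,1) this assms(2)] show "z = y" by simp
qed fact

text \<open>Pointwise convergence of simple functions is improved to convergence in L1 by truncation
  and dominated convergence; completeness then provides the value.\<close>

lemma has_strong_integral_sint:
  assumes "sintegrable M F" shows "has_strong_integral M F (sint M F)"
proof -
  have sm: "smeas M F" and fin: "(\<integral>\<^sup>+ x. ennreal (norm (F x)) \<partial>M) < \<infinity>"
    using assms unfolding sintegrable_def by auto
  note [measurable] = smeas_borel[OF sm]
  obtain s where s: "\<And>i. simple_function M (s i)" "\<And>x. x \<in> space M \<Longrightarrow> (\<lambda>i::nat. s i x) \<longlonglongrightarrow> F x"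
    using sm unfolding smeas_def by blast
  note [measurable] = borel_measurable_simple_function[OF s(1)]
  \<comment> \<open>The cutoff bounds the approximants by \<open>2 * norm (F x)\<close>. Where
    \<open>F x = 0\<close> it forces the value \<open>0\<close>; elsewhere it is eventually inactive
    because of the factor \<open>2\<close>.\<close>
  define t where "t i x = indicator {x\<in>space M. norm (s i x) \<le> 2 * norm (F x)} x *\<^sub>R s i x" for i x
  have t_simple: "simple_function M (t i)" for i
    unfolding t_def
    by (intro simple_function_compose2[where h="(*\<^sub>R)"] s simple_function_indicator) measurable
  have t_le: "norm (t i x) \<le> 2 * norm (F x)" for i x
    by (auto simp: t_def indicator_def)
  have t_lim: "(\<lambda>i. t i x) \<longlonglongrightarrow> F x" if x: "x \<in> space M" for x
  proof (cases "F x = 0")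
    case True
    then have "t i x = 0" for i using t_le[of i x] by simp
    then show ?thesis using True by simp
  next
    case False
    have "(\<lambda>i. norm (s i x)) \<longlonglongrightarrow> norm (F x)" by (intro tendsto_norm s x)
    then have "\<forall>\<^sub>F i in sequentially. norm (s i x) < 2 * norm (F x)"
      by (rule order_tendstoD) (use False in auto)
    then have "\<forall>\<^sub>F i in sequentially. s i x = t i x"
      by eventually_elim (auto simp: t_def x)
    then show ?thesis by (rule Lim_transform_eventually[OF s(2)[OF x]])
  qed
  have t_int: "sb_integrable M (t i)" for i
  proof (rule simple_bochner_integrableI_bounded[OF t_simple])
    have "(\<integral>\<^sup>+x. norm (t i x) \<partial>M) \<le> (\<integral>\<^sup>+x. 2 * ennreal (norm (F x)) \<partial>M)"
      by (intro nn_integral_mono) (use ennreal_leI[OF t_le, of i] in \<open>simp add: ennreal_mult'\<close>)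
    also have "\<dots> < \<infinity>" using fin by (simp add: nn_integral_cmult ennreal_mult_less_top)
    finally show "(\<integral>\<^sup>+x. norm (t i x) \<partial>M) < \<infinity>" .
  qed
  have lim: "(\<lambda>i. \<integral>\<^sup>+x. ennreal (norm (F x - t i x)) \<partial>M) \<longlonglongrightarrow> 0"
  proof -
    have "(\<lambda>i. \<integral>\<^sup>+x. ennreal (norm (F x - t i x)) \<partial>M) \<longlonglongrightarrow> (\<integral>\<^sup>+x. 0 \<partial>M)"
    proof (rule nn_integral_dominated_convergence[where w="\<lambda>x. 3 * ennreal (norm (F x))"])
      show "(\<lambda>x. ennreal (norm (F x - t i x))) \<in> borel_measurable M" for i
        using smeas_borel[OF smeas_diff[OF sm smeas_simple[OF t_simple]]] by measurable
      show "(\<integral>\<^sup>+x. 3 * ennreal (norm (F x)) \<partial>M) < \<infinity>"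
        using fin by (simp add: nn_integral_cmult ennreal_mult_less_top)
      show "AE x in M. ennreal (norm (F x - t i x)) \<le> 3 * ennreal (norm (F x))" for i
      proof (rule AE_I2)
        fix x
        have "norm (F x - t i x) \<le> norm (F x) + norm (t i x)" by (rule norm_triangle_ineq4)
        then have "norm (F x - t i x) \<le> 3 * norm (F x)" using t_le[of i x] by simp
        then show "ennreal (norm (F x - t i x)) \<le> 3 * ennreal (norm (F x))"
          using ennreal_leI[of "norm (F x - t i x)" "3 * norm (F x)"] by (simp add: ennreal_mult')
      qed
      show "AE x in M. (\<lambda>i. ennreal (norm (F x - t i x))) \<longlonglongrightarrow> 0"
      proof (rule AE_I2)
        fix x assume "x \<in> space M"
        then have "(\<lambda>i. ennreal (norm (F x - t i x))) \<longlonglongrightarrow> ennreal (norm (F x - F x))"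
          by (intro tendsto_ennrealI tendsto_intros t_lim)
        then show "(\<lambda>i. ennreal (norm (F x - t i x))) \<longlonglongrightarrow> 0" by simp
      qed
    qed auto
    then show ?thesis by simp
  qed
  have "Cauchy (\<lambda>i. sb_integral M (t i))"
  proof (rule metric_CauchyI)
    fix e :: real assume e: "0 < e"
    then have "\<forall>\<^sub>F i in sequentially. (\<integral>\<^sup>+x. ennreal (norm (F x - t i x)) \<partial>M) < ennreal (e / 2)"
      by (intro order_tendstoD[OF lim]) simp
    then obtain N where N: "\<And>i. i \<ge> N \<Longrightarrow> (\<integral>\<^sup>+x. ennreal (norm (F x - t i x)) \<partial>M) < ennreal (e / 2)"
      unfolding eventually_sequentially by blast
    show "\<exists>N. \<forall>m\<ge>N. \<forall>n\<ge>N. dist (sb_integral M (t m))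
        (sb_integral M (t n)) < e"
    proof (intro exI[of _ N] allI impI)
      fix m n assume mn: "N \<le> m" "N \<le> n"
      have "ennreal (norm (sb_integral M (t m)
          - sb_integral M (t n)))
        \<le> (\<integral>\<^sup>+x. ennreal (norm (F x - t m x)) \<partial>M) + 0 + (\<integral>\<^sup>+x. ennreal (norm (F x - t n x)) \<partial>M)"
        using simple_bochner_integral_dist_le[OF sm t_int t_int sm, of m n] by simp
      also have "\<dots> < ennreal (e / 2) + 0 + ennreal (e / 2)"
        using N[OF mn(1)] N[OF mn(2)] by (simp add: add_strict_mono)
      also have "\<dots> = ennreal e" using e by (simp flip: ennreal_plus)
      finally show "dist (sb_integral M (t m))
        (sb_integral M (t n)) < e"
        by (simp add: dist_norm ennreal_less_iff)
    qed
  qed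
  then obtain y where y: "(\<lambda>i. sb_integral M (t i)) \<longlonglongrightarrow> y"
    using Cauchy_convergent_iff convergent_def by blast
  have "has_strong_integral M F y"
    unfolding has_strong_integral_def using t_int lim y by (auto intro: smeas_borel sm)
  with sint_eqI[OF sm this] show ?thesis by simp
qed

lemma sintegrable_smeas: "sintegrable M F \<Longrightarrow> smeas M F"
  by (simp add: sintegrable_def)

lemma sintegrableI:
  assumes "smeas M F" "integrable M \<phi>" "\<And>x. x \<in> space M \<Longrightarrow> norm (F x) \<le> \<phi> x"
  shows "sintegrable M F"
proof -
  have "(\<integral>\<^sup>+ x. ennreal (norm (F x)) \<partial>M) \<le> (\<integral>\<^sup>+ x. ennreal (norm (\<phi> x)) \<partial>M)"
    by (intro nn_integral_mono ennreal_leI) (use assms(3) in force)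
  also have "\<dots> < \<infinity>" using assms(2) by (simp add: integrable_iff_bounded)
  finally show ?thesis using assms(1) by (simp add: sintegrable_def)
qed

lemma sint_cong:
  assumes "\<And>x. x \<in> space M \<Longrightarrow> F x = G x" shows "sint M F = sint M G"
proof -
  have "has_strong_integral M F y = has_strong_integral M G y" for y
    unfolding has_strong_integral_def
    using assms by (simp cong: measurable_cong nn_integral_cong)
  then show ?thesis by (simp add: sint_def)
qed

lemma has_strong_integral_simple:
  assumes "sb_integrable M s"
  shows "has_strong_integral M s (sb_integral M s)"
  unfolding has_strong_integral_def using assms
  by (auto intro!: exI[of _ "\<lambda>_. s"] borel_measurable_simple_function
     elim: simple_bochner_integrable.cases simp flip: zero_ennreal_def)

lemma sintegrable_zero [simp]: "sintegrable M (\<lambda>_. 0)"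
  by (simp add: sintegrable_def)

lemma sint_zero [simp]: "sint M (\<lambda>_. 0::'b::banach) = 0"
proof -
  have "sb_integrable M (\<lambda>_. 0::'b)"
    by (rule simple_bochner_integrable.intros) auto
  from sint_eqI[OF _ has_strong_integral_simple[OF this]]
  have "sint M (\<lambda>_. 0::'b) = sb_integral M (\<lambda>_. 0::'b)" by simp
  also have "\<dots> = 0"
    unfolding simple_bochner_integral_def by (rule sum.neutral) auto
  finally show ?thesis .
qed

lemma has_strong_integral_bounded_linear:
  assumes L: "bounded_linear L" and sm: "smeas M F" and "has_strong_integral M F y"
  shows "has_strong_integral M (\<lambda>x. L (F x)) (L y)"
proof -
  interpret L: bounded_linear L by fact
  obtain s where s: "\<And>i. sb_integrable M (s i)"
      "(\<lambda>i::nat. \<integral>\<^sup>+ x. ennreal (norm (F x - s i x)) \<partial>M) \<longlonglongrightarrow> 0"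
      "(\<lambda>i. sb_integral M (s i)) \<longlonglongrightarrow> y"
    using assms(3) unfolding has_strong_integral_def by blast
  have ss: "smeas M (s i)" for i
    using s(1)[of i] by (auto intro!: smeas_simple elim: simple_bochner_integrable.cases)
  obtain K where K: "K > 0" "\<And>x. norm (L x) \<le> norm x * K" using L.pos_bounded by blast
  show ?thesis
    unfolding has_strong_integral_def
  proof (intro conjI exI[of _ "\<lambda>i x. L (s i x)"] allI)
    show "(\<lambda>x. L (F x)) \<in> borel_measurable M" by (rule smeas_borel[OF smeas_bounded_linear[OF L sm]])
    show "sb_integrable M (\<lambda>x. L (s i x))" for i
      using s(1)[of i] by (auto intro: simple_bochner_integrable_compose2 L.zero)
    show "(\<lambda>i. sb_integral M (\<lambda>x. L (s i x))) \<longlonglongrightarrow> L y"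
      using L.tendsto[OF s(3)]
      by (simp add: simple_bochner_integral_linear[OF L.linear s(1)])
    show "(\<lambda>i. \<integral>\<^sup>+ x. ennreal (norm (L (F x) - L (s i x))) \<partial>M) \<longlonglongrightarrow> 0"
    proof (rule tendsto_sandwich[OF _ _ tendsto_const])
      show "\<forall>\<^sub>F i in sequentially. (\<integral>\<^sup>+ x. ennreal (norm (L (F x) - L (s i x))) \<partial>M)
          \<le> ennreal K * (\<integral>\<^sup>+ x. ennreal (norm (F x - s i x)) \<partial>M)"
      proof (intro always_eventually allI)
        fix i
        have [measurable]: "(\<lambda>x. F x - s i x) \<in> borel_measurable M" by (intro smeas_borel smeas_diff sm ss)
        have "(\<integral>\<^sup>+ x. ennreal (norm (L (F x) - L (s i x))) \<partial>M)
          \<le> (\<integral>\<^sup>+ x. ennreal K * ennreal (norm (F x - s i x)) \<partial>M)"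
        proof (rule nn_integral_mono)
          fix x
          have "norm (L (F x) - L (s i x)) \<le> K * norm (F x - s i x)"
            using K(2)[of "F x - s i x"] by (simp add: L.diff mult.commute)
          from ennreal_leI[OF this] show "ennreal (norm (L (F x) - L (s i x))) \<le> ennreal K * ennreal (norm (F x - s i x))"
            using K(1) by (simp add: ennreal_mult)
        qed
        also have "\<dots> = ennreal K * (\<integral>\<^sup>+ x. ennreal (norm (F x - s i x)) \<partial>M)"
          by (rule nn_integral_cmult) measurable
        finally show "(\<integral>\<^sup>+ x. ennreal (norm (L (F x) - L (s i x))) \<partial>M)
          \<le> ennreal K * (\<integral>\<^sup>+ x. ennreal (norm (F x - s i x)) \<partial>M)" .
      qed
      show "(\<lambda>i. ennreal K * (\<integral>\<^sup>+ x. ennreal (norm (F x - s i x)) \<partial>M)) \<longlonglongrightarrow> 0"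
        using ennreal_tendsto_cmult[OF _ s(2), of "ennreal K"] by simp
    qed auto
  qed
qed

lemma sintegrable_bounded_linear:
  assumes L: "bounded_linear L" and F: "sintegrable M F"
  shows "sintegrable M (\<lambda>x. L (F x))"
proof -
  interpret L: bounded_linear L by fact
  obtain K where K: "K > 0" "\<And>x. norm (L x) \<le> norm x * K" using L.pos_bounded by blast
  have sm: "smeas M F" using F by (rule sintegrable_smeas)
  note [measurable] = smeas_borel[OF sm]
  have "(\<integral>\<^sup>+ x. ennreal (norm (L (F x))) \<partial>M) \<le> (\<integral>\<^sup>+ x. ennreal K * ennreal (norm (F x)) \<partial>M)"
  proof (rule nn_integral_mono)
    fix x
    have "norm (L (F x)) \<le> K * norm (F x)" using K(2)[of "F x"] by (simp add: mult.commute)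
    from ennreal_leI[OF this] show "ennreal (norm (L (F x))) \<le> ennreal K * ennreal (norm (F x))"
      using K(1) by (simp add: ennreal_mult)
  qed
  also have "\<dots> < \<infinity>"
    using F by (simp add: nn_integral_cmult sintegrable_def ennreal_mult_less_top)
  finally show ?thesis
    unfolding sintegrable_def using smeas_bounded_linear[OF L sm] by simp
qed

lemma sint_bounded_linear:
  assumes L: "bounded_linear L" and F: "sintegrable M F"
  shows "sint M (\<lambda>x. L (F x)) = L (sint M F)"
proof (rule sint_eqI)
  have sm: "smeas M F" using F by (rule sintegrable_smeas)
  show "smeas M (\<lambda>x. L (F x))" by (rule smeas_bounded_linear[OF L sm])
  show "has_strong_integral M (\<lambda>x. L (F x)) (L (sint M F))"
    by (rule has_strong_integral_bounded_linear[OF L sm has_strong_integral_sint[OF F]])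
qed

lemma sintegrable_add:
  assumes F: "sintegrable M F" and G: "sintegrable M G"
  shows "sintegrable M (\<lambda>x. F x + G x)"
proof -
  note [measurable] = smeas_borel[OF sintegrable_smeas[OF F]] smeas_borel[OF sintegrable_smeas[OF G]]
  have "(\<integral>\<^sup>+ x. ennreal (norm (F x + G x)) \<partial>M) \<le> (\<integral>\<^sup>+ x. ennreal (norm (F x)) + ennreal (norm (G x)) \<partial>M)"
    by (intro nn_integral_mono) (auto simp flip: ennreal_plus intro!: ennreal_leI norm_triangle_ineq)
  also have "\<dots> < \<infinity>" using F G by (subst nn_integral_add) (auto simp: sintegrable_def)
  finally show ?thesis using F G by (simp add: sintegrable_def smeas_add)
qed

lemma sint_add:
  assumes F: "sintegrable M F" and G: "sintegrable M G"
  shows "sint M (\<lambda>x. F x + G x) = sint M F + sint M G"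
proof (rule sint_eqI)
  have sm: "smeas M F" "smeas M G" using F G by (auto intro: sintegrable_smeas)
  then show "smeas M (\<lambda>x. F x + G x)" by (rule smeas_add)
  obtain s where s: "\<And>i. sb_integrable M (s i)"
      "(\<lambda>i::nat. \<integral>\<^sup>+ x. ennreal (norm (F x - s i x)) \<partial>M) \<longlonglongrightarrow> 0"
      "(\<lambda>i. sb_integral M (s i)) \<longlonglongrightarrow> sint M F"
    using has_strong_integral_sint[OF F] unfolding has_strong_integral_def by blast
  obtain t where t: "\<And>i. sb_integrable M (t i)"
      "(\<lambda>i::nat. \<integral>\<^sup>+ x. ennreal (norm (G x - t i x)) \<partial>M) \<longlonglongrightarrow> 0"
      "(\<lambda>i. sb_integral M (t i)) \<longlonglongrightarrow> sint M G"
    using has_strong_integral_sint[OF G] unfolding has_strong_integral_def by blast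
  have st: "smeas M (s i)" "smeas M (t i)" for i
    using s(1)[of i] t(1)[of i]
    by (auto intro!: smeas_simple elim: simple_bochner_integrable.cases)
  have [measurable]: "(\<lambda>x. F x - s i x) \<in> borel_measurable M" "(\<lambda>x. G x - t i x) \<in> borel_measurable M" for i
    by (intro smeas_borel smeas_diff sm st)+
  show "has_strong_integral M (\<lambda>x. F x + G x) (sint M F + sint M G)"
    unfolding has_strong_integral_def
  proof (intro conjI exI[of _ "\<lambda>i x. s i x + t i x"] allI)
    show "(\<lambda>x. F x + G x) \<in> borel_measurable M" by (intro smeas_borel smeas_add sm)
    show "sb_integrable M (\<lambda>x. s i x + t i x)" for i
      using s(1)[of i] t(1)[of i] by (auto intro: simple_bochner_integrable_compose2)
    show "(\<lambda>i. sb_integral M (\<lambda>x. s i x + t i x)) \<longlonglongrightarrow> sint M F + sint M G"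
      using tendsto_add[OF s(3) t(3)]
      by (simp add: simple_bochner_integral_add[OF s(1) t(1)])
    show "(\<lambda>i. \<integral>\<^sup>+ x. ennreal (norm (F x + G x - (s i x + t i x))) \<partial>M) \<longlonglongrightarrow> 0"
    proof (rule tendsto_sandwich[OF _ _ tendsto_const])
      show "\<forall>\<^sub>F i in sequentially. (\<integral>\<^sup>+ x. ennreal (norm (F x + G x - (s i x + t i x))) \<partial>M)
          \<le> (\<integral>\<^sup>+ x. ennreal (norm (F x - s i x)) \<partial>M) + (\<integral>\<^sup>+ x. ennreal (norm (G x - t i x)) \<partial>M)"
      proof (intro always_eventually allI)
        fix i
        have "(\<integral>\<^sup>+ x. ennreal (norm (F x + G x - (s i x + t i x))) \<partial>M)
          \<le> (\<integral>\<^sup>+ x. ennreal (norm (F x - s i x)) + ennreal (norm (G x - t i x)) \<partial>M)"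
          by (intro nn_integral_mono)
             (auto simp flip: ennreal_plus intro!: ennreal_leI norm_diff_triangle_ineq)
        also have "\<dots> = (\<integral>\<^sup>+ x. ennreal (norm (F x - s i x)) \<partial>M) + (\<integral>\<^sup>+ x. ennreal (norm (G x - t i x)) \<partial>M)"
          by (rule nn_integral_add) measurable
        finally show "(\<integral>\<^sup>+ x. ennreal (norm (F x + G x - (s i x + t i x))) \<partial>M)
          \<le> (\<integral>\<^sup>+ x. ennreal (norm (F x - s i x)) \<partial>M) + (\<integral>\<^sup>+ x. ennreal (norm (G x - t i x)) \<partial>M)" .
      qed
      show "(\<lambda>i. (\<integral>\<^sup>+ x. ennreal (norm (F x - s i x)) \<partial>M) + (\<integral>\<^sup>+ x. ennreal (norm (G x - t i x)) \<partial>M)) \<longlonglongrightarrow> 0"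
        using tendsto_add[OF s(2) t(2)] by simp
    qed auto
  qed
qed

lemma sintegrable_minus: "sintegrable M F \<Longrightarrow> sintegrable M (\<lambda>x. - F x)"
  by (rule sintegrable_bounded_linear[OF bounded_linear_minus[OF bounded_linear_ident]])

lemma sintegrable_diff: "sintegrable M F \<Longrightarrow> sintegrable M G \<Longrightarrow> sintegrable M (\<lambda>x. F x - G x)"
  using sintegrable_add[OF _ sintegrable_minus, of M F G] by simp

lemma sint_diff:
  assumes "sintegrable M F" "sintegrable M G"
  shows "sint M (\<lambda>x. F x - G x) = sint M F - sint M G"
  using sint_add[OF assms(1) sintegrable_minus[OF assms(2)]]
    sint_bounded_linear[OF bounded_linear_minus[OF bounded_linear_ident] assms(2)] by simp

lemma sintegrable_sum:
  "(\<And>j. j \<in> J \<Longrightarrow> sintegrable M (F j)) \<Longrightarrow> sintegrable M (\<lambda>x. \<Sum>j\<in>J. F j x)"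
  by (induction J rule: infinite_finite_induct) (auto intro: sintegrable_add)

lemma sint_sum:
  "(\<And>j. j \<in> J \<Longrightarrow> sintegrable M (F j)) \<Longrightarrow> sint M (\<lambda>x. \<Sum>j\<in>J. F j x) = (\<Sum>j\<in>J. sint M (F j))"
  by (induction J rule: infinite_finite_induct) (auto simp: sint_add sintegrable_sum)

lemma norm_sint_le:
  assumes "smeas M F" "integrable M \<phi>" "\<And>x. x \<in> space M \<Longrightarrow> norm (F x) \<le> \<phi> x"
  shows "norm (sint M F) \<le> integral\<^sup>L M \<phi>"
proof -
  have F: "sintegrable M F" by (rule sintegrableI[OF assms])
  have "ennreal (norm (sint M F - sint M (\<lambda>_. 0))) \<le> (\<integral>\<^sup>+ x. ennreal (norm (F x - 0)) \<partial>M)"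
    by (intro has_strong_integral_dist_le sintegrable_smeas F has_strong_integral_sint sintegrable_zero)
  also have "\<dots> \<le> (\<integral>\<^sup>+ x. ennreal (\<phi> x) \<partial>M)"
    by (intro nn_integral_mono ennreal_leI) (use assms(3) in auto)
  also have "\<dots> = ennreal (integral\<^sup>L M \<phi>)"
    by (rule nn_integral_eq_integral[OF assms(2)], rule AE_I2)
       (use assms(3) norm_ge_zero order_trans in blast)
  finally have "ennreal (norm (sint M F)) \<le> ennreal (integral\<^sup>L M \<phi>)" by simp
  moreover have "0 \<le> integral\<^sup>L M \<phi>"
    by (rule integral_nonneg_AE, rule AE_I2) (use assms(3) norm_ge_zero order_trans in blast)
  ultimately show ?thesis by (simp add: ennreal_le_iff)
qed

text \<open>On second countable targets both integrals have the same defining sequences. Together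
  with \<open>sint_bounded_linear\<close> this evaluates the integral of a scalar function times a
  fixed vector.\<close>

lemma
  fixes \<phi> :: "'s \<Rightarrow> 'b::{banach, second_countable_topology}"
  assumes "integrable M \<phi>"
  shows sintegrable_of_integrable: "sintegrable M \<phi>"
    and sint_eq_integral: "sint M \<phi> = integral\<^sup>L M \<phi>"
proof -
  show s: "sintegrable M \<phi>"
    using assms by (auto simp: sintegrable_def integrable_iff_bounded intro: smeas_of_borel)
  have "has_strong_integral M \<phi> (integral\<^sup>L M \<phi>)"
    using has_bochner_integral_integrable[OF assms]
    unfolding has_strong_integral_def has_bochner_integral.simps by blast
  then show "sint M \<phi> = integral\<^sup>L M \<phi>" by (intro sint_eqI sintegrable_smeas s)
qed

lemma sint_scaleC_const:
  fixes \<phi> :: "'s \<Rightarrow> complex"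
  assumes "integrable M \<phi>"
  shows sintegrable_scaleC_const: "sintegrable M (\<lambda>x. \<phi> x *\<^sub>C v)"
    and "sint M (\<lambda>x. \<phi> x *\<^sub>C v) = (integral\<^sup>L M \<phi>) *\<^sub>C v"
  using sint_bounded_linear[OF scaleC.bounded_linear_left sintegrable_of_integrable[OF assms], of v]
    sintegrable_bounded_linear[OF scaleC.bounded_linear_left sintegrable_of_integrable[OF assms], of v]
  by (auto simp: sint_eq_integral[OF assms])

text \<open>Dominated convergence, reduced to the scalar case for
  \<open>norm (F i x - G x)\<close>.\<close>

lemma sint_tendsto:
  assumes F: "\<And>i::nat. smeas M (F i)" and G: "smeas M G" and \<phi>: "integrable M \<phi>"
    and le: "\<And>i x. x \<in> space M \<Longrightarrow> norm (F i x) \<le> \<phi> x"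
    and lim: "\<And>x. x \<in> space M \<Longrightarrow> (\<lambda>i. F i x) \<longlonglongrightarrow> G x"
  shows "(\<lambda>i. sint M (F i)) \<longlonglongrightarrow> sint M G"
proof -
  have leG: "norm (G x) \<le> \<phi> x" if "x \<in> space M" for x
    by (rule Lim_norm_ubound[OF _ lim[OF that]]) (auto simp: le that)
  have int: "sintegrable M (F i)" "sintegrable M G" for i
    by (rule sintegrableI[OF F \<phi> le] sintegrableI[OF G \<phi> leG]; assumption)+
  have [measurable]: "(\<lambda>x. F i x - G x) \<in> borel_measurable M" for i
    by (intro smeas_borel smeas_diff F G)
  have i2: "integrable M (\<lambda>x. norm (F i x - G x))" for i
  proof (rule Bochner_Integration.integrable_bound[where f="\<lambda>x. 2 * \<phi> x"])
    show "AE x in M. norm (norm (F i x - G x)) \<le> norm (2 * \<phi> x)"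
    proof (rule AE_I2)
      fix x assume "x \<in> space M"
      with le[OF this, of i] leG[OF this] norm_triangle_ineq4[of "F i x" "G x"]
      show "norm (norm (F i x - G x)) \<le> norm (2 * \<phi> x)" by simp
    qed
  qed (use \<phi> in auto)
  have "(\<lambda>i. LINT x|M. norm (F i x - G x)) \<longlonglongrightarrow> (LINT x|M. 0)"
  proof (rule integral_dominated_convergence[where w="\<lambda>x. 2 * \<phi> x"])
    show "AE x in M. (\<lambda>i. norm (F i x - G x)) \<longlonglongrightarrow> 0"
      using lim by (intro AE_I2 tendsto_norm_zero) (auto simp: LIM_zero_iff)
    show "AE x in M. norm (norm (F i x - G x)) \<le> 2 * \<phi> x" for i
    proof (rule AE_I2)
      fix x assume "x \<in> space M"
      with le[OF this, of i] leG[OF this] norm_triangle_ineq4[of "F i x" "G x"]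
      show "norm (norm (F i x - G x)) \<le> 2 * \<phi> x" by simp
    qed
  qed (use \<phi> in auto)
  then have l: "(\<lambda>i. LINT x|M. norm (F i x - G x)) \<longlonglongrightarrow> 0" by simp
  have "norm (sint M (F i) - sint M G) \<le> (LINT x|M. norm (F i x - G x))" for i
    using norm_sint_le[OF smeas_diff[OF F G] i2] by (simp add: sint_diff int)
  then have "(\<lambda>i. sint M (F i) - sint M G) \<longlonglongrightarrow> 0"
    by (intro Lim_null_comparison[OF _ l]) auto
  then show ?thesis by (simp add: LIM_zero_iff)
qed

text \<open>Change of variables. For simple functions it is a finite sum of scalar identities on
  level sets; by \<open>nn\<close> the transfer preserves L1 distances, so the approximants carry it
  to all integrable functions. It serves for translations of Lebesgue measure and for
  \<open>exp_measure\<close>.\<close>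

lemma sint_transfer:
  fixes M :: "'c measure" and N :: "'d measure" and F :: "'c \<Rightarrow> 'b::banach"
  assumes M: "M = distr (density N \<rho>) M \<phi>" and \<phi>[measurable]: "\<phi> \<in> measurable N M"
    and \<rho>: "\<rho> = (\<lambda>x. ennreal (r x))" "r \<in> borel_measurable N" "\<And>x. 0 \<le> r x"
    and F: "sintegrable M F"
  shows "sintegrable N (\<lambda>x. r x *\<^sub>R F (\<phi> x))" "sint N (\<lambda>x. r x *\<^sub>R F (\<phi> x)) = sint M F"
proof -
  note [measurable] = \<rho>(2)
  have \<rho>m[measurable]: "\<rho> \<in> borel_measurable N" unfolding \<rho> by measurable
  have \<phi>'[measurable]: "\<phi> \<in> measurable (density N \<rho>) M" by simp
  have nn: "(\<integral>\<^sup>+ x. ennreal (norm (r x *\<^sub>R H (\<phi> x))) \<partial>N) = (\<integral>\<^sup>+ x. ennreal (norm (H x)) \<partial>M)"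
    if H[measurable]: "H \<in> borel_measurable M" for H :: "'c \<Rightarrow> 'b"
  proof -
    have "(\<integral>\<^sup>+ x. ennreal (norm (H x)) \<partial>M) = (\<integral>\<^sup>+ x. ennreal (norm (H x)) \<partial>distr (density N \<rho>) M \<phi>)"
      by (rule arg_cong[OF M])
    also have "\<dots> = (\<integral>\<^sup>+ x. ennreal (norm (H (\<phi> x))) \<partial>density N \<rho>)"
      by (rule nn_integral_distr) measurable
    also have "\<dots> = (\<integral>\<^sup>+ x. \<rho> x * ennreal (norm (H (\<phi> x))) \<partial>N)"
      by (rule nn_integral_density) measurable
    also have "\<dots> = (\<integral>\<^sup>+ x. ennreal (norm (r x *\<^sub>R H (\<phi> x))) \<partial>N)"
      by (intro nn_integral_cong) (simp add: \<rho> ennreal_mult)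
    finally show ?thesis by simp
  qed
  have sm: "smeas N (\<lambda>x. r x *\<^sub>R H (\<phi> x))" if H: "smeas M H" for H :: "'c \<Rightarrow> 'b"
    by (intro smeas_scaleR smeas_of_borel \<rho> smeas_compose[OF H \<phi>])
  have int: "sintegrable N (\<lambda>x. r x *\<^sub>R H (\<phi> x))" if H: "sintegrable M H" for H :: "'c \<Rightarrow> 'b"
    using H sm[of H] unfolding sintegrable_def by (metis nn smeas_borel)
  show "sintegrable N (\<lambda>x. r x *\<^sub>R F (\<phi> x))" by (rule int[OF F])
  have simp: "sint N (\<lambda>x. r x *\<^sub>R s (\<phi> x)) = sb_integral M s"
    if s: "sb_integrable M s" for s :: "'c \<Rightarrow> 'b"
  proof -
    have sf: "simple_function M s" and fin: "emeasure M {y\<in>space M. s y \<noteq> 0} \<noteq> \<infinity>"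
      using s by (auto elim: simple_bochner_integrable.cases)
    define A where "A v = {x\<in>space M. s x = v}" for v
    have A[measurable]: "A v \<in> sets M" for v
    proof -
      have "A v = s -` {v} \<inter> space M" by (auto simp: A_def)
      then show ?thesis using simple_functionD(2)[OF sf] by simp
    qed
    have finA: "emeasure M (A v) < \<infinity>" if "v \<noteq> 0" for v
    proof -
      have "{y\<in>space M. s y \<noteq> 0} = space M - A 0" by (auto simp: A_def)
      then have "{y\<in>space M. s y \<noteq> 0} \<in> sets M" by simp
      then have "emeasure M (A v) \<le> emeasure M {y\<in>space M. s y \<noteq> 0}"
        using that by (intro emeasure_mono) (auto simp: A_def)
      also have "\<dots> < \<infinity>" using fin by (simp add: less_top)
      finally show ?thesis .
    qed
    have i1: "integrable N (\<lambda>x. r x * indicator (A v) (\<phi> x))"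
        "(LINT x|N. r x * indicator (A v) (\<phi> x)) = measure M (A v)" if "v \<noteq> 0" for v
    proof -
      have "integrable M (indicator (A v) :: 'c \<Rightarrow> real)"
        using has_bochner_integral_real_indicator[OF A finA[OF that]] by (simp add: has_bochner_integral_iff)
      then have "integrable (density N \<rho>) (\<lambda>x. indicator (A v) (\<phi> x) :: real)"
        by (subst (asm) M, subst (asm) integrable_distr_eq) auto
      then show "integrable N (\<lambda>x. r x * indicator (A v) (\<phi> x))"
        unfolding \<rho> by (subst (asm) integrable_density) (auto simp: \<rho>(3))
      have "measure M (A v) = (LINT x|M. indicator (A v) x)"
        using sets.sets_into_space[OF A] by (simp add: Int_absorb1)
      also have "\<dots> = (LINT x|density N \<rho>. indicator (A v) (\<phi> x))"
        by (subst M, subst integral_distr) auto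
      also have "\<dots> = (LINT x|N. r x * indicator (A v) (\<phi> x))"
        unfolding \<rho> by (subst integral_density) (auto simp: \<rho>(3))
      finally show "(LINT x|N. r x * indicator (A v) (\<phi> x)) = measure M (A v)" by simp
    qed
    \<comment> \<open>The level set of \<open>0\<close> may have infinite measure. Its term is
      multiplied by the vector \<open>0\<close>, so both sides vanish.\<close>
    have i2: "sintegrable N (\<lambda>x. (r x * indicator (A v) (\<phi> x)) *\<^sub>R v)"
        "sint N (\<lambda>x. (r x * indicator (A v) (\<phi> x)) *\<^sub>R v) = measure M (A v) *\<^sub>R v" for v
    proof -
      show "sintegrable N (\<lambda>x. (r x * indicator (A v) (\<phi> x)) *\<^sub>R v)"
      proof (cases "v = 0")
        case False
        show ?thesis
          by (rule sintegrable_bounded_linear[OF bounded_linear_scaleR_left sintegrable_of_integrable])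
             (use i1[OF False] in blast)
      qed simp
      show "sint N (\<lambda>x. (r x * indicator (A v) (\<phi> x)) *\<^sub>R v) = measure M (A v) *\<^sub>R v"
      proof (cases "v = 0")
        case False
        note b = i1[OF False]
        show ?thesis
          using sint_bounded_linear[OF bounded_linear_scaleR_left sintegrable_of_integrable[OF b(1)], of v]
          by (simp add: sint_eq_integral[OF b(1)] b(2))
      qed simp
    qed
    have "sint N (\<lambda>x. r x *\<^sub>R s (\<phi> x))
      = sint N (\<lambda>x. \<Sum>v\<in>s ` space M. (r x * indicator (A v) (\<phi> x)) *\<^sub>R v)"
    proof (rule sint_cong)
      fix x assume "x \<in> space N"
      then have x: "\<phi> x \<in> space M" using measurable_space[OF \<phi>] by auto
      have "(\<Sum>v\<in>s ` space M. (r x * indicator (A v) (\<phi> x)) *\<^sub>R v)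
        = (\<Sum>v\<in>{s (\<phi> x)}. (r x * indicator (A v) (\<phi> x)) *\<^sub>R v)"
        using x simple_functionD(1)[OF sf] by (intro sum.mono_neutral_right) (auto simp: A_def)
      then show "r x *\<^sub>R s (\<phi> x) = (\<Sum>v\<in>s ` space M. (r x * indicator (A v) (\<phi> x)) *\<^sub>R v)"
        using x by (simp add: A_def)
    qed
    also have "\<dots> = (\<Sum>v\<in>s ` space M. measure M (A v) *\<^sub>R v)"
      by (simp add: sint_sum i2)
    finally show ?thesis
      by (simp add: simple_bochner_integral_def A_def)
  qed
  obtain s where s: "\<And>i. sb_integrable M (s i)"
      "(\<lambda>i::nat. \<integral>\<^sup>+ x. ennreal (norm (F x - s i x)) \<partial>M) \<longlonglongrightarrow> 0"
      "(\<lambda>i. sb_integral M (s i)) \<longlonglongrightarrow> sint M F"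
    using has_strong_integral_sint[OF F] unfolding has_strong_integral_def by blast
  have ssm: "smeas M (s i)" for i
    using s(1)[of i] by (auto intro!: smeas_simple elim: simple_bochner_integrable.cases)
  have sint_s: "sintegrable M (s i)" for i
  proof -
    have "sb_integrable M (\<lambda>x. norm (s i x))"
      using s(1)[of i] by (auto intro: simple_bochner_integrable_compose2)
    from simple_bochner_integral_eq_nn_integral[OF this]
    have "(\<integral>\<^sup>+ x. ennreal (norm (s i x)) \<partial>M)
      = ennreal (sb_integral M (\<lambda>x. norm (s i x)))" by simp
    then show ?thesis using ssm by (simp add: sintegrable_def)
  qed
  have "(\<lambda>i. sint N (\<lambda>x. r x *\<^sub>R s i (\<phi> x))) \<longlonglongrightarrow> sint N (\<lambda>x. r x *\<^sub>R F (\<phi> x))"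
  proof (rule Lim_transform2[OF tendsto_const], rule tendsto_norm_zero_cancel)
    have "(\<lambda>i. ennreal (norm (sint N (\<lambda>x. r x *\<^sub>R F (\<phi> x)) - sint N (\<lambda>x. r x *\<^sub>R s i (\<phi> x))))) \<longlonglongrightarrow> ennreal 0"
    proof (rule tendsto_sandwich[OF _ _ tendsto_const])
      show "\<forall>\<^sub>F i in sequentially. ennreal (norm (sint N (\<lambda>x. r x *\<^sub>R F (\<phi> x)) - sint N (\<lambda>x. r x *\<^sub>R s i (\<phi> x))))
          \<le> (\<integral>\<^sup>+ x. ennreal (norm (F x - s i x)) \<partial>M)"
      proof (intro always_eventually allI)
        fix i
        have "ennreal (norm (sint N (\<lambda>x. r x *\<^sub>R F (\<phi> x)) - sint N (\<lambda>x. r x *\<^sub>R s i (\<phi> x))))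
          \<le> (\<integral>\<^sup>+ x. ennreal (norm (r x *\<^sub>R F (\<phi> x) - r x *\<^sub>R s i (\<phi> x))) \<partial>N)"
          by (intro has_strong_integral_dist_le sm ssm sintegrable_smeas F has_strong_integral_sint int sint_s)
        also have "\<dots> = (\<integral>\<^sup>+ x. ennreal (norm (F x - s i x)) \<partial>M)"
          using nn[of "\<lambda>x. F x - s i x"] smeas_borel[OF smeas_diff[OF sintegrable_smeas[OF F] ssm]]
          by (simp add: scaleR_diff_right)
        finally show "ennreal (norm (sint N (\<lambda>x. r x *\<^sub>R F (\<phi> x)) - sint N (\<lambda>x. r x *\<^sub>R s i (\<phi> x))))
          \<le> (\<integral>\<^sup>+ x. ennreal (norm (F x - s i x)) \<partial>M)" .
      qed
    qed (use s(2) in auto)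
    then show "(\<lambda>i. norm (sint N (\<lambda>x. r x *\<^sub>R F (\<phi> x)) - sint N (\<lambda>x. r x *\<^sub>R s i (\<phi> x)))) \<longlonglongrightarrow> 0"
      by (subst (asm) tendsto_ennreal_iff) auto
  qed
  with s(3) show "sint N (\<lambda>x. r x *\<^sub>R F (\<phi> x)) = sint M F"
    by (simp add: simp[OF s(1)] LIMSEQ_unique)
qed

section \<open>Approximation by exponential sums\<close>

text \<open>Bernstein's proof uses that the weights are nonnegative, have sum \<open>1\<close> and
  variance \<open>x (1 - x) / n\<close>, and it looks at \<open>g\<close> only through norms of
  differences. It thus carries over from real to vector values.\<close>

lemma Bernstein_Weierstrass_vector:
  fixes g :: "real \<Rightarrow> 'b::real_normed_vector"
  assumes g: "continuous_on {0..1} g" and e: "0 < e"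
  shows "\<exists>n. \<forall>x\<in>{0..1}. norm (g x - (\<Sum>k\<le>n. Bernstein n k x *\<^sub>R g (k / n))) < e"
proof -
  have "bounded (g ` {0..1})"
    using compact_continuous_image compact_imp_bounded g by blast
  then obtain M where M: "M > 0" "\<And>x. x \<in> {0..1} \<Longrightarrow> norm (g x) \<le> M"
    by (auto simp: bounded_pos)
  have "uniformly_continuous_on {0..1} g"
    using compact_uniformly_continuous g by blast
  then obtain d where d: "d > 0" "\<And>x x'. x \<in> {0..1} \<Longrightarrow> x' \<in> {0..1} \<Longrightarrow> \<bar>x' - x\<bar> < d \<Longrightarrow> norm (g x' - g x) < e / 2"
    using e by (auto simp: uniformly_continuous_on_def dist_norm dest!: spec[of _ "e / 2"])
  \<comment> \<open>Chosen so that the contribution \<open>2 M / (d^2 n)\<close> of the nodes far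
    from \<open>x\<close> stays below \<open>e / 2\<close>.\<close>
  obtain n :: nat where n: "real n > 4 * M / (e * d\<^sup>2)"
    using reals_Archimedean2 by blast
  have n0: "0 < real n"
    using n M e d by (smt (verit) divide_nonneg_nonneg mult_nonneg_nonneg zero_le_power2)
  show ?thesis
  proof (intro exI[of _ n] ballI)
    fix x :: real assume x: "x \<in> {0..1}"
    have B0: "0 \<le> Bernstein n k x" for k using x by (auto intro: Bernstein_nonneg)
    have var: "(\<Sum>k\<le>n. Bernstein n k x * (x - k / n)\<^sup>2) = x * (1 - x) / n"
    proof -
      have "(\<Sum>k\<le>n. Bernstein n k x * (x - k / n)\<^sup>2) =
        (\<Sum>k\<le>n. x\<^sup>2 * Bernstein n k x + (1 / (real n)\<^sup>2 - 2 * x / n) * (k * Bernstein n k x)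
          + 1 / (real n)\<^sup>2 * (k * (real k - 1) * Bernstein n k x))"
        by (rule sum.cong) (use n0 in \<open>auto simp: field_simps power2_eq_square\<close>)
      also have "\<dots> = x\<^sup>2 * (\<Sum>k\<le>n. Bernstein n k x) + (1 / (real n)\<^sup>2 - 2 * x / n) * (\<Sum>k\<le>n. k * Bernstein n k x)
          + 1 / (real n)\<^sup>2 * (\<Sum>k\<le>n. k * (real k - 1) * Bernstein n k x)"
        by (simp only: sum.distrib sum_distrib_left)
      also have "\<dots> = x * (1 - x) / n"
        using n0 by (simp only: sum_Bernstein sum_k_Bernstein sum_kk_Bernstein)
          (simp add: field_simps power2_eq_square)
      finally show ?thesis .
    qed
    \<comment> \<open>Chebyshev's device: for nodes at distance at least \<open>d\<close> the
      trivial bound \<open>2 M\<close> is multiplied by \<open>(x - k / n)^2 / d^2\<close>, which is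
      at least \<open>1\<close>; the variance then sums it up.\<close>
    have close: "norm (g x - g (k / n)) \<le> e / 2 + 2 * M / d\<^sup>2 * (x - k / n)\<^sup>2" if "k \<le> n" for k
    proof -
      have kn: "real k / real n \<in> {0..1}" using that n0 by (auto simp: field_simps)
      show ?thesis
      proof (cases "\<bar>x - k / n\<bar> < d")
        case True
        then have "norm (g x - g (k / n)) < e / 2" using d(2)[OF kn x] by simp
        moreover have "0 \<le> 2 * M / d\<^sup>2 * (x - k / n)\<^sup>2" using M by simp
        ultimately show ?thesis by linarith
      next
        case False
        then have "d\<^sup>2 \<le> (x - k / n)\<^sup>2"
          using d(1) by (metis abs_le_square_iff abs_of_pos not_less)
        then have "2 * M * 1 \<le> 2 * M * ((x - k / n)\<^sup>2 / d\<^sup>2)"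
          using M d(1) by (intro mult_left_mono) auto
        moreover have "norm (g x - g (k / n)) \<le> 2 * M"
          using norm_triangle_ineq4[of "g x" "g (k / n)"] M(2)[OF x] M(2)[OF kn] by linarith
        ultimately show ?thesis using e by simp
      qed
    qed
    have "g x - (\<Sum>k\<le>n. Bernstein n k x *\<^sub>R g (k / n)) = (\<Sum>k\<le>n. Bernstein n k x *\<^sub>R (g x - g (k / n)))"
      by (simp add: scaleR_diff_right sum_subtractf flip: scaleR_left.sum)
    also have "norm \<dots> \<le> (\<Sum>k\<le>n. Bernstein n k x * (e / 2 + 2 * M / d\<^sup>2 * (x - k / n)\<^sup>2))"
      by (rule sum_norm_le) (use close B0 in \<open>auto intro!: mult_left_mono\<close>)
    also have "\<dots> = e / 2 * (\<Sum>k\<le>n. Bernstein n k x) + 2 * M / d\<^sup>2 * (\<Sum>k\<le>n. Bernstein n k x * (x - k / n)\<^sup>2)"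
      by (simp add: distrib_left sum.distrib sum_distrib_left sum_distrib_right mult_ac del: sum_Bernstein)
    also have "\<dots> = e / 2 + 2 * M / d\<^sup>2 * (x * (1 - x) / n)"
      by (simp add: var)
    also have "\<dots> \<le> e / 2 + 2 * M / d\<^sup>2 * (1 / n)"
      using M x n0 by (intro add_left_mono mult_left_mono divide_right_mono mult_le_one) auto
    also have "\<dots> < e"
    proof -
      have "4 * M < real n * (e * d\<^sup>2)" using n e d by (simp add: field_simps)
      then have "2 * M / d\<^sup>2 * (1 / n) < e / 2" using e d n0 by (simp add: field_simps)
      then show ?thesis by simp
    qed
    finally show "norm (g x - (\<Sum>k\<le>n. Bernstein n k x *\<^sub>R g (k / n))) < e" .
  qed
qed

text \<open>The substitution \<open>u = exp (- t)\<close> turns polynomials in \<open>u\<close> into exponential sums.\<close>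
lemma exponential_sum_approx:
  fixes g :: "real \<Rightarrow> 'b::real_normed_vector"
  assumes g: "continuous_on {0..} g" and lim: "(g \<longlongrightarrow> 0) at_top" and e: "0 < e"
  obtains J :: "(nat \<times> nat) set" and l v where "finite J" "\<And>j. 0 \<le> l j"
    "\<And>t. 0 \<le> t \<Longrightarrow> norm (g t - (\<Sum>j\<in>J. exp (- (l j * t)) *\<^sub>R v j)) < e"
proof -
  \<comment> \<open>The point \<open>u = 0\<close> corresponds to \<open>t\<close> at infinity,
    where \<open>g\<close> tends to \<open>0\<close>; with this value \<open>G\<close> is continuous
    on the compact interval.\<close>
  define G where "G u = (if u \<le> 0 then 0 else g (- ln u))" for u :: real
  have "continuous_on {0..1} G"
  proof (rule continuous_on_eq_continuous_within[THEN iffD2], rule ballI)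
    fix u :: real assume u: "u \<in> {0..1}"
    show "continuous (at u within {0..1}) G"
    proof (cases "u = 0")
      case True
      have "filterlim (\<lambda>u::real. - ln u) at_top (at_right 0)"
        using ln_at_0 by (simp add: filterlim_uminus_at_bot)
      then have "((\<lambda>u. g (- ln u)) \<longlongrightarrow> 0) (at_right 0)"
        by (rule filterlim_compose[OF lim])
      moreover have "\<forall>\<^sub>F u in at_right (0::real). g (- ln u) = G u"
        by (simp add: eventually_at_filter G_def)
      ultimately have "(G \<longlongrightarrow> 0) (at_right 0)"
        by (rule Lim_transform_eventually)
      then have "(G \<longlongrightarrow> G 0) (at 0 within {0..1})"
        by (simp add: G_def at_within_Icc_at_right)
      then show ?thesis using True by (simp add: continuous_within)
    next
      case False
      with u have u: "0 < u" "u \<le> 1" by auto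
      have "continuous_on {0<..1} (\<lambda>u. g (- ln u))"
        by (rule continuous_on_compose2[OF g]) (auto intro!: continuous_intros)
      then have "continuous_on {0<..1} G"
        by (rule continuous_on_cong[THEN iffD1, rotated -1]) (auto simp: G_def)
      then have "continuous (at u within {0<..1}) G"
        using u by (auto simp: continuous_on_eq_continuous_within)
      moreover have "at u within {0<..1} = at u within {0..1}"
        by (rule at_within_nhd[of _ "{0<..}"]) (use u in auto)
      ultimately show ?thesis by (simp add: continuous_within)
    qed
  qed
  from Bernstein_Weierstrass_vector[OF this e] obtain n where
    n: "\<And>x. x \<in> {0..1} \<Longrightarrow> norm (G x - (\<Sum>k\<le>n. Bernstein n k x *\<^sub>R G (k / n))) < e"
    by blast
  \<comment> \<open>The pair \<open>(k, i)\<close> indexes the monomial \<open>u ^ (k + i)\<close>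
    from the binomial expansion of \<open>(1 - u) ^ (n - k)\<close> in the \<open>k\<close>-th
    Bernstein polynomial; it becomes the frequency \<open>k + i\<close>.\<close>
  define J where "J = Sigma {..n} (\<lambda>k. {..n - k})"
  define l where "l = (\<lambda>(k::nat, i::nat). real (k + i))"
  define v where "v = (\<lambda>(k, i). (real (n choose k) * real ((n - k) choose i) * (- 1) ^ i) *\<^sub>R G (k / n))"
  show ?thesis
  proof (rule that[of J l v])
    fix t :: real assume t: "0 \<le> t"
    define u where "u = exp (- t)"
    have u: "u \<in> {0..1}" "G u = g t" using t by (auto simp: u_def G_def)
    have ul: "exp (- (l (k, i) * t)) = u ^ k * u ^ i" for k i
      by (simp add: l_def u_def algebra_simps flip: exp_of_nat_mult power_add exp_add)
    have B: "Bernstein n k u = (\<Sum>i\<le>n - k. real (n choose k) * real ((n - k) choose i) * (- 1) ^ i * (u ^ k * u ^ i))"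
      for k
    proof -
      have "(1 - u) ^ (n - k) = (- u + 1) ^ (n - k)" by simp
      also have "\<dots> = (\<Sum>i\<le>n - k. real ((n - k) choose i) * (- u) ^ i)"
        by (subst binomial_ring) simp
      finally show ?thesis
        by (simp add: Bernstein_def sum_distrib_left power_minus[of u] mult_ac)
    qed
    have "(\<Sum>j\<in>J. exp (- (l j * t)) *\<^sub>R v j) = (\<Sum>k\<le>n. \<Sum>i\<le>n - k. exp (- (l (k, i) * t)) *\<^sub>R v (k, i))"
      unfolding J_def by (subst sum.Sigma) auto
    also have "\<dots> = (\<Sum>k\<le>n. Bernstein n k u *\<^sub>R G (k / n))"
      unfolding ul B v_def by (simp add: scaleR_left.sum mult_ac)
    finally show "norm (g t - (\<Sum>j\<in>J. exp (- (l j * t)) *\<^sub>R v j)) < e"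
      using n[OF u(1)] by (simp add: u(2))
  qed (auto simp: J_def l_def)
qed

section \<open>Laplace integrals of exponentials over the half-line\<close>

lemma
  assumes a: "0 < a"
  shows integrable_exp_minus: "integrable lborel (\<lambda>t::real. indicator {0..} t * exp (- (a * t)))"
    and integral_exp_minus: "(LBINT t. indicator {0..} t * exp (- (a * t))) = 1 / a"
proof -
  have lim: "((\<lambda>t. - exp (- (a * t)) / a) \<longlongrightarrow> 0) at_top"
    using a by real_asymp
  have "(\<integral>\<^sup>+ t. ennreal (exp (- (a * t))) * indicator {0..} t \<partial>lborel) = ennreal (0 - (- exp (- (a * 0)) / a))"
    by (rule nn_integral_FTC_atLeast[OF _ _ _ lim])
       (use a in \<open>auto intro!: derivative_eq_intros\<close>)
  then have nn: "(\<integral>\<^sup>+ t. ennreal (indicator {0..} t * exp (- (a * t))) \<partial>lborel) = ennreal (1 / a)"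
    by (simp add: nn_integral_set_ennreal mult.commute[of "exp _"])
  have m: "(\<lambda>t::real. indicator {0..} t * exp (- (a * t))) \<in> borel_measurable lborel"
    by measurable
  show "integrable lborel (\<lambda>t::real. indicator {0..} t * exp (- (a * t)))"
    by (rule integrableI_nonneg[OF m]) (auto simp: nn)
  show "(LBINT t. indicator {0..} t * exp (- (a * t))) = 1 / a"
    using integral_eq_nn_integral[OF m] a by (simp add: nn)
qed

lemma
  assumes z: "0 < Re z"
  shows integrable_cexp_minus: "integrable lborel (\<lambda>t::real. indicator {0..} t *\<^sub>R exp (- (z * of_real t)))"
    and integral_cexp_minus: "(LBINT t. indicator {0..} t *\<^sub>R exp (- (z * of_real t))) = 1 / z"
proof -
  show int: "integrable lborel (\<lambda>t::real. indicator {0..} t *\<^sub>R exp (- (z * of_real t)))"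
    by (rule Bochner_Integration.integrable_bound[OF integrable_exp_minus[OF z]])
       (auto simp: norm_exp_eq_Re indicator_def)
  have z0: "z \<noteq> 0" using z by auto
  have d: "((\<lambda>t. - exp (- (z * of_real t)) / z) has_vector_derivative exp (- (z * of_real t))) (at t)" for t
    by (rule has_vector_derivative_real_field) (use z0 in \<open>auto intro!: derivative_eq_intros\<close>)
  have "(LBINT t=ereal 0..\<infinity>. exp (- (z * of_real t))) = 0 - (- exp (- (z * of_real 0)) / z)"
  proof (rule interval_integral_FTC_integrable)
    show "((\<lambda>t. - exp (- (z * of_real t)) / z) has_vector_derivative exp (- (z * of_real t))) (at t)" for t
      by (rule d)
    show "set_integrable lborel (einterval (ereal 0) \<infinity>) (\<lambda>t. exp (- (z * of_real t)))"
      unfolding set_integrable_def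
      by (rule Bochner_Integration.integrable_bound[OF integrable_exp_minus[OF z]])
         (auto simp: norm_exp_eq_Re indicator_def)
    have "isCont (\<lambda>t. - exp (- (z * of_real t)) / z) 0"
      by (rule has_vector_derivative_continuous[OF d])
    then show "(((\<lambda>t. - exp (- (z * of_real t)) / z) \<circ> real_of_ereal) \<longlongrightarrow> - exp (- (z * of_real 0)) / z) (at_right (ereal 0))"
      unfolding ereal_tendsto_simps isCont_def by (rule tendsto_within_subset) simp
    have "((\<lambda>t. - exp (- (z * of_real t)) / z) \<longlongrightarrow> 0) at_top"
    proof (rule tendsto_norm_zero_cancel)
      have "((\<lambda>t. exp (- (Re z * t)) / cmod z) \<longlongrightarrow> 0) at_top"
        using z z0 by real_asymp
      then show "((\<lambda>t. norm (- exp (- (z * of_real t)) / z)) \<longlongrightarrow> 0) at_top"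
        by (simp add: norm_divide norm_exp_eq_Re)
    qed
    then show "(((\<lambda>t. - exp (- (z * of_real t)) / z) \<circ> real_of_ereal) \<longlongrightarrow> 0) (at_left \<infinity>)"
      unfolding ereal_tendsto_simps .
  qed (auto intro!: continuous_intros)
  also have "(LBINT t=ereal 0..\<infinity>. exp (- (z * of_real t))) = (LBINT t. indicator {0<..} t *\<^sub>R exp (- (z * of_real t)))"
    by (simp add: interval_integral_to_infinity_eq set_lebesgue_integral_def)
  also have "\<dots> = (LBINT t. indicator {0..} t *\<^sub>R exp (- (z * of_real t)))"
  proof (rule integral_cong_AE)
    show "AE t in lborel. indicator {0<..} t *\<^sub>R exp (- (z * of_real t)) = indicator {0..} t *\<^sub>R exp (- (z * of_real t))"
      using AE_lborel_singleton[of 0] by eventually_elim (auto simp: indicator_def)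
  qed auto
  finally show "(LBINT t. indicator {0..} t *\<^sub>R exp (- (z * of_real t))) = 1 / z" by simp
qed

text \<open>The retraction \<open>max 0\<close> of the line onto the half-line pulls measurability
  back to Lebesgue measure.\<close>

lemma smeas_halfline:
  fixes G :: "real \<Rightarrow> 'b::real_normed_vector"
  assumes G: "continuous_on {0..} G"
  shows "smeas lborel (\<lambda>r. indicator {0..} r *\<^sub>R G r)"
proof -
  have "smeas (restrict_space borel {0..}) G"
    by (rule smeas_continuous[OF _ _ G]) auto
  moreover have "(\<lambda>r::real. max 0 r) \<in> measurable lborel (restrict_space borel {0..})"
    by (rule measurable_restrict_space2) auto
  ultimately have "smeas lborel (\<lambda>r. G (max 0 r))"
    by (rule smeas_compose)
  then have "smeas lborel (\<lambda>r. indicator {0..} r *\<^sub>R G (max 0 r))"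
    by (intro smeas_scaleR smeas_of_borel) auto
  then show ?thesis
    by (rule smeas_cong[rotated]) (auto simp: indicator_def max_def)
qed

section \<open>Semigroups and resolvents\<close>

locale C0_semigroup =
  fixes T :: "real \<Rightarrow> 'a::complex_banach \<Rightarrow> 'a"
  assumes semigroup: "bounded_C0_semigroup T"
begin

definition "M0 = (SUP t\<in>{0..}. onorm (T t))"

lemma T_linear: "0 \<le> t \<Longrightarrow> bounded_linear (T t)"
  and T_scaleC: "0 \<le> t \<Longrightarrow> T t (c *\<^sub>C x) = c *\<^sub>C T t x"
  and T_0 [simp]: "T 0 x = x"
  and T_add: "0 \<le> s \<Longrightarrow> 0 \<le> t \<Longrightarrow> T (s + t) x = T s (T t x)"
  and T_lim: "((\<lambda>t. T t x) \<longlongrightarrow> x) (at_right 0)"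
  and T_bdd: "bdd_above ((\<lambda>t. onorm (T t)) ` {0..})"
  using semigroup by (auto simp: bounded_C0_semigroup_def bounded_clinear_def)

lemma norm_T: assumes "0 \<le> t" shows "norm (T t x) \<le> M0 * norm x"
proof -
  have "norm (T t x) \<le> onorm (T t) * norm x"
    by (rule onorm[OF T_linear[OF assms]])
  also have "\<dots> \<le> M0 * norm x"
    unfolding M0_def using assms by (intro mult_right_mono cSUP_upper T_bdd) auto
  finally show ?thesis .
qed

lemma M0_nonneg: "0 \<le> M0"
proof -
  have "0 \<le> onorm (T 0)" by (rule onorm_pos_le[OF T_linear]) simp
  also have "\<dots> \<le> M0" unfolding M0_def by (intro cSUP_upper T_bdd) auto
  finally show ?thesis .
qed

lemma T_diff: "0 \<le> t \<Longrightarrow> T t (x - y) = T t x - T t y"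
  using T_linear[of t] by (simp add: bounded_linear.linear linear_diff)

text \<open>For \<open>s \<le> t\<close> the increment is \<open>T s (T (t - s) x - x)\<close>, and
  the uniform bound \<open>M0\<close> turns strong continuity at \<open>0\<close> into uniform
  continuity of the orbit.\<close>

lemma T_continuous: "continuous_on {0..} (\<lambda>t. T t x)"
proof -
  have "uniformly_continuous_on {0..} (\<lambda>t. T t x)"
    unfolding uniformly_continuous_on_def
  proof (intro allI impI)
    fix e :: real assume e: "0 < e"
    define e' where "e' = e / (M0 + 1)"
    have e': "0 < e'" "M0 * e' < e"
      using e M0_nonneg by (auto simp: e'_def field_simps)
    have "\<forall>\<^sub>F t in at_right 0. dist (T t x) x < e'"
      using T_lim[of x] e'(1) by (rule tendstoD)
    then obtain d where d: "0 < d" "\<And>t. 0 < t \<Longrightarrow> t < d \<Longrightarrow> dist (T t x) x < e'"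
      by (auto simp: eventually_at_right_field)
    have *: "norm (T t x - T s x) < e" if "0 \<le> s" "s \<le> t" "t - s < d" for s t
    proof (cases "s = t")
      case False
      have "T t x - T s x = T s (T (t - s) x - x)"
        using that T_add[of s "t - s" x] by (simp add: T_diff)
      also have "norm \<dots> \<le> M0 * norm (T (t - s) x - x)"
        by (rule norm_T[OF that(1)])
      also have "\<dots> \<le> M0 * e'"
        using d(2)[of "t - s"] that False M0_nonneg
        by (intro mult_left_mono) (auto simp: dist_norm)
      finally show ?thesis using e' by linarith
    qed (use e in simp)
    show "\<exists>d>0. \<forall>s\<in>{0..}. \<forall>t\<in>{0..}. dist t s < d \<longrightarrow> dist (T t x) (T s x) < e"
    proof (intro exI[of _ d] conjI ballI impI)
      fix s t :: real assume st: "s \<in> {0..}" "t \<in> {0..}" "dist t s < d"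
      show "dist (T t x) (T s x) < e"
        using *[of s t] *[of t s] st
        by (cases "s \<le> t") (auto simp: dist_norm norm_minus_commute)
    qed (fact d)
  qed
  then show ?thesis by (rule uniformly_continuous_imp_continuous)
qed

text \<open>For \<open>0 < Re l\<close> this is the resolvent \<open>(l + A)\<close> inverse, where
  \<open>- A\<close> is the generator, written as the Laplace transform of the orbit. The two
  inverse relations are \<open>Rs_generator\<close> and \<open>Rs_of_generator\<close>.\<close>

definition Rs :: "complex \<Rightarrow> 'a \<Rightarrow> 'a"
  where "Rs l u = sint lborel (\<lambda>r. indicator {0..} r *\<^sub>R (exp (- (l * of_real r)) *\<^sub>C T r u))"

lemma Rs_continuous_integrand:
  "continuous_on {0..} (\<lambda>r. exp (- (l * of_real r)) *\<^sub>C T r u)"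
  by (intro scaleC.continuous_on T_continuous continuous_intros)

lemma norm_exp_of_real: "norm (exp (- (l * of_real r))) = exp (- (Re l * r))"
  by (simp add: norm_exp_eq_Re)

lemma Rs_bound: "0 \<le> r \<Longrightarrow> norm (exp (- (l * of_real r)) *\<^sub>C T r u) \<le> exp (- (Re l * r)) * (M0 * norm u)"
  unfolding norm_scaleC norm_exp_of_real by (intro mult_left_mono norm_T) auto

lemma exp_const_integrable:
  "0 < a \<Longrightarrow> integrable lborel (\<lambda>r::real. indicator {0..} r * exp (- (a * r)) * c)"
  using integrable_exp_minus[of a] by (intro integrable_mult_left) auto

lemma Rs_integrable:
  assumes l: "0 < Re l"
  shows "sintegrable lborel (\<lambda>r. indicator {0..} r *\<^sub>R (exp (- (l * of_real r)) *\<^sub>C T r u))"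
  by (rule sintegrableI[OF smeas_halfline[OF Rs_continuous_integrand] exp_const_integrable[OF l, of "M0 * norm u"]])
     (use Rs_bound in \<open>auto simp: indicator_def\<close>)

lemma norm_Rs:
  assumes l: "0 < Re l"
  shows "norm (Rs l u) \<le> M0 * norm u / Re l"
proof -
  have "norm (Rs l u) \<le> (LBINT r. indicator {0..} r * exp (- (Re l * r)) * (M0 * norm u))"
    unfolding Rs_def
    by (rule norm_sint_le[OF smeas_halfline[OF Rs_continuous_integrand] exp_const_integrable[OF l]])
       (use Rs_bound in \<open>auto simp: indicator_def\<close>)
  also have "\<dots> = M0 * norm u / Re l"
    by (simp add: integral_exp_minus[OF l])
  finally show ?thesis .
qed

lemma Rs_add: assumes "0 < Re l" shows "Rs l (u + v) = Rs l u + Rs l v"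
proof -
  have "Rs l (u + v) = sint lborel (\<lambda>r. indicator {0..} r *\<^sub>R (exp (- (l * of_real r)) *\<^sub>C T r u)
      + indicator {0..} r *\<^sub>R (exp (- (l * of_real r)) *\<^sub>C T r v))"
    unfolding Rs_def
    by (rule sint_cong)
       (auto simp: indicator_def T_linear bounded_linear.linear linear_add scaleC_add_right)
  also have "\<dots> = Rs l u + Rs l v"
    unfolding Rs_def by (intro sint_add Rs_integrable assms)
  finally show ?thesis .
qed

lemma bounded_linear_scaleC: "bounded_linear (\<lambda>x::'a. c *\<^sub>C x)"
  by (rule scaleC.bounded_linear_right)

lemma Rs_scaleC: assumes "0 < Re l" shows "Rs l (c *\<^sub>C u) = c *\<^sub>C Rs l u"
proof -
  have "Rs l (c *\<^sub>C u) = sint lborel (\<lambda>r. c *\<^sub>C (indicator {0..} r *\<^sub>R (exp (- (l * of_real r)) *\<^sub>C T r u)))"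
    unfolding Rs_def
    by (rule sint_cong) (auto simp: indicator_def T_scaleC scaleC_scaleC mult.commute)
  also have "\<dots> = c *\<^sub>C Rs l u"
    unfolding Rs_def by (rule sint_bounded_linear[OF bounded_linear_scaleC Rs_integrable[OF assms]])
  finally show ?thesis .
qed

lemma Rs_scaleR: assumes "0 < Re l" shows "Rs l (r *\<^sub>R u) = r *\<^sub>R Rs l u"
  using Rs_scaleC[OF assms] by (simp add: scaleR_scaleC)

lemma Rs_linear: assumes "0 < Re l" shows "bounded_linear (Rs l)"
proof (rule bounded_linear_intro)
  show "norm (Rs l x) \<le> norm x * (M0 / Re l)" for x
    using norm_Rs[OF assms, of x] by (simp add: mult.commute)
qed (simp_all add: Rs_add Rs_scaleR assms)

lemma Rs_diff: "0 < Re l \<Longrightarrow> Rs l (u - v) = Rs l u - Rs l v"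
  using Rs_linear[of l] by (simp add: bounded_linear.linear linear_diff)

lemma T_Rs:
  assumes t: "0 \<le> t" and l: "0 < Re l"
  shows "sintegrable lborel (\<lambda>r. indicator {0..} r *\<^sub>R (exp (- (l * of_real r)) *\<^sub>C T (t + r) u))"
    and "T t (Rs l u) = sint lborel (\<lambda>r. indicator {0..} r *\<^sub>R (exp (- (l * of_real r)) *\<^sub>C T (t + r) u))"
proof -
  have eq: "T t (indicator {0..} r *\<^sub>R (exp (- (l * of_real r)) *\<^sub>C T r u))
      = indicator {0..} r *\<^sub>R (exp (- (l * of_real r)) *\<^sub>C T (t + r) u)" for r :: real
    using t by (auto simp: indicator_def T_scaleC T_add linear_0 T_linear bounded_linear.linear)
  show "sintegrable lborel (\<lambda>r. indicator {0..} r *\<^sub>R (exp (- (l * of_real r)) *\<^sub>C T (t + r) u))"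
    using sintegrable_bounded_linear[OF T_linear[OF t] Rs_integrable[OF l, of u]] by (simp add: eq)
  show "T t (Rs l u) = sint lborel (\<lambda>r. indicator {0..} r *\<^sub>R (exp (- (l * of_real r)) *\<^sub>C T (t + r) u))"
    using sint_bounded_linear[OF T_linear[OF t] Rs_integrable[OF l, of u]] by (simp add: eq Rs_def)
qed

lemma T_Rs_commute:
  assumes t: "0 \<le> t" and l: "0 < Re l" shows "T t (Rs l u) = Rs l (T t u)"
  unfolding T_Rs(2)[OF assms] unfolding Rs_def
  by (rule sint_cong) (use t in \<open>auto simp: indicator_def T_add[symmetric] add.commute\<close>)

text \<open>The kernel \<open>exp (- s r) - exp (- s' r)\<close> is nonnegative for
  \<open>r \<ge> 0\<close>, so its integral \<open>1 / s - 1 / s'\<close> times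
  \<open>M0 * norm u\<close> bounds the difference.\<close>

lemma Rs_continuous_real:
  assumes "0 < s" "s \<le> s'"
  shows "norm (Rs (of_real s) u - Rs (of_real s') u) \<le> M0 * norm u * (1 / s - 1 / s')"
proof -
  let ?F = "\<lambda>s r. indicator {0..} r *\<^sub>R (exp (- (complex_of_real s * of_real r)) *\<^sub>C T r u)"
  let ?\<phi> = "\<lambda>r. (indicator {0..} r * exp (- (s * r)) - indicator {0..} r * exp (- (s' * r))) * (M0 * norm u)"
  have int: "integrable lborel ?\<phi>"
    using assms by (intro integrable_mult_left Bochner_Integration.integrable_diff integrable_exp_minus) auto
  have F: "sintegrable lborel (?F s)" "sintegrable lborel (?F s')"
    by (rule Rs_integrable; use assms in simp)+
  have sm: "smeas lborel (\<lambda>r. ?F s r - ?F s' r)"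
    by (rule smeas_diff[OF sintegrable_smeas[OF F(1)] sintegrable_smeas[OF F(2)]])
  have bound: "norm (?F s r - ?F s' r) \<le> ?\<phi> r" for r
  proof (cases "0 \<le> r")
    case True
    have le: "exp (- (s' * r)) \<le> exp (- (s * r))"
      using mult_right_mono[OF assms(2) True] by simp
    have ex: "exp (- (complex_of_real s * of_real r)) = of_real (exp (- (s * r)))" for s
      by (simp flip: exp_of_real)
    have "?F s r - ?F s' r = of_real (exp (- (s * r)) - exp (- (s' * r))) *\<^sub>C T r u"
      using True unfolding ex by (simp add: scaleC.diff_left)
    also have "norm \<dots> = (exp (- (s * r)) - exp (- (s' * r))) * norm (T r u)"
      using le unfolding norm_scaleC norm_of_real by simp
    also have "\<dots> \<le> ?\<phi> r"
      using True le norm_T[OF True, of u] by (auto intro!: mult_left_mono)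
    finally show ?thesis .
  qed simp
  have eq: "Rs (of_real s) u - Rs (of_real s') u = sint lborel (\<lambda>r. ?F s r - ?F s' r)"
    unfolding Rs_def by (rule sint_diff[OF F, symmetric])
  have le: "norm (Rs (of_real s) u - Rs (of_real s') u) \<le> (LBINT r. ?\<phi> r)"
    unfolding eq by (rule norm_sint_le[OF sm int bound])
  have e: "integrable lborel (\<lambda>r. indicator {0..} r * exp (- (s * r)))"
    "integrable lborel (\<lambda>r. indicator {0..} r * exp (- (s' * r)))"
    using assms by (auto intro!: integrable_exp_minus)
  have val: "(LBINT r. ?\<phi> r) = M0 * norm u * (1 / s - 1 / s')"
    unfolding integral_mult_left_zero Bochner_Integration.integral_diff[OF e]
    using assms by (simp add: integral_exp_minus)
  show ?thesis using le unfolding val .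
qed

lemma Rs_of_real_continuous: "continuous_on {0<..} (\<lambda>s. Rs (of_real s) u)"
proof (rule continuous_on_eq_continuous_within[THEN iffD2], rule ballI)
  fix s :: real assume s: "s \<in> {0<..}"
  have "((\<lambda>s'. Rs (of_real s') u - Rs (of_real s) u) \<longlongrightarrow> 0) (at s within {0<..})"
  proof (rule Lim_null_comparison)
    show "\<forall>\<^sub>F s' in at s within {0<..}. norm (Rs (of_real s') u - Rs (of_real s) u)
        \<le> M0 * norm u * \<bar>1 / s' - 1 / s\<bar>"
      unfolding eventually_at_topological
    proof (intro exI[of _ UNIV] conjI ballI impI)
      fix s' :: real assume s': "s' \<in> {0<..}"
      show "norm (Rs (of_real s') u - Rs (of_real s) u) \<le> M0 * norm u * \<bar>1 / s' - 1 / s\<bar>"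
      proof (cases "s \<le> s'")
        case True
        then have "1 / s' \<le> 1 / s" using s by (auto simp: field_simps)
        then show ?thesis
          using Rs_continuous_real[of s s' u] True s by (simp add: norm_minus_commute)
      next
        case False
        then have "1 / s \<le> 1 / s'" using s' by (auto simp: field_simps)
        then show ?thesis
          using Rs_continuous_real[of s' s u] False s' by simp
      qed
    qed auto
    have "((\<lambda>s'. M0 * norm u * \<bar>1 / s' - 1 / s\<bar>) \<longlongrightarrow> M0 * norm u * \<bar>1 / s - 1 / s\<bar>) (at s within {0<..})"
      using s by (intro tendsto_intros) auto
    then show "((\<lambda>s'. M0 * norm u * \<bar>1 / s' - 1 / s\<bar>) \<longlongrightarrow> 0) (at s within {0<..})" by simp
  qed
  then show "continuous (at s within {0<..}) (\<lambda>s. Rs (of_real s) u)"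
    by (simp add: continuous_within LIM_zero_iff)
qed

text \<open>The operator on the left translates the integrand by \<open>h\<close>, which leaves the
  integral over \<open>{h..}\<close>. Its complement in \<open>{0..}\<close> produces the difference
  quotient in \<open>Rs_generator\<close>.\<close>

lemma exp_T_Rs:
  assumes h: "0 \<le> h" and l: "0 < Re l"
  shows "exp (- (l * of_real h)) *\<^sub>C T h (Rs l u)
    = Rs l u - sint lborel (\<lambda>r. indicator {0..<h} r *\<^sub>R (exp (- (l * of_real r)) *\<^sub>C T r u))"
proof -
  let ?G = "\<lambda>r. exp (- (l * of_real r)) *\<^sub>C T r u"
  have sub: "sintegrable lborel (\<lambda>r. indicator S r *\<^sub>R ?G r)" if S: "S \<subseteq> {0..}" "S \<in> sets borel" for S
  proof (rule sintegrableI[OF _ exp_const_integrable[OF l, of "M0 * norm u"]])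
    have "smeas lborel (\<lambda>r. (indicator S r :: real) *\<^sub>R (indicator {0..} r *\<^sub>R ?G r))"
      using S by (intro smeas_scaleR smeas_of_borel smeas_halfline Rs_continuous_integrand) auto
    then show "smeas lborel (\<lambda>r. indicator S r *\<^sub>R ?G r)"
      by (rule smeas_cong[rotated]) (use S in \<open>auto simp: indicator_def\<close>)
    show "norm (indicator S r *\<^sub>R ?G r) \<le> indicator {0..} r * exp (- (Re l * r)) * (M0 * norm u)" for r
      using S Rs_bound[of r l u] M0_nonneg by (auto simp: indicator_def)
  qed
  have i: "sintegrable lborel (\<lambda>r. indicator {h..} r *\<^sub>R ?G r)"
      "sintegrable lborel (\<lambda>r. indicator {0..<h} r *\<^sub>R ?G r)"
    using h by (auto intro!: sub)
  \<comment> \<open>Translation invariance, with density \<open>1\<close> to fit the shape of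
    \<open>sint_transfer\<close>.\<close>
  have tr: "lborel = distr (density lborel (\<lambda>x. ennreal 1)) lborel ((+) h)"
  proof -
    have "distr (density lborel (\<lambda>x. ennreal 1)) lborel ((+) h) = distr lborel borel ((+) h)"
      by (rule distr_cong) (auto simp: density_1)
    then show ?thesis by (simp only: lborel_distr_plus)
  qed
  have "exp (- (l * of_real h)) *\<^sub>C T h (Rs l u)
      = sint lborel (\<lambda>r. exp (- (l * of_real h)) *\<^sub>C (indicator {0..} r *\<^sub>R (exp (- (l * of_real r)) *\<^sub>C T (h + r) u)))"
    using sint_bounded_linear[OF bounded_linear_scaleC T_Rs(1)[OF h l, of u]] T_Rs(2)[OF h l, of u] by simp
  also have "\<dots> = sint lborel (\<lambda>r. (1::real) *\<^sub>R (indicator {h..} (h + r) *\<^sub>R ?G (h + r)))"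
    by (rule sint_cong) (auto simp: indicator_def scaleC_scaleC algebra_simps exp_add[symmetric])
  also have "\<dots> = sint lborel (\<lambda>r. indicator {h..} r *\<^sub>R ?G r)"
    by (rule sint_transfer(2)[OF tr _ _ _ _ i(1)]) auto
  also have "\<dots> = sint lborel (\<lambda>r. indicator {0..} r *\<^sub>R ?G r - indicator {0..<h} r *\<^sub>R ?G r)"
    by (rule sint_cong) (use h in \<open>auto simp: indicator_def\<close>)
  also have "\<dots> = Rs l u - sint lborel (\<lambda>r. indicator {0..<h} r *\<^sub>R ?G r)"
    unfolding Rs_def by (rule sint_diff[OF Rs_integrable[OF l] i(2)])
  finally show ?thesis .
qed

lemma average_tendsto:
  "((\<lambda>h. (1 / h) *\<^sub>R sint lborel (\<lambda>r. indicator {0..<h} r *\<^sub>R (exp (- (l * of_real r)) *\<^sub>C T r u)))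
    \<longlongrightarrow> u) (at_right 0)"
proof (rule tendstoI)
  let ?G = "\<lambda>r. exp (- (l * of_real r)) *\<^sub>C T r u"
  fix e :: real assume e: "0 < e"
  obtain d where d: "d > 0" "\<And>r. 0 \<le> r \<Longrightarrow> r < d \<Longrightarrow> norm (?G r - u) < e / 2"
  proof -
    from Rs_continuous_integrand[of l u]
    obtain d where "d > 0" "\<And>r. r \<in> {0..} \<Longrightarrow> dist r 0 < d \<Longrightarrow> dist (?G r) (?G 0) < e / 2"
      unfolding continuous_on_iff using e by (metis atLeast_iff order_refl half_gt_zero)
    then show ?thesis by (intro that[of d]) (auto simp: dist_norm scaleC_one)
  qed
  have *: "dist ((1 / h) *\<^sub>R sint lborel (\<lambda>r. indicator {0..<h} r *\<^sub>R ?G r)) u < e" if h: "0 < h" "h < d" for h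
  proof -
    have sm: "smeas lborel (\<lambda>r. (indicator {0..<h} r :: real) *\<^sub>R ?G r)"
    proof -
      have "smeas lborel (\<lambda>r. (indicator {0..<h} r :: real) *\<^sub>R (indicator {0..} r *\<^sub>R ?G r))"
        by (intro smeas_scaleR smeas_of_borel smeas_halfline Rs_continuous_integrand) auto
      then show ?thesis by (rule smeas_cong[rotated]) (auto simp: indicator_def)
    qed
    have ih: "integrable lborel (indicator {0..<h} :: real \<Rightarrow> real)"
      "(LBINT r. (indicator {0..<h} r :: real)) = h"
      using h by auto
    have c: "sintegrable lborel (\<lambda>r. (indicator {0..<h} r :: real) *\<^sub>R u)"
      "sint lborel (\<lambda>r. (indicator {0..<h} r :: real) *\<^sub>R u) = h *\<^sub>R u"
      using sintegrable_bounded_linear[OF bounded_linear_scaleR_left sintegrable_of_integrable[OF ih(1)], of u]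
        sint_bounded_linear[OF bounded_linear_scaleR_left sintegrable_of_integrable[OF ih(1)], of u]
      by (auto simp only: sint_eq_integral[OF ih(1), unfolded ih(2)])
    have bd: "norm (indicator {0..<h} r *\<^sub>R ?G r - indicator {0..<h} r *\<^sub>R u) \<le> indicator {0..<h} r * (e / 2)" for r
      using d(2)[of r] h e by (auto simp: indicator_def)
    have bd': "norm (indicator {0..<h} r *\<^sub>R ?G r) \<le> indicator {0..<h} r * (e / 2 + norm u)" for r
      using d(2)[of r] norm_triangle_sub[of "?G r" u] h e by (auto simp: indicator_def)
    have Gi: "sintegrable lborel (\<lambda>r. (indicator {0..<h} r :: real) *\<^sub>R ?G r)"
      by (rule sintegrableI[OF sm _ bd']) (use ih in auto)
    have "norm (sint lborel (\<lambda>r. indicator {0..<h} r *\<^sub>R ?G r) - h *\<^sub>R u)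
      = norm (sint lborel (\<lambda>r. (indicator {0..<h} r :: real) *\<^sub>R ?G r - indicator {0..<h} r *\<^sub>R u))"
      by (subst sint_diff[OF Gi c(1)]) (simp add: c(2))
    also have "\<dots> \<le> (LBINT r. indicator {0..<h} r * (e / 2))"
      by (rule norm_sint_le[OF smeas_diff[OF sm sintegrable_smeas[OF c(1)]] _ bd]) (use ih in auto)
    also have "\<dots> = h * (e / 2)" using h by simp
    finally have le: "norm (sint lborel (\<lambda>r. indicator {0..<h} r *\<^sub>R ?G r) - h *\<^sub>R u) \<le> h * (e / 2)" .
    have "(1 / h) *\<^sub>R sint lborel (\<lambda>r. indicator {0..<h} r *\<^sub>R ?G r) - u
      = (1 / h) *\<^sub>R (sint lborel (\<lambda>r. indicator {0..<h} r *\<^sub>R ?G r) - h *\<^sub>R u)"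
      using h by (simp add: scaleR_diff_right)
    also have "norm \<dots> = norm (sint lborel (\<lambda>r. indicator {0..<h} r *\<^sub>R ?G r) - h *\<^sub>R u) / h"
      using h by simp
    also have "\<dots> \<le> e / 2" using le h by (simp add: field_simps)
    finally show ?thesis using e by (simp add: dist_norm)
  qed
  show "\<forall>\<^sub>F h in at_right 0. dist ((1 / h) *\<^sub>R sint lborel (\<lambda>r. indicator {0..<h} r *\<^sub>R ?G r)) u < e"
    unfolding eventually_at_right_field using d(1) * by blast
qed

text \<open>Solve \<open>exp_T_Rs\<close> for \<open>T h (Rs l u)\<close>: the factor of
  \<open>Rs l u\<close> in the difference quotient tends to the derivative \<open>l\<close> of
  \<open>exp (l h)\<close> at \<open>0\<close>, and the average over \<open>{0..<h}\<close> tends to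
  \<open>u\<close>. In other words \<open>(l + A) Rs l u = u\<close>.\<close>

lemma Rs_generator:
  assumes l: "0 < Re l"
  shows "(Rs l u, l *\<^sub>C Rs l u - u) \<in> semigroup_generator T"
proof -
  let ?E = "\<lambda>h. sint lborel (\<lambda>r. indicator {0..<h} r *\<^sub>R (exp (- (l * of_real r)) *\<^sub>C T r u))"
  have eq: "(1 / h) *\<^sub>R (T h (Rs l u) - Rs l u)
      = ((exp (l * of_real h) - 1) / of_real h) *\<^sub>C Rs l u - exp (l * of_real h) *\<^sub>C ((1 / h) *\<^sub>R ?E h)"
    if h: "h > 0" for h
  proof -
    have "exp (l * of_real h) *\<^sub>C (exp (- (l * of_real h)) *\<^sub>C T h (Rs l u)) = T h (Rs l u)"
      by (simp add: scaleC_scaleC scaleC_one flip: exp_add)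
    then have "T h (Rs l u) = exp (l * of_real h) *\<^sub>C Rs l u - exp (l * of_real h) *\<^sub>C ?E h"
      using exp_T_Rs[OF _ l, of h u] h by (simp add: scaleC.diff_right)
    then have "T h (Rs l u) - Rs l u = (exp (l * of_real h) - 1) *\<^sub>C Rs l u - exp (l * of_real h) *\<^sub>C ?E h"
      by (simp add: scaleC.diff_left scaleC_one)
    then show ?thesis
      by (simp add: scaleR_scaleC scaleC.diff_right scaleC_scaleC mult.commute)
  qed
  have "((\<lambda>h. (exp (l * of_real h) - 1) / of_real h) \<longlongrightarrow> l) (at_right (0::real))"
  proof -
    have "((\<lambda>z. exp (l * z)) has_field_derivative l) (at 0)"
      by (auto intro!: derivative_eq_intros)
    then have D: "((\<lambda>z. (exp (l * z) - 1) / z) \<longlongrightarrow> l) (at 0)"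
      by (simp add: DERIV_def)
    have "filterlim complex_of_real (at 0) (at_right 0)"
    proof (rule filterlim_atI)
      show "(complex_of_real \<longlongrightarrow> 0) (at_right 0)"
        by (auto intro!: tendsto_eq_intros)
      show "\<forall>\<^sub>F h in at_right 0. complex_of_real h \<noteq> 0"
        by (simp add: eventually_at_filter)
    qed
    from filterlim_compose[OF D this] show ?thesis .
  qed
  moreover have "((\<lambda>h. exp (l * of_real h)) \<longlongrightarrow> exp (l * of_real 0)) (at_right (0::real))"
    by (intro tendsto_intros)
  ultimately have "((\<lambda>h. ((exp (l * of_real h) - 1) / of_real h) *\<^sub>C Rs l u - exp (l * of_real h) *\<^sub>C ((1 / h) *\<^sub>R ?E h))
      \<longlongrightarrow> l *\<^sub>C Rs l u - exp (l * of_real 0) *\<^sub>C u) (at_right 0)"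
    by (intro tendsto_diff scaleC.tendsto tendsto_const average_tendsto)
  then have "((\<lambda>h. ((exp (l * of_real h) - 1) / of_real h) *\<^sub>C Rs l u - exp (l * of_real h) *\<^sub>C ((1 / h) *\<^sub>R ?E h))
      \<longlongrightarrow> l *\<^sub>C Rs l u - u) (at_right 0)" by (simp add: scaleC_one)
  then have "((\<lambda>h. (1 / h) *\<^sub>R (T h (Rs l u) - Rs l u)) \<longlongrightarrow> l *\<^sub>C Rs l u - u) (at_right 0)"
    by (rule Lim_transform_eventually) (auto simp: eventually_at_right_field eq intro!: exI[of _ 1])
  then show ?thesis by (simp add: semigroup_generator_def)
qed

section \<open>The generator as a graph; resolvents on its domain and injectivity\<close>

lemma generator_unique:
  assumes "(w, x) \<in> semigroup_generator T" "(w, y) \<in> semigroup_generator T" shows "x = y"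
  using assms unfolding semigroup_generator_def
  by (auto intro: tendsto_unique[rotated])

lemma generator_diff:
  assumes "(w, x) \<in> semigroup_generator T" "(v, y) \<in> semigroup_generator T"
  shows "(w - v, x - y) \<in> semigroup_generator T"
proof -
  have "((\<lambda>t. (1 / t) *\<^sub>R (T t w - w) - (1 / t) *\<^sub>R (T t v - v)) \<longlongrightarrow> x - y) (at_right 0)"
    using assms unfolding semigroup_generator_def by (intro tendsto_diff) auto
  then have "((\<lambda>t. (1 / t) *\<^sub>R (T t (w - v) - (w - v))) \<longlongrightarrow> x - y) (at_right 0)"
    by (rule Lim_transform_eventually)
       (auto simp: eventually_at_right_field T_diff algebra_simps intro!: exI[of _ 1])
  then show ?thesis by (simp add: semigroup_generator_def)
qed

lemma generator_scaleC:
  assumes "(w, x) \<in> semigroup_generator T"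
  shows "(c *\<^sub>C w, c *\<^sub>C x) \<in> semigroup_generator T"
proof -
  have "((\<lambda>t. c *\<^sub>C ((1 / t) *\<^sub>R (T t w - w))) \<longlongrightarrow> c *\<^sub>C x) (at_right 0)"
    using assms unfolding semigroup_generator_def by (intro scaleC.tendsto tendsto_const) auto
  then have "((\<lambda>t. (1 / t) *\<^sub>R (T t (c *\<^sub>C w) - c *\<^sub>C w)) \<longlongrightarrow> c *\<^sub>C x) (at_right 0)"
    by (rule Lim_transform_eventually)
       (auto simp: eventually_at_right_field T_scaleC scaleC.diff_right scaleR_scaleC scaleC_scaleC mult.commute
          intro!: exI[of _ 1])
  then show ?thesis by (simp add: semigroup_generator_def)
qed

text \<open>Since \<open>Rs l\<close> commutes with the semigroup, it maps the difference quotients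
  of \<open>w\<close> to those of \<open>Rs l w\<close>; comparing the limit with
  \<open>Rs_generator\<close> gives the value. In other words
  \<open>Rs l ((l + A) w) = w\<close>.\<close>

lemma Rs_of_generator:
  assumes l: "0 < Re l" and w: "(w, z) \<in> semigroup_generator T"
  shows "Rs l z = l *\<^sub>C Rs l w - w"
proof -
  have "((\<lambda>h. Rs l ((1 / h) *\<^sub>R (T h w - w))) \<longlongrightarrow> Rs l z) (at_right 0)"
    using w by (intro bounded_linear.tendsto[OF Rs_linear[OF l]]) (simp add: semigroup_generator_def)
  then have "((\<lambda>h. (1 / h) *\<^sub>R (T h (Rs l w) - Rs l w)) \<longlongrightarrow> Rs l z) (at_right 0)"
    by (rule Lim_transform_eventually)
       (auto simp: eventually_at_right_field Rs_scaleR[OF l] Rs_diff[OF l] T_Rs_commute[OF _ l]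
         intro!: exI[of _ 1])
  then have "(Rs l w, Rs l z) \<in> semigroup_generator T" by (simp add: semigroup_generator_def)
  from generator_unique[OF this Rs_generator[OF l]] show ?thesis .
qed

text \<open>Mean ergodic argument: \<open>s Rs s\<close> fixes the kernel and tends strongly to \<open>0\<close> on the closure of the range.\<close>
lemma generator_injective:
  assumes dense: "closure (Range (semigroup_generator T)) = UNIV"
    and w: "(w, 0) \<in> semigroup_generator T"
  shows "w = 0"
proof (rule ccontr)
  assume "w \<noteq> 0"
  define e where "e = norm w / (2 * (M0 + 1))"
  have e: "0 < e" "M0 * e < norm w / 2"
    using \<open>w \<noteq> 0\<close> M0_nonneg by (auto simp: e_def field_simps)
  have "w \<in> closure (Range (semigroup_generator T))" using dense by simp
  then obtain x where x: "x \<in> Range (semigroup_generator T)" "dist x w < e"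
    using e(1) unfolding closure_approachable by blast
  then obtain v where v: "(v, x) \<in> semigroup_generator T" by blast
  \<comment> \<open>The distance \<open>e\<close> from \<open>w\<close> to the range is fixed first;
    the preimage \<open>v\<close> comes with the chosen \<open>x\<close>, and only then is
    \<open>s\<close> taken small relative to \<open>v\<close>. The summand \<open>1\<close> covers
    \<open>v = 0\<close>.\<close>
  define s where "s = norm w / (2 * ((M0 + 1) * norm v + 1))"
  have pos: "0 < (M0 + 1) * norm v + 1" using M0_nonneg by (simp add: add_nonneg_pos)
  have s: "0 < s" using \<open>w \<noteq> 0\<close> pos by (simp add: s_def)
  have sv: "s * ((M0 + 1) * norm v) \<le> norm w / 2"
  proof -
    have "s * ((M0 + 1) * norm v) \<le> s * ((M0 + 1) * norm v + 1)" using s by simp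
    also have "\<dots> = norm w / 2"
    proof -
      have "n / (2 * P) * P = n / 2" if "0 < P" for n P :: real using that by simp
      from this[OF pos] show ?thesis unfolding s_def .
    qed
    finally show ?thesis .
  qed
  have re: "0 < Re (of_real s)" using s by simp
  note sR = norm_Rs[OF re]
  have nb: "norm (s *\<^sub>R Rs (of_real s) u) \<le> M0 * norm u" for u
    using sR[of u] s by (simp add: field_simps)
  have zero: "Rs (complex_of_real s) 0 = 0" using Rs_scaleR[OF re, of 0 0] by simp
  have w': "s *\<^sub>R Rs (of_real s) w = w"
    using Rs_of_generator[OF re w] zero by (simp add: scaleR_scaleC)
  have x': "s *\<^sub>R Rs (of_real s) x = s *\<^sub>R (s *\<^sub>R Rs (of_real s) v - v)"
    using Rs_of_generator[OF re v] by (simp add: scaleR_scaleC)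
  have "w = s *\<^sub>R Rs (of_real s) (w - x) + s *\<^sub>R Rs (of_real s) x"
    by (simp add: Rs_diff[OF re] scaleR_diff_right w')
  also have "norm \<dots> \<le> M0 * norm (w - x) + s * (M0 * norm v + norm v)"
  proof (rule norm_triangle_mono[OF nb])
    show "norm (s *\<^sub>R Rs (of_real s) x) \<le> s * (M0 * norm v + norm v)"
      unfolding x' using s nb[of v] norm_triangle_ineq4[of "s *\<^sub>R Rs (of_real s) v" v]
      by (simp del: norm_scaleR add: norm_scaleR[of s "_ - _"])
  qed
  also have "\<dots> \<le> M0 * e + s * ((M0 + 1) * norm v)"
    using x(2) M0_nonneg s by (intro add_mono mult_left_mono)
      (auto simp: dist_norm norm_minus_commute algebra_simps)
  also have "\<dots> < norm w" using sv e by linarith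
  finally show False by simp
qed

end

section \<open>The Hille-Phillips calculus of a Stieltjes function\<close>

lemma bounded_radon_space:
  assumes "bounded_radon_measure m h" shows "space m = {0..}"
proof -
  have "sets m = sets (restrict_space borel {0..})"
    using assms by (simp add: bounded_radon_measure_def)
  from sets_eq_imp_space_eq[OF this] show ?thesis by (simp add: space_restrict_space)
qed

lemma smeas_radon:
  assumes mh: "bounded_radon_measure m h" and G: "continuous_on {0..} G"
  shows "smeas m (\<lambda>t. h t *\<^sub>C G t)"
proof (rule smeas_scaleC)
  show "smeas m h"
    using mh by (intro smeas_of_borel) (auto simp: bounded_radon_measure_def)
  show "smeas m G"
    by (rule smeas_continuous[OF _ _ G]) (use mh in \<open>auto simp: bounded_radon_measure_def\<close>)
qed

lemma
  assumes mh: "bounded_radon_measure m h" and G: "continuous_on {0..} G"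
    and C: "\<And>t. 0 \<le> t \<Longrightarrow> norm (G t) \<le> C"
  shows sintegrable_radon: "sintegrable m (\<lambda>t. h t *\<^sub>C G t)"
    and norm_sint_radon: "norm (sint m (\<lambda>t. h t *\<^sub>C G t)) \<le> (LINT t|m. norm (h t)) * C"
proof -
  have int: "integrable m (\<lambda>t. norm (h t) * C)"
    using mh by (auto simp: bounded_radon_measure_def)
  have le: "norm (h t *\<^sub>C G t) \<le> norm (h t) * C" if "t \<in> space m" for t
    unfolding norm_scaleC by (rule mult_left_mono[OF C]) (use that bounded_radon_space[OF mh] in auto)
  show "sintegrable m (\<lambda>t. h t *\<^sub>C G t)"
    by (rule sintegrableI[OF smeas_radon[OF mh G] int le])
  show "norm (sint m (\<lambda>t. h t *\<^sub>C G t)) \<le> (LINT t|m. norm (h t)) * C"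
    using norm_sint_le[OF smeas_radon[OF mh G] int le] by simp
qed

text \<open>Continuity of the integral in the supremum norm, with the total mass of the measure as
  constant. This is what carries identities from exponential sums to orbits.\<close>

lemma norm_sint_radon_diff:
  assumes mh: "bounded_radon_measure m h" and G: "continuous_on {0..} G" and H: "continuous_on {0..} H"
    and C: "\<And>t. 0 \<le> t \<Longrightarrow> norm (G t) \<le> C" and D: "\<And>t. 0 \<le> t \<Longrightarrow> norm (H t) \<le> D"
    and d: "\<And>t. 0 \<le> t \<Longrightarrow> norm (G t - H t) \<le> \<delta>"
  shows "norm (sint m (\<lambda>t. h t *\<^sub>C G t) - sint m (\<lambda>t. h t *\<^sub>C H t)) \<le> (LINT t|m. norm (h t)) * \<delta>"
  using norm_sint_radon[OF mh continuous_on_diff[OF G H] d]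
    sint_diff[OF sintegrable_radon[OF mh G C] sintegrable_radon[OF mh H D]]
  by (simp add: scaleC.diff_right)

lemma laplace_integrable:
  assumes mh: "bounded_radon_measure m h" and z: "0 \<le> Re z"
  shows "integrable m (\<lambda>t. exp (- (complex_of_real t * z)) * h t)"
proof (rule Bochner_Integration.integrable_bound)
  have m: "sets m = sets (restrict_space borel {0..})"
    using mh by (simp add: bounded_radon_measure_def)
  have "(\<lambda>t. t) \<in> borel_measurable m"
    unfolding measurable_cong_sets[OF m refl] by (rule measurable_restrict_space1) simp
  moreover have "h \<in> borel_measurable m" using mh by (auto simp: bounded_radon_measure_def)
  ultimately show "(\<lambda>t. exp (- (complex_of_real t * z)) * h t) \<in> borel_measurable m"
    by measurable
  show "integrable m h" using mh by (simp add: bounded_radon_measure_def)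
  show "AE t in m. norm (exp (- (complex_of_real t * z)) * h t) \<le> norm (h t)"
  proof (rule AE_I2)
    fix t assume "t \<in> space m"
    then have "0 \<le> t * Re z" using bounded_radon_space[OF mh] z by auto
    then show "norm (exp (- (complex_of_real t * z)) * h t) \<le> norm (h t)"
      by (simp add: norm_mult norm_exp_eq_Re mult_left_le_one_le)
  qed
qed

text \<open>On exponential sums the vector integral sees the measure only through its Laplace
  transform at the frequencies, which here are real.\<close>

lemma sint_radon_exponential_sum:
  assumes mh: "bounded_radon_measure m h" and J: "\<And>j. 0 \<le> z j"
  shows "sint m (\<lambda>t. h t *\<^sub>C (\<Sum>j\<in>J. exp (- (z j * t)) *\<^sub>R (v j :: 'a::complex_banach)))
    = (\<Sum>j\<in>J. (LINT t|m. exp (- (complex_of_real t * of_real (z j))) * h t) *\<^sub>C v j)"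
proof -
  have i: "integrable m (\<lambda>t. exp (- (complex_of_real t * of_real (z j))) * h t)" for j
    by (rule laplace_integrable[OF mh]) (simp add: J)
  have "h t *\<^sub>C (\<Sum>j\<in>J. exp (- (z j * t)) *\<^sub>R v j)
      = (\<Sum>j\<in>J. (exp (- (complex_of_real t * of_real (z j))) * h t) *\<^sub>C v j)" for t
    unfolding scaleC.sum_right
  proof (rule sum.cong[OF refl])
    fix j
    have "complex_of_real (exp (- (z j * t))) = exp (- (complex_of_real t * of_real (z j)))"
      by (simp add: exp_of_real[symmetric] mult.commute)
    then show "h t *\<^sub>C exp (- (z j * t)) *\<^sub>R v j = (exp (- (complex_of_real t * of_real (z j))) * h t) *\<^sub>C v j"
      by (simp only: scaleR_scaleC scaleC_scaleC mult.commute)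
  qed
  then show ?thesis
    by (simp add: sint_sum sintegrable_scaleC_const[OF i] sint_scaleC_const(2)[OF i])
qed

section \<open>Stieltjes functions normalized to a finite measure\<close>

locale stieltjes_data =
  fixes c0 c1 :: real and \<nu> :: "real measure"
  assumes c: "0 \<le> c0" "0 \<le> c1" and finite_\<nu>: "finite_measure \<nu>"
    and sets_\<nu>: "sets \<nu> = sets (restrict_space borel {0<..})"
begin

text \<open>The factor \<open>1 + s\<close> compensates the density \<open>1 / (1 + s)\<close> that
  makes the measure finite. The kernel is bounded in \<open>s\<close> for each \<open>z > 0\<close>,
  so integrability reduces to boundedness.\<close>

definition "fS z = c0 / z + c1 + (LINT s|\<nu>. (1 + s) / (z + s))"

lemma space_\<nu>: "space \<nu> = {0<..}"
  using sets_eq_imp_space_eq[OF sets_\<nu>] by (simp add: space_restrict_space)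

lemma \<nu>_ident: "(\<lambda>s. s) \<in> borel_measurable \<nu>"
  unfolding measurable_cong_sets[OF sets_\<nu> refl] by (rule measurable_restrict_space1) simp

lemma \<nu>_integrable_bounded:
  fixes g :: "real \<Rightarrow> 'b::{banach, second_countable_topology}"
  assumes "g \<in> borel_measurable \<nu>" "\<And>s. 0 < s \<Longrightarrow> norm (g s) \<le> C"
  shows "integrable \<nu> g"
  by (rule finite_measure.integrable_const_bound[OF finite_\<nu>, of _ C])
     (use assms space_\<nu> in auto)

lemma smeas_\<nu>:
  assumes "continuous_on {0<..} G" shows "smeas \<nu> G"
  by (rule smeas_continuous[OF _ _ assms sets_\<nu>]) auto

lemma sintegrable_\<nu>:
  assumes G: "continuous_on {0<..} G" and le: "\<And>s. 0 < s \<Longrightarrow> norm (G s) \<le> C"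
  shows "sintegrable \<nu> G"
proof (rule sintegrableI[OF smeas_\<nu>[OF G]])
  show "integrable \<nu> (\<lambda>_. C)" using finite_\<nu> by (simp add: finite_measure.integrable_const)
qed (use le space_\<nu> in auto)

lemma kernel_le:
  fixes z s :: real
  assumes "0 < z" "0 < s" shows "(1 + s) / (z + s) \<le> 1 + 1 / z"
proof -
  have "1 + s \<le> (1 + 1 / z) * (z + s)"
    using assms by (simp add: field_simps)
  then show ?thesis using assms by (simp add: pos_divide_le_eq)
qed

lemma kernel_integrable:
  assumes z: "0 < z" shows "integrable \<nu> (\<lambda>s. (1 + s) / (z + s))"
  by (rule \<nu>_integrable_bounded[where C="1 + 1 / z"])
     (use \<nu>_ident kernel_le[OF z] z in auto)

lemma fS_nonneg: "0 < z \<Longrightarrow> 0 \<le> fS z"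
  unfolding fS_def using c
  by (intro add_nonneg_nonneg integral_nonneg_AE AE_I2) (auto simp: space_\<nu>)

end

section \<open>The bounded operator \<open>f(A + \<epsilon>)\<close>\<close>

locale stieltjes_semigroup = C0_semigroup T + stieltjes_data c0 c1 \<nu>
  for T :: "real \<Rightarrow> 'a::complex_banach \<Rightarrow> 'a" and c0 c1 \<nu>
begin

text \<open>This is \<open>f(A + \<epsilon>) x\<close>: the resolvent of
  \<open>A + \<epsilon>\<close> at \<open>s\<close> is \<open>Rs (s + \<epsilon>)\<close>, whose
  norm is at most \<open>M0 / (s + \<epsilon>)\<close>, so the integral exists for every
  \<open>x\<close>.\<close>

definition "fA_shift \<epsilon> x = c0 *\<^sub>R Rs (of_real \<epsilon>) x + c1 *\<^sub>R x
  + sint \<nu> (\<lambda>s. (1 + s) *\<^sub>R Rs (of_real (s + \<epsilon>)) x)"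

lemma fA_shift_integrable:
  assumes e: "0 < \<epsilon>"
  shows "sintegrable \<nu> (\<lambda>s. (1 + s) *\<^sub>R Rs (of_real (s + \<epsilon>)) x)"
proof (rule sintegrable_\<nu>)
  show "continuous_on {0<..} (\<lambda>s. (1 + s) *\<^sub>R Rs (of_real (s + \<epsilon>)) x)"
    by (intro continuous_intros continuous_on_compose2[OF Rs_of_real_continuous, of _ "\<lambda>s. s + \<epsilon>"])
       (use e in auto)
  fix s :: real assume s: "0 < s"
  have "norm ((1 + s) *\<^sub>R Rs (of_real (s + \<epsilon>)) x) \<le> (1 + s) * (M0 * norm x / (s + \<epsilon>))"
    unfolding norm_scaleR using norm_Rs[of "of_real (s + \<epsilon>)" x] s e by (intro mult_mono) auto
  also have "\<dots> = (1 + s) / (\<epsilon> + s) * (M0 * norm x)" by (simp add: add.commute)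
  also have "\<dots> \<le> (1 + 1 / \<epsilon>) * (M0 * norm x)"
    by (intro mult_right_mono kernel_le e s mult_nonneg_nonneg M0_nonneg norm_ge_zero)
  finally show "norm ((1 + s) *\<^sub>R Rs (of_real (s + \<epsilon>)) x) \<le> (1 + 1 / \<epsilon>) * (M0 * norm x)" .
qed

text \<open>Both terms arise from one operation
  \<open>g \<mapsto> \<integral> exp (- s r) g (t + r) dr\<close> on the half-line, applied to the
  damped orbit and to the exponential sum; it multiplies \<open>exp (- z t) v\<close> by
  \<open>1 / (s + z)\<close>. The weight in \<open>approx\<close> makes the error integrable in
  \<open>r\<close>. The case \<open>s = 0\<close> is included for the term with
  \<open>c0\<close>.\<close>

lemma T_Rs_exponential_sum:
  assumes s: "0 \<le> s" and e: "0 < \<epsilon>" and t: "0 \<le> t" and J: "\<And>j. \<epsilon> / 2 \<le> z j" and d: "0 \<le> \<delta>"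
    and approx: "\<And>t. 0 \<le> t \<Longrightarrow>
      norm (exp (- (\<epsilon> * t)) *\<^sub>R T t x - (\<Sum>j\<in>J. exp (- (z j * t)) *\<^sub>R v j)) \<le> \<delta> * exp (- (\<epsilon> / 2 * t))"
  shows "norm (exp (- (\<epsilon> * t)) *\<^sub>R T t (Rs (of_real (s + \<epsilon>)) x) - (\<Sum>j\<in>J. (exp (- (z j * t)) / (s + z j)) *\<^sub>R v j))
    \<le> \<delta> / (\<epsilon> / 2 + s)"
proof -
  let ?F = "\<lambda>r. indicator {0..} r *\<^sub>R (exp (- (complex_of_real (s + \<epsilon>) * of_real r)) *\<^sub>C T (t + r) x)"
  let ?W = "\<lambda>r. \<Sum>j\<in>J. (indicator {0..} r * exp (- ((s + z j) * r))) *\<^sub>R (exp (- (z j * t)) *\<^sub>R v j)"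
  let ?\<phi> = "\<lambda>r. indicator {0..} r * exp (- ((\<epsilon> / 2 + s) * r)) * \<delta>"
  have re: "0 < Re (of_real (s + \<epsilon>))" using s e by simp
  have zj: "0 < s + z j" for j using s e J[of j] by simp
  have eF: "sintegrable lborel (\<lambda>r. exp (- (\<epsilon> * t)) *\<^sub>R ?F r)"
      "sint lborel (\<lambda>r. exp (- (\<epsilon> * t)) *\<^sub>R ?F r) = exp (- (\<epsilon> * t)) *\<^sub>R T t (Rs (of_real (s + \<epsilon>)) x)"
    using sintegrable_bounded_linear[OF bounded_linear_scaleR_right T_Rs(1)[OF t re, of x]]
      sint_bounded_linear[OF bounded_linear_scaleR_right T_Rs(1)[OF t re, of x]]
    by (simp_all only: T_Rs(2)[OF t re, of x])
  have w: "sintegrable lborel (\<lambda>r. (indicator {0..} r * exp (- ((s + z j) * r))) *\<^sub>R (exp (- (z j * t)) *\<^sub>R v j))"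
      "sint lborel (\<lambda>r. (indicator {0..} r * exp (- ((s + z j) * r))) *\<^sub>R (exp (- (z j * t)) *\<^sub>R v j))
       = (1 / (s + z j)) *\<^sub>R (exp (- (z j * t)) *\<^sub>R v j)" for j
    using sintegrable_bounded_linear[OF bounded_linear_scaleR_left
        sintegrable_of_integrable[OF integrable_exp_minus[OF zj]], of j "exp (- (z j * t)) *\<^sub>R v j"]
      sint_bounded_linear[OF bounded_linear_scaleR_left
        sintegrable_of_integrable[OF integrable_exp_minus[OF zj]], of j "exp (- (z j * t)) *\<^sub>R v j"]
    by (simp_all only: sint_eq_integral[OF integrable_exp_minus[OF zj]] integral_exp_minus[OF zj])
  have W: "sintegrable lborel ?W"
    by (rule sintegrable_sum[OF w(1)])
  have sW: "sint lborel ?W = (\<Sum>j\<in>J. (exp (- (z j * t)) / (s + z j)) *\<^sub>R v j)"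
    unfolding sint_sum[OF w(1)] w(2) by simp
  have bound: "norm (exp (- (\<epsilon> * t)) *\<^sub>R ?F r - ?W r) \<le> ?\<phi> r" for r
  proof (cases "0 \<le> r")
    case True
    have ex: "exp (- (complex_of_real (s + \<epsilon>) * of_real r)) = of_real (exp (- (s * r)) * exp (- (\<epsilon> * r)))"
      by (simp add: exp_of_real[symmetric] exp_add[symmetric] algebra_simps)
    have "exp (- (\<epsilon> * t)) *\<^sub>R ?F r = (exp (- (\<epsilon> * t)) * (exp (- (s * r)) * exp (- (\<epsilon> * r)))) *\<^sub>R T (t + r) x"
      using True unfolding ex scaleR_scaleC[symmetric] by simp
    also have "exp (- (\<epsilon> * t)) * (exp (- (s * r)) * exp (- (\<epsilon> * r))) = exp (- (s * r)) * exp (- (\<epsilon> * (t + r)))"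
      by (simp add: exp_add[symmetric] algebra_simps)
    finally have 1: "exp (- (\<epsilon> * t)) *\<^sub>R ?F r = exp (- (s * r)) *\<^sub>R (exp (- (\<epsilon> * (t + r))) *\<^sub>R T (t + r) x)"
      by simp
    have 2: "?W r = exp (- (s * r)) *\<^sub>R (\<Sum>j\<in>J. exp (- (z j * (t + r))) *\<^sub>R v j)"
      unfolding scaleR_sum_right using True
      by (intro sum.cong refl) (simp add: exp_add[symmetric] algebra_simps)
    have "norm (exp (- (\<epsilon> * t)) *\<^sub>R ?F r - ?W r) \<le> exp (- (s * r)) * (\<delta> * exp (- (\<epsilon> / 2 * (t + r))))"
      unfolding 1 2 scaleR_diff_right[symmetric] norm_scaleR
      using approx[of "t + r"] t True by (auto intro!: mult_left_mono)
    \<comment> \<open>The part of the decay that depends on \<open>r\<close> is kept; with it the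
      integral over \<open>r\<close> converges even for \<open>s = 0\<close>.\<close>
    also have "\<dots> \<le> exp (- (s * r)) * (\<delta> * exp (- (\<epsilon> / 2 * r)))"
      using t e d by (intro mult_left_mono) (auto simp: field_simps)
    also have "\<dots> = ?\<phi> r"
      using True by (simp add: exp_add[symmetric] algebra_simps)
    finally show ?thesis .
  qed simp
  have es: "0 < \<epsilon> / 2 + s" using e s by simp
  have int: "integrable lborel ?\<phi>" by (rule exp_const_integrable[OF es])
  have "norm (sint lborel (\<lambda>r. exp (- (\<epsilon> * t)) *\<^sub>R ?F r - ?W r)) \<le> integral\<^sup>L lborel ?\<phi>"
    by (rule norm_sint_le[OF smeas_diff[OF sintegrable_smeas[OF eF(1)] sintegrable_smeas[OF W]] int bound])
  then show ?thesis
    unfolding sint_diff[OF eF(1) W] eF(2) sW integral_mult_left_zero integral_exp_minus[OF es] by simp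
qed

text \<open>Integrating the resolvent estimate against the Stieltjes representation: the exponential
  with frequency \<open>z\<close> is multiplied by \<open>fS z\<close>, and the errors
  \<open>\<delta> / (\<epsilon> / 2 + s)\<close> add up to the same representation evaluated at
  \<open>\<epsilon> / 2\<close>.\<close>

lemma fA_shift_exponential_sum:
  assumes e: "0 < \<epsilon>" and t: "0 \<le> t" and J: "\<And>j. \<epsilon> / 2 \<le> z j" and d: "0 \<le> \<delta>"
    and approx: "\<And>t. 0 \<le> t \<Longrightarrow>
      norm (exp (- (\<epsilon> * t)) *\<^sub>R T t x - (\<Sum>j\<in>J. exp (- (z j * t)) *\<^sub>R v j)) \<le> \<delta> * exp (- (\<epsilon> / 2 * t))"
  shows "norm (exp (- (\<epsilon> * t)) *\<^sub>R T t (fA_shift \<epsilon> x) - (\<Sum>j\<in>J. exp (- (z j * t)) *\<^sub>R (fS (z j) *\<^sub>R v j)))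
    \<le> \<delta> * fS (\<epsilon> / 2)"
proof -
  define P where "P s = (\<Sum>j\<in>J. (exp (- (z j * t)) / (s + z j)) *\<^sub>R v j)" for s
  define Q where "Q s = exp (- (\<epsilon> * t)) *\<^sub>R T t (Rs (of_real (s + \<epsilon>)) x)" for s
  have QP: "norm (Q s - P s) \<le> \<delta> / (\<epsilon> / 2 + s)" if "0 \<le> s" for s
    unfolding Q_def P_def by (rule T_Rs_exponential_sum[OF that e t J d approx])
  have zj: "0 < z j" for j using e J[of j] by simp
  have L: "bounded_linear (\<lambda>u. exp (- (\<epsilon> * t)) *\<^sub>R T t u)"
    by (rule bounded_linear_compose[OF bounded_linear_scaleR_right T_linear[OF t]])
  interpret L: bounded_linear "\<lambda>u. exp (- (\<epsilon> * t)) *\<^sub>R T t u" by (rule L)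
  have Q: "sintegrable \<nu> (\<lambda>s. (1 + s) *\<^sub>R Q s)"
      "sint \<nu> (\<lambda>s. (1 + s) *\<^sub>R Q s) = exp (- (\<epsilon> * t)) *\<^sub>R T t (sint \<nu> (\<lambda>s. (1 + s) *\<^sub>R Rs (of_real (s + \<epsilon>)) x))"
    using sintegrable_bounded_linear[OF L fA_shift_integrable[OF e, of x]]
      sint_bounded_linear[OF L fA_shift_integrable[OF e, of x]]
    by (simp_all only: L.scaleR Q_def)
  have eqQ: "exp (- (\<epsilon> * t)) *\<^sub>R T t (fA_shift \<epsilon> x)
      = c0 *\<^sub>R Q 0 + c1 *\<^sub>R (exp (- (\<epsilon> * t)) *\<^sub>R T t x) + sint \<nu> (\<lambda>s. (1 + s) *\<^sub>R Q s)"
    unfolding fA_shift_def L.add L.scaleR Q(2) by (simp add: Q_def)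
  have p: "sintegrable \<nu> (\<lambda>s. ((1 + s) / (z j + s)) *\<^sub>R (exp (- (z j * t)) *\<^sub>R v j))"
      "sint \<nu> (\<lambda>s. ((1 + s) / (z j + s)) *\<^sub>R (exp (- (z j * t)) *\<^sub>R v j))
        = (LINT s|\<nu>. (1 + s) / (z j + s)) *\<^sub>R (exp (- (z j * t)) *\<^sub>R v j)" for j
    using sintegrable_bounded_linear[OF bounded_linear_scaleR_left
        sintegrable_of_integrable[OF kernel_integrable[OF zj]], of j "exp (- (z j * t)) *\<^sub>R v j"]
      sint_bounded_linear[OF bounded_linear_scaleR_left
        sintegrable_of_integrable[OF kernel_integrable[OF zj]], of j "exp (- (z j * t)) *\<^sub>R v j"]
    by (simp_all only: sint_eq_integral[OF kernel_integrable[OF zj]])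
  have Pe: "(1 + s) *\<^sub>R P s = (\<Sum>j\<in>J. ((1 + s) / (z j + s)) *\<^sub>R (exp (- (z j * t)) *\<^sub>R v j))" for s
    unfolding P_def scaleR_sum_right by (intro sum.cong refl) (simp add: add.commute)
  have P: "sintegrable \<nu> (\<lambda>s. (1 + s) *\<^sub>R P s)"
      "sint \<nu> (\<lambda>s. (1 + s) *\<^sub>R P s)
        = (\<Sum>j\<in>J. (LINT s|\<nu>. (1 + s) / (z j + s)) *\<^sub>R (exp (- (z j * t)) *\<^sub>R v j))"
    unfolding Pe sint_sum[OF p(1)] p(2) by (rule sintegrable_sum[OF p(1)], rule refl)
  have eqP: "(\<Sum>j\<in>J. exp (- (z j * t)) *\<^sub>R (fS (z j) *\<^sub>R v j))
      = c0 *\<^sub>R P 0 + c1 *\<^sub>R (\<Sum>j\<in>J. exp (- (z j * t)) *\<^sub>R v j) + sint \<nu> (\<lambda>s. (1 + s) *\<^sub>R P s)"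
    unfolding P(2) unfolding P_def scaleR_sum_right sum.distrib[symmetric] fS_def
    by (intro sum.cong refl) (simp add: algebra_simps)
  have "norm (sint \<nu> (\<lambda>s. (1 + s) *\<^sub>R Q s) - sint \<nu> (\<lambda>s. (1 + s) *\<^sub>R P s))
      \<le> (LINT s|\<nu>. (1 + s) / (\<epsilon> / 2 + s) * \<delta>)"
    unfolding sint_diff[OF Q(1) P(1), symmetric]
  proof (rule norm_sint_le[OF smeas_diff[OF sintegrable_smeas[OF Q(1)] sintegrable_smeas[OF P(1)]]])
    show "integrable \<nu> (\<lambda>s. (1 + s) / (\<epsilon> / 2 + s) * \<delta>)"
      using kernel_integrable[of "\<epsilon> / 2"] e by (intro integrable_mult_left) auto
    fix s assume "s \<in> space \<nu>"
    then have s: "0 < s" by (simp add: space_\<nu>)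
    have "norm ((1 + s) *\<^sub>R Q s - (1 + s) *\<^sub>R P s) = (1 + s) * norm (Q s - P s)"
      using s unfolding scaleR_diff_right[symmetric] norm_scaleR by simp
    also have "\<dots> \<le> (1 + s) * (\<delta> / (\<epsilon> / 2 + s))"
      using s QP by (intro mult_left_mono) auto
    finally show "norm ((1 + s) *\<^sub>R Q s - (1 + s) *\<^sub>R P s) \<le> (1 + s) / (\<epsilon> / 2 + s) * \<delta>" by simp
  qed
  then have n3: "norm (sint \<nu> (\<lambda>s. (1 + s) *\<^sub>R Q s) - sint \<nu> (\<lambda>s. (1 + s) *\<^sub>R P s))
      \<le> (LINT s|\<nu>. (1 + s) / (\<epsilon> / 2 + s)) * \<delta>" unfolding integral_mult_left_zero .
  have n1: "norm (c0 *\<^sub>R Q 0 - c0 *\<^sub>R P 0) \<le> c0 * (\<delta> / (\<epsilon> / 2))"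
    unfolding scaleR_diff_right[symmetric] norm_scaleR using QP[of 0] c
    by (simp add: mult_left_mono del: times_divide_eq_right)
  have "\<delta> * exp (- (\<epsilon> / 2 * t)) \<le> \<delta>"
    using d e t by (simp add: mult_left_le)
  then have "norm (exp (- (\<epsilon> * t)) *\<^sub>R T t x - (\<Sum>j\<in>J. exp (- (z j * t)) *\<^sub>R v j)) \<le> \<delta>"
    using approx[OF t] by linarith
  then have n2: "norm (c1 *\<^sub>R (exp (- (\<epsilon> * t)) *\<^sub>R T t x) - c1 *\<^sub>R (\<Sum>j\<in>J. exp (- (z j * t)) *\<^sub>R v j)) \<le> c1 * \<delta>"
    unfolding scaleR_diff_right[symmetric] norm_scaleR using c by (simp add: mult_left_mono)
  have "norm (exp (- (\<epsilon> * t)) *\<^sub>R T t (fA_shift \<epsilon> x) - (\<Sum>j\<in>J. exp (- (z j * t)) *\<^sub>R (fS (z j) *\<^sub>R v j)))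
    \<le> c0 * (\<delta> / (\<epsilon> / 2)) + c1 * \<delta> + (LINT s|\<nu>. (1 + s) / (\<epsilon> / 2 + s)) * \<delta>"
    unfolding eqQ eqP add_diff_add
    by (intro norm_triangle_mono n1 n2 n3)
  also have "\<dots> = \<delta> * fS (\<epsilon> / 2)"
    unfolding fS_def by (simp add: algebra_simps)
  finally show ?thesis .
qed

text \<open>Both sides are continuous in the orbit for the norm \<open>sup\<^sub>t exp (\<epsilon> t / 2) * norm (g t)\<close>, and they agree
  when the orbit is replaced by an exponential sum. Only real arguments of the Laplace transforms enter.\<close>
lemma hp_shift:
  assumes mh: "bounded_radon_measure m h" and nk: "bounded_radon_measure n k"
    and lap: "\<And>z. 0 < z \<Longrightarrow> (LINT t|n. exp (- (complex_of_real t * of_real z)) * k t)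
      = (LINT t|m. exp (- (complex_of_real t * of_real z)) * h t) * of_real (fS z)"
    and e: "0 < \<epsilon>"
  shows "sint n (\<lambda>t. k t *\<^sub>C (exp (- (\<epsilon> * t)) *\<^sub>R T t x))
    = sint m (\<lambda>t. h t *\<^sub>C (exp (- (\<epsilon> * t)) *\<^sub>R T t (fA_shift \<epsilon> x)))" (is "?L = ?R")
proof -
  \<comment> \<open>A bound that depends on \<open>\<epsilon>\<close> but not on the exponential
    sum, so that \<open>\<delta>\<close> can tend to \<open>0\<close> at the end.\<close>
  define K where "K = (LINT t|n. norm (k t)) + (LINT t|m. norm (h t)) * fS (\<epsilon> / 2)"
  have cont: "continuous_on {0..} (\<lambda>t. exp (- (a * t)) *\<^sub>R T t u)" for a u
    by (intro continuous_intros T_continuous)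
  have bd: "norm (exp (- (\<epsilon> * t)) *\<^sub>R T t u) \<le> M0 * norm u" if "0 \<le> t" for t u
  proof -
    have "exp (- (\<epsilon> * t)) * norm (T t u) \<le> 1 * (M0 * norm u)"
      using that e norm_T[OF that] by (intro mult_mono) auto
    then show ?thesis by simp
  qed
  have le: "norm (?L - ?R) \<le> \<delta> * K" if d: "0 < \<delta>" for \<delta>
  proof -
    \<comment> \<open>The first half of the damping provides the decay at infinity that the
      approximation requires.\<close>
    have "((\<lambda>t. exp (- (\<epsilon> / 2 * t)) *\<^sub>R T t x) \<longlongrightarrow> 0) at_top"
    proof (rule Lim_null_comparison)
      show "\<forall>\<^sub>F t in at_top. norm (exp (- (\<epsilon> / 2 * t)) *\<^sub>R T t x) \<le> exp (- (\<epsilon> / 2 * t)) * (M0 * norm x)"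
        using eventually_ge_at_top[of 0] by eventually_elim (auto intro!: mult_left_mono norm_T)
      show "((\<lambda>t. exp (- (\<epsilon> / 2 * t)) * (M0 * norm x)) \<longlongrightarrow> 0) at_top"
        by (rule tendsto_mult_left_zero) (use e in real_asymp)
    qed
    from exponential_sum_approx[OF cont this d] obtain J :: "(nat \<times> nat) set" and l v where
      J: "finite J" "\<And>j. 0 \<le> l j"
      and Jv: "\<And>t. 0 \<le> t \<Longrightarrow> norm (exp (- (\<epsilon> / 2 * t)) *\<^sub>R T t x - (\<Sum>j\<in>J. exp (- (l j * t)) *\<^sub>R v j)) < \<delta>"
      by blast
    \<comment> \<open>Multiplying the approximation by the second half of the damping shifts all
      frequencies, among them possibly \<open>0\<close>, to at least \<open>\<epsilon> / 2\<close>
      and gives the error its weight.\<close>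
    define z where "z j = l j + \<epsilon> / 2" for j
    have z: "\<epsilon> / 2 \<le> z j" "0 < z j" "0 \<le> z j" for j using J(2)[of j] e by (auto simp: z_def)
    let ?p = "\<lambda>t. \<Sum>j\<in>J. exp (- (z j * t)) *\<^sub>R v j"
    let ?q = "\<lambda>t. \<Sum>j\<in>J. exp (- (z j * t)) *\<^sub>R (fS (z j) *\<^sub>R v j)"
    have approx: "norm (exp (- (\<epsilon> * t)) *\<^sub>R T t x - ?p t) \<le> \<delta> * exp (- (\<epsilon> / 2 * t))" if t: "0 \<le> t" for t
    proof -
      have 1: "exp (- (\<epsilon> * t)) *\<^sub>R T t x = exp (- (\<epsilon> / 2 * t)) *\<^sub>R (exp (- (\<epsilon> / 2 * t)) *\<^sub>R T t x)"
        by (simp add: exp_add[symmetric])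
      have 2: "?p t = exp (- (\<epsilon> / 2 * t)) *\<^sub>R (\<Sum>j\<in>J. exp (- (l j * t)) *\<^sub>R v j)"
        unfolding scaleR_sum_right
        by (intro sum.cong refl) (simp add: z_def exp_add[symmetric] algebra_simps)
      show ?thesis
        unfolding 1 2 scaleR_diff_right[symmetric] norm_scaleR
        using Jv[OF t] by (simp add: mult.commute mult_left_mono)
    qed
    have d1: "norm (exp (- (\<epsilon> * t)) *\<^sub>R T t x - ?p t) \<le> \<delta>" if "0 \<le> t" for t
    proof -
      have "\<delta> * exp (- (\<epsilon> / 2 * t)) \<le> \<delta>" using d e that by (simp add: mult_left_le)
      then show ?thesis using approx[OF that] by linarith
    qed
    have d2: "norm (exp (- (\<epsilon> * t)) *\<^sub>R T t (fA_shift \<epsilon> x) - ?q t) \<le> \<delta> * fS (\<epsilon> / 2)" if "0 \<le> t" for t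
      by (rule fA_shift_exponential_sum[OF e that z(1) less_imp_le[OF d] approx])
    have cp: "continuous_on {0..} ?p" "continuous_on {0..} ?q"
      by (intro continuous_intros)+
    have bound: "norm (?p t) \<le> (\<Sum>j\<in>J. norm (v j))" "norm (?q t) \<le> (\<Sum>j\<in>J. norm (fS (z j) *\<^sub>R v j))"
      if t: "0 \<le> t" for t
    proof -
      have *: "norm (exp (- (z j * t)) *\<^sub>R u) \<le> norm u" for j and u :: 'a
        using mult_right_mono[of "exp (- (z j * t))" 1 "norm u"] t z(3)[of j] by simp
      show "norm (?p t) \<le> (\<Sum>j\<in>J. norm (v j))" "norm (?q t) \<le> (\<Sum>j\<in>J. norm (fS (z j) *\<^sub>R v j))"
        by (rule sum_norm_le, rule *)+
    qed
    have L: "norm (?L - sint n (\<lambda>t. k t *\<^sub>C ?p t)) \<le> (LINT t|n. norm (k t)) * \<delta>"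
      by (rule norm_sint_radon_diff[OF nk cont cp(1) bd bound(1) d1])
    have R: "norm (?R - sint m (\<lambda>t. h t *\<^sub>C ?q t)) \<le> (LINT t|m. norm (h t)) * (\<delta> * fS (\<epsilon> / 2))"
      by (rule norm_sint_radon_diff[OF mh cont cp(2) bd bound(2) d2])
    \<comment> \<open>Here the relation of the two transforms enters: each term carries the
      transform of \<open>k n\<close>, or that of \<open>h m\<close> times \<open>fS\<close>, at the
      same frequency.\<close>
    have pq: "sint n (\<lambda>t. k t *\<^sub>C ?p t) = sint m (\<lambda>t. h t *\<^sub>C ?q t)"
      unfolding sint_radon_exponential_sum[OF nk z(3)] sint_radon_exponential_sum[OF mh z(3)]
      by (intro sum.cong refl) (simp add: lap z(2) scaleR_scaleC scaleC_scaleC)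
    have tri: "norm (a - b) \<le> norm (a - c) + norm (b - c)" for a b c :: 'a
      using norm_triangle_ineq4[of "a - c" "b - c"] by simp
    have "norm (?L - ?R) \<le> (LINT t|n. norm (k t)) * \<delta> + (LINT t|m. norm (h t)) * (\<delta> * fS (\<epsilon> / 2))"
      by (rule order_trans[OF tri add_mono[OF L R[folded pq]]])
    then show ?thesis unfolding K_def by (simp only: distrib_left mult_ac)
  qed
  have "((\<lambda>\<delta>. \<delta> * K) \<longlongrightarrow> 0 * K) (at_right 0)" by (intro tendsto_intros)
  then have "norm (?L - ?R) \<le> 0 * K"
  proof (rule tendsto_lowerbound)
    show "\<forall>\<^sub>F \<delta> in at_right 0. norm (?L - ?R) \<le> \<delta> * K"
      unfolding eventually_at_right_field using le by (intro exI[of _ 1]) auto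
  qed simp
  then show ?thesis by simp
qed

section \<open>The operator \<open>f(A)\<close> on the range of \<open>A\<close>\<close>

definition "fA w x = c0 *\<^sub>R w + c1 *\<^sub>R x + sint \<nu> (\<lambda>s. (1 + s) *\<^sub>R Rs (of_real s) x)"

lemma Rs_range:
  assumes w: "(w, - x) \<in> semigroup_generator T" and l: "0 < Re l"
  shows "Rs l x = w - l *\<^sub>C Rs l w"
proof -
  have "Rs l (0 - x) = l *\<^sub>C Rs l w - w" using Rs_of_generator[OF l w] by simp
  moreover have "Rs l 0 = 0" using Rs_scaleR[OF l, of 0 0] by simp
  ultimately show ?thesis unfolding Rs_diff[OF l] by (simp add: algebra_simps)
qed

text \<open>For \<open>x = A w\<close> the resolvent is \<open>w - s Rs s w\<close>, which stays
  bounded as \<open>s\<close> tends to \<open>0\<close>, where \<open>norm_Rs\<close> alone only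
  gives \<open>1 / s\<close>. This makes the integral in \<open>fA\<close> converge near
  \<open>0\<close>.\<close>

lemma norm_Rs_range:
  assumes w: "(w, - x) \<in> semigroup_generator T" and s: "0 < s"
  shows "norm (Rs (of_real s) x) \<le> (1 + M0) * norm w"
proof -
  have re: "0 < Re (of_real s)" using s by simp
  have "norm (of_real s *\<^sub>C Rs (of_real s) w) \<le> M0 * norm w"
    using norm_Rs[OF re, of w] s by (simp add: norm_scaleC field_simps)
  then show ?thesis
    unfolding Rs_range[OF w re]
    using norm_triangle_ineq4[of w "of_real s *\<^sub>C Rs (of_real s) w"] by (simp add: algebra_simps)
qed

text \<open>The bound \<open>W\<close> serves \<open>s \<le> 1\<close>, the bound
  \<open>X / s\<close> serves \<open>s > 1\<close>; either way the factor \<open>1 + s\<close> costs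
  at most \<open>2\<close>. The resolvent point \<open>r\<close> is separate from \<open>s\<close>
  so that \<open>r = s + \<epsilon>\<close> is covered.\<close>

lemma norm_kernel_Rs_le:
  assumes w: "norm (Rs (of_real r) x) \<le> W" and x: "norm (Rs (of_real r) x) \<le> X / s" and s: "0 < s"
    and "0 \<le> W" "0 \<le> X"
  shows "norm ((1 + s) *\<^sub>R Rs (of_real r) x) \<le> 2 * (W + X)"
proof (cases "s \<le> 1")
  case True
  have "(1 + s) * norm (Rs (of_real r) x) \<le> 2 * W"
    using True s assms by (intro mult_mono) auto
  then show ?thesis using s \<open>0 \<le> X\<close> by simp
next
  case False
  have "(1 + s) * norm (Rs (of_real r) x) \<le> (1 + s) * (X / s)"
    using s x by (intro mult_left_mono) auto
  also have "\<dots> \<le> 2 * X"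
  proof -
    have "X \<le> X * s" using False \<open>0 \<le> X\<close> by (simp add: mult_le_cancel_left1)
    then show ?thesis using s by (simp add: field_simps)
  qed
  finally show ?thesis using s \<open>0 \<le> W\<close> by simp
qed

lemma fA_integrable:
  assumes w: "(w, - x) \<in> semigroup_generator T"
  shows "sintegrable \<nu> (\<lambda>s. (1 + s) *\<^sub>R Rs (of_real s) x)"
proof (rule sintegrable_\<nu>)
  show "continuous_on {0<..} (\<lambda>s. (1 + s) *\<^sub>R Rs (of_real s) x)"
    by (intro continuous_intros Rs_of_real_continuous)
  fix s :: real assume s: "0 < s"
  show "norm ((1 + s) *\<^sub>R Rs (of_real s) x) \<le> 2 * ((1 + M0) * norm w + M0 * norm x)"
    by (rule norm_kernel_Rs_le[OF norm_Rs_range[OF w s] _ s])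
       (use norm_Rs[of "of_real s" x] s M0_nonneg in auto)
qed

text \<open>The argument \<open>x + \<epsilon> w\<close> is \<open>(A + \<epsilon>) w\<close>. Its
  resolvents are \<open>w - s Rs (s + \<epsilon>) w\<close>, bounded uniformly in \<open>s\<close>
  and \<open>\<epsilon>\<close>, so dominated convergence applies with a constant.\<close>

lemma fA_shift_tendsto:
  assumes w: "(w, - x) \<in> semigroup_generator T" and e: "\<And>i. 0 < \<epsilon> i" "\<And>i. \<epsilon> i \<le> 1" "\<epsilon> \<longlonglongrightarrow> 0"
  shows "(\<lambda>i::nat. fA_shift (\<epsilon> i) (x + \<epsilon> i *\<^sub>R w)) \<longlonglongrightarrow> fA w x"
proof -
  have re: "0 < Re (of_real (s + \<epsilon> i))" if "0 \<le> s" for s i using that e(1)[of i] by simp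
  \<comment> \<open>For \<open>s = 0\<close> this is \<open>w\<close> itself, so the term with
    \<open>c0\<close> does not vary with \<open>i\<close>.\<close>
  have R: "Rs (of_real (s + \<epsilon> i)) (x + \<epsilon> i *\<^sub>R w) = w - s *\<^sub>R Rs (of_real (s + \<epsilon> i)) w" if "0 \<le> s" for s i
    unfolding Rs_add[OF re[OF that]] Rs_scaleR[OF re[OF that]] Rs_range[OF w re[OF that]]
    by (simp add: scaleR_scaleC scaleC.add_left)
  have "(\<lambda>i. sint \<nu> (\<lambda>s. (1 + s) *\<^sub>R Rs (of_real (s + \<epsilon> i)) (x + \<epsilon> i *\<^sub>R w)))
      \<longlonglongrightarrow> sint \<nu> (\<lambda>s. (1 + s) *\<^sub>R Rs (of_real s) x)"
  proof (rule sint_tendsto)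
    show "smeas \<nu> (\<lambda>s. (1 + s) *\<^sub>R Rs (of_real (s + \<epsilon> i)) (x + \<epsilon> i *\<^sub>R w))" for i
      by (rule sintegrable_smeas[OF fA_shift_integrable[OF e(1)]])
    show "smeas \<nu> (\<lambda>s. (1 + s) *\<^sub>R Rs (of_real s) x)"
      by (rule sintegrable_smeas[OF fA_integrable[OF w]])
    show "integrable \<nu> (\<lambda>_. 2 * ((1 + M0) * norm w + M0 * (norm x + norm w)))"
      using finite_\<nu> by (simp add: finite_measure.integrable_const)
    fix s assume "s \<in> space \<nu>"
    then have s: "0 < s" by (simp add: space_\<nu>)
    show "norm ((1 + s) *\<^sub>R Rs (of_real (s + \<epsilon> i)) (x + \<epsilon> i *\<^sub>R w))
        \<le> 2 * ((1 + M0) * norm w + M0 * (norm x + norm w))" for i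
    proof (rule norm_kernel_Rs_le[OF _ _ s])
      have re': "0 < Re (of_real (s + \<epsilon> i))" using re s by simp
      have "s * norm (Rs (of_real (s + \<epsilon> i)) w) \<le> s * (M0 * norm w / (s + \<epsilon> i))"
        using norm_Rs[OF re', of w] s by (intro mult_left_mono) auto
      also have "\<dots> = (s / (s + \<epsilon> i)) * (M0 * norm w)" by simp
      also have "\<dots> \<le> 1 * (M0 * norm w)"
        using s e(1)[of i] M0_nonneg by (intro mult_right_mono) auto
      finally show "norm (Rs (of_real (s + \<epsilon> i)) (x + \<epsilon> i *\<^sub>R w)) \<le> (1 + M0) * norm w"
        unfolding R[OF less_imp_le[OF s]]
        using norm_triangle_ineq4[of w "s *\<^sub>R Rs (of_real (s + \<epsilon> i)) w"] s by (simp add: algebra_simps)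
      have "norm (x + \<epsilon> i *\<^sub>R w) \<le> norm x + \<epsilon> i * norm w"
        using norm_triangle_ineq[of x "\<epsilon> i *\<^sub>R w"] e(1)[of i] by simp
      also have "\<dots> \<le> norm x + 1 * norm w" by (intro add_left_mono mult_right_mono e) simp
      finally have "M0 * norm (x + \<epsilon> i *\<^sub>R w) \<le> M0 * (norm x + norm w)"
        using M0_nonneg by (intro mult_left_mono) auto
      then have "M0 * norm (x + \<epsilon> i *\<^sub>R w) / (s + \<epsilon> i) \<le> M0 * (norm x + norm w) / s"
        using s e(1)[of i] M0_nonneg by (intro frac_le) auto
      then show "norm (Rs (of_real (s + \<epsilon> i)) (x + \<epsilon> i *\<^sub>R w)) \<le> M0 * (norm x + norm w) / s"
        using norm_Rs[OF re', of "x + \<epsilon> i *\<^sub>R w"] by simp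
    qed (use M0_nonneg in auto)
    have "(\<lambda>i. Rs (of_real (s + \<epsilon> i)) w) \<longlonglongrightarrow> Rs (of_real s) w"
    proof -
      have "(\<lambda>i. s + \<epsilon> i) \<longlonglongrightarrow> s" using tendsto_add[OF tendsto_const e(3), of s] by simp
      from continuous_on_tendsto_compose[OF Rs_of_real_continuous this, of w] show ?thesis
        using s e(1) by (simp add: add_pos_pos del: of_real_add)
    qed
    then have "(\<lambda>i. (1 + s) *\<^sub>R (w - s *\<^sub>R Rs (of_real (s + \<epsilon> i)) w)) \<longlonglongrightarrow> (1 + s) *\<^sub>R (w - s *\<^sub>R Rs (of_real s) w)"
      by (intro tendsto_intros)
    then show "(\<lambda>i. (1 + s) *\<^sub>R Rs (of_real (s + \<epsilon> i)) (x + \<epsilon> i *\<^sub>R w)) \<longlonglongrightarrow> (1 + s) *\<^sub>R Rs (of_real s) x"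
      using Rs_range[OF w, of "of_real s"] s by (simp only: R[OF less_imp_le[OF s]]) (simp add: scaleR_scaleC)
  qed
  moreover have "(\<lambda>i. c1 *\<^sub>R (x + \<epsilon> i *\<^sub>R w)) \<longlonglongrightarrow> c1 *\<^sub>R (x + 0 *\<^sub>R w)"
    by (intro tendsto_intros e)
  moreover have "Rs (of_real (\<epsilon> i)) (x + \<epsilon> i *\<^sub>R w) = w" for i
    using R[of 0 i] by simp
  ultimately show ?thesis
    unfolding fA_shift_def fA_def by (auto intro!: tendsto_add)
qed

text \<open>Undamping \<open>hp_shift\<close> along \<open>(A + \<epsilon>) w\<close>. The pair of
  measures is arbitrary, subject to the relation at real points; it will be the unknown pair behind
  membership in the calculus as well as the explicit regularizer.\<close>

theorem hp_operator_fA: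
  assumes mh: "bounded_radon_measure m h" and nk: "bounded_radon_measure n k"
    and lap: "\<And>z. 0 < z \<Longrightarrow> (LINT t|n. exp (- (complex_of_real t * of_real z)) * k t)
      = (LINT t|m. exp (- (complex_of_real t * of_real z)) * h t) * of_real (fS z)"
    and w: "(w, - x) \<in> semigroup_generator T"
  shows "hp_operator T n k x = hp_operator T m h (fA w x)"
proof -
  define \<epsilon> where "\<epsilon> i = 1 / real (Suc i)" for i
  have e: "\<And>i. 0 < \<epsilon> i" "\<And>i. \<epsilon> i \<le> 1" "\<epsilon> \<longlonglongrightarrow> 0"
    using LIMSEQ_inverse_real_of_nat by (auto simp: \<epsilon>_def[abs_def] inverse_eq_divide)
  \<comment> \<open>One limit for both sides: the damping is at most \<open>1\<close> and the
    vectors converge, hence the orbits are dominated by \<open>M0 * D\<close>.\<close>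
  have main: "(\<lambda>i. sint m' (\<lambda>t. h' t *\<^sub>C (exp (- (\<epsilon> i * t)) *\<^sub>R T t (u i)))) \<longlonglongrightarrow> hp_operator T m' h' v"
    if mh': "bounded_radon_measure m' h'" and u: "u \<longlonglongrightarrow> v" for m' h' u v
  proof -
    obtain D where D: "\<And>i. norm (u i) \<le> D"
      using convergent_imp_bounded[OF u] by (auto simp: bounded_iff)
    have D0: "0 \<le> D" using D[of 0] norm_ge_zero order_trans by blast
    have "(\<lambda>i. sint m' (\<lambda>t. h' t *\<^sub>C (exp (- (\<epsilon> i * t)) *\<^sub>R T t (u i)))) \<longlonglongrightarrow> sint m' (\<lambda>t. h' t *\<^sub>C T t v)"
    proof (rule sint_tendsto)
      show "smeas m' (\<lambda>t. h' t *\<^sub>C (exp (- (\<epsilon> i * t)) *\<^sub>R T t (u i)))" for i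
        by (rule smeas_radon[OF mh']) (intro continuous_intros T_continuous)
      show "smeas m' (\<lambda>t. h' t *\<^sub>C T t v)"
        by (rule smeas_radon[OF mh' T_continuous])
      show "integrable m' (\<lambda>t. norm (h' t) * (M0 * D))"
        using mh' by (auto simp: bounded_radon_measure_def)
      fix t assume "t \<in> space m'"
      then have t: "0 \<le> t" using bounded_radon_space[OF mh'] by simp
      show "norm (h' t *\<^sub>C (exp (- (\<epsilon> i * t)) *\<^sub>R T t (u i))) \<le> norm (h' t) * (M0 * D)" for i
      proof -
        have "norm (T t (u i)) \<le> M0 * D"
          using norm_T[OF t, of "u i"] mult_left_mono[OF D M0_nonneg, of i] by linarith
        then have "exp (- (\<epsilon> i * t)) * norm (T t (u i)) \<le> 1 * (M0 * D)"
          using t e(1)[of i] by (intro mult_mono) auto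
        then show ?thesis unfolding norm_scaleC by (intro mult_left_mono) auto
      qed
      have "(\<lambda>i. T t (u i)) \<longlonglongrightarrow> T t v"
        by (rule bounded_linear.tendsto[OF T_linear[OF t] u])
      then have "(\<lambda>i. h' t *\<^sub>C (exp (- (\<epsilon> i * t)) *\<^sub>R T t (u i))) \<longlonglongrightarrow> h' t *\<^sub>C (exp (- (0 * t)) *\<^sub>R T t v)"
        by (intro scaleC.tendsto tendsto_const tendsto_scaleR tendsto_exp tendsto_minus tendsto_mult e)
      then show "(\<lambda>i. h' t *\<^sub>C (exp (- (\<epsilon> i * t)) *\<^sub>R T t (u i))) \<longlonglongrightarrow> h' t *\<^sub>C T t v" by simp
    qed
    then show ?thesis by (simp add: hp_operator_def sint_def)
  qed
  have "(\<lambda>i. x + \<epsilon> i *\<^sub>R w) \<longlonglongrightarrow> x + 0 *\<^sub>R w" by (intro tendsto_intros e)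
  then have 1: "(\<lambda>i. sint n (\<lambda>t. k t *\<^sub>C (exp (- (\<epsilon> i * t)) *\<^sub>R T t (x + \<epsilon> i *\<^sub>R w)))) \<longlonglongrightarrow> hp_operator T n k x"
    by (intro main[OF nk]) simp
  have 2: "(\<lambda>i. sint m (\<lambda>t. h t *\<^sub>C (exp (- (\<epsilon> i * t)) *\<^sub>R T t (fA_shift (\<epsilon> i) (x + \<epsilon> i *\<^sub>R w)))))
      \<longlonglongrightarrow> hp_operator T m h (fA w x)"
    by (rule main[OF mh fA_shift_tendsto[OF w e]])
  have "sint n (\<lambda>t. k t *\<^sub>C (exp (- (\<epsilon> i * t)) *\<^sub>R T t (x + \<epsilon> i *\<^sub>R w)))
      = sint m (\<lambda>t. h t *\<^sub>C (exp (- (\<epsilon> i * t)) *\<^sub>R T t (fA_shift (\<epsilon> i) (x + \<epsilon> i *\<^sub>R w))))" for i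
    by (rule hp_shift[OF mh nk lap e(1)])
  with 1 2 show ?thesis by (simp only: LIMSEQ_unique)
qed

end

section \<open>The holomorphic extension of a Stieltjes function\<close>

lemma stieltjes_obtain:
  assumes "stieltjes f"
  obtains c0 c1 \<nu> where "stieltjes_data c0 c1 \<nu>" "\<And>z. 0 < z \<Longrightarrow> f z = stieltjes_data.fS c0 c1 \<nu> z"
proof -
  obtain c0 c1 and \<nu> :: "real measure" where c: "0 \<le> c0" "0 \<le> c1"
    and sets: "sets \<nu> = sets (restrict_space borel {0<..})"
    and fin: "(\<integral>\<^sup>+ s. ennreal (1 / (1 + s)) \<partial>\<nu>) < \<infinity>"
    and f: "\<And>z. 0 < z \<Longrightarrow> f z = c0 / z + c1 + (LINT s|\<nu>. 1 / (z + s))"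
    using assms unfolding stieltjes_def by blast
  have space: "space \<nu> = {0<..}"
    using sets_eq_imp_space_eq[OF sets] by (simp add: space_restrict_space)
  have id: "(\<lambda>s. s) \<in> borel_measurable \<nu>"
    unfolding measurable_cong_sets[OF sets refl] by (rule measurable_restrict_space1) simp
  have w: "(\<lambda>s. 1 / (1 + s)) \<in> borel_measurable \<nu>" using id by measurable
  \<comment> \<open>The integrability condition on the Stieltjes measure says exactly that
    \<open>N\<close> is finite.\<close>
  define N where "N = density \<nu> (\<lambda>s. ennreal (1 / (1 + s)))"
  have data: "stieltjes_data c0 c1 N"
    unfolding stieltjes_data_def
  proof (intro conjI)
    show "finite_measure N"
    proof
      have "emeasure N (space N) = (\<integral>\<^sup>+ s. ennreal (1 / (1 + s)) * indicator (space \<nu>) s \<partial>\<nu>)"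
        unfolding N_def using w by (subst emeasure_density) auto
      also have "\<dots> = (\<integral>\<^sup>+ s. ennreal (1 / (1 + s)) \<partial>\<nu>)"
        by (rule nn_integral_cong) simp
      finally show "emeasure N (space N) \<noteq> \<infinity>" using fin by simp
    qed
  qed (use c sets in \<open>auto simp: N_def\<close>)
  have "f z = stieltjes_data.fS c0 c1 N z" if z: "0 < z" for z
  proof -
    have "(LINT s|N. (1 + s) / (z + s)) = (LINT s|\<nu>. (1 / (1 + s)) *\<^sub>R ((1 + s) / (z + s)))"
      unfolding N_def
    proof (rule integral_density)
      show "(\<lambda>s. (1 + s) / (z + s)) \<in> borel_measurable \<nu>" using id by measurable
      show "AE s in \<nu>. 0 \<le> 1 / (1 + s)" by (rule AE_I2) (auto simp: space)
    qed (rule w)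
    also have "\<dots> = (LINT s|\<nu>. 1 / (z + s))"
      by (rule Bochner_Integration.integral_cong) (auto simp: space)
    finally show ?thesis using f[OF z] by (simp add: stieltjes_data.fS_def[OF data])
  qed
  then show ?thesis by (rule that[OF data])
qed

context stieltjes_data
begin

definition F0 :: "complex \<Rightarrow> complex"
  where "F0 z = of_real c0 / z + of_real c1 + (LINT s|\<nu>. of_real (1 + s) / (z + of_real s))"

lemma F0_of_real: "0 < x \<Longrightarrow> F0 (of_real x) = of_real (fS x)"
proof -
  have "(LINT s|\<nu>. complex_of_real (1 + s) / (of_real x + of_real s))
      = (LINT s|\<nu>. complex_of_real ((1 + s) / (x + s)))"
    by (simp only: of_real_add of_real_divide of_real_1)
  then have eq: "(LINT s|\<nu>. complex_of_real (1 + s) / (of_real x + of_real s))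
      = of_real (LINT s|\<nu>. (1 + s) / (x + s))"
    by (simp only: integral_complex_of_real)
  show "F0 (of_real x) = of_real (fS x)" unfolding F0_def fS_def eq by simp
qed

text \<open>Since \<open>- s\<close> lies on the cut, a ball around \<open>z0\<close> that misses
  the cut keeps \<open>z0 + s\<close> away from \<open>0\<close>; half its radius makes this uniform
  in \<open>z\<close>. For large \<open>s\<close> the modulus of \<open>z + s\<close> grows like
  \<open>s\<close>.\<close>

lemma cut_plane_kernel_bound:
  assumes "z0 \<in> - \<real>\<^sub>\<le>\<^sub>0"
  obtains d C where "0 < d" "0 < C"
    "\<And>z s. dist z z0 < d \<Longrightarrow> 0 < s \<Longrightarrow> d \<le> cmod (z + of_real s) \<and> 1 + s \<le> C * cmod (z + of_real s)"
proof -
  have "open (- \<real>\<^sub>\<le>\<^sub>0 :: complex set)" by (simp add: open_Compl)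
  then obtain d where d: "d > 0" "ball z0 d \<subseteq> - \<real>\<^sub>\<le>\<^sub>0"
    using assms open_contains_ball by blast
  have far: "d \<le> cmod (z0 + of_real s)" if "0 < s" for s
  proof (rule ccontr)
    assume "\<not> d \<le> cmod (z0 + of_real s)"
    then have "- complex_of_real s \<in> ball z0 d" by (simp add: dist_norm)
    then have "- complex_of_real s \<notin> \<real>\<^sub>\<le>\<^sub>0" using d by blast
    then show False using that by (simp add: complex_nonpos_Reals_iff)
  qed
  \<comment> \<open>From \<open>1 + s \<le> (1 + cmod z0) + cmod (z0 + s)\<close> and
    \<open>cmod (z0 + s) \<ge> d\<close>; the factor \<open>2\<close> passes from \<open>z0\<close>
    to \<open>z\<close>.\<close>
  define C where "C = 2 * ((1 + cmod z0) / d + 1)"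
  show ?thesis
  proof (rule that[of "d / 2" C])
    fix z s assume z: "dist z z0 < d / 2" and s: "(0::real) < s"
    have half: "cmod (z0 + of_real s) / 2 \<le> cmod (z + of_real s)"
    proof -
      have "cmod (z0 + of_real s) \<le> cmod (z + of_real s) + cmod (z0 - z)"
        using norm_triangle_ineq[of "z + of_real s" "z0 - z"] by (simp add: add.commute)
      also have "cmod (z0 - z) \<le> cmod (z0 + of_real s) / 2"
        using z far[OF s] by (simp add: dist_norm norm_minus_commute)
      finally show ?thesis by simp
    qed
    moreover have "1 + s \<le> ((1 + cmod z0) / d + 1) * cmod (z0 + of_real s)"
    proof -
      have "s \<le> cmod z0 + cmod (z0 + of_real s)"
        using norm_triangle_ineq4[of "z0 + of_real s" z0] s by simp
      moreover have "1 + cmod z0 \<le> (1 + cmod z0) / d * cmod (z0 + of_real s)"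
        using mult_left_mono[OF far[OF s], of "(1 + cmod z0) / d"] d by (simp add: add_nonneg_nonneg)
      ultimately show ?thesis by (simp add: algebra_simps)
    qed
    moreover have "((1 + cmod z0) / d + 1) * cmod (z0 + of_real s)
        \<le> ((1 + cmod z0) / d + 1) * (2 * cmod (z + of_real s))"
      using half d by (intro mult_left_mono) (auto simp: add_nonneg_nonneg)
    ultimately show "d / 2 \<le> cmod (z + of_real s) \<and> 1 + s \<le> C * cmod (z + of_real s)"
      using far[OF s] unfolding C_def by (auto simp: algebra_simps)
  qed (use d in \<open>auto simp: C_def add_pos_nonneg add_nonneg_pos\<close>)
qed

text \<open>The difference quotient of \<open>1 / (z + s)\<close> at \<open>z0\<close> is
  \<open>- 1 / ((z + s) (z0 + s))\<close>. Times \<open>1 + s\<close> it is at most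
  \<open>C / d\<close> near \<open>z0\<close>, a constant that is integrable for the finite measure,
  so the limit passes under the integral.\<close>

lemma F0_holomorphic: "F0 holomorphic_on (- \<real>\<^sub>\<le>\<^sub>0)"
proof -
  define I where "I z = (LINT s|\<nu>. complex_of_real (1 + s) / (z + of_real s))" for z
  have m: "(\<lambda>s. complex_of_real (1 + s) / (z + of_real s)) \<in> borel_measurable \<nu>" for z
    using \<nu>_ident by measurable
  have "I field_differentiable (at z0 within - \<real>\<^sub>\<le>\<^sub>0)" if z0: "z0 \<in> - \<real>\<^sub>\<le>\<^sub>0" for z0
  proof -
    obtain d C where d: "0 < d" "0 < C"
      and b: "\<And>z s. dist z z0 < d \<Longrightarrow> 0 < s \<Longrightarrow> d \<le> cmod (z + of_real s) \<and> 1 + s \<le> C * cmod (z + of_real s)"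
      using cut_plane_kernel_bound[OF z0] by blast
    have b0: "d \<le> cmod (z0 + of_real s)" "z0 + of_real s \<noteq> 0" if "0 < s" for s
      using b[of z0 s] that d by auto
    have int: "integrable \<nu> (\<lambda>s. complex_of_real (1 + s) / (z + of_real s))" if z: "dist z z0 < d" for z
    proof (rule \<nu>_integrable_bounded[OF m, of _ C])
      fix s :: real assume s: "0 < s"
      then have "1 + s \<le> C * cmod (z + of_real s)" "0 < cmod (z + of_real s)" using b[OF z s] d by auto
      then show "cmod (complex_of_real (1 + s) / (z + of_real s)) \<le> C"
        using s by (simp add: norm_divide pos_divide_le_eq norm_of_real del: of_real_add)
    qed
    let ?D = "\<lambda>z s. - complex_of_real (1 + s) / ((z + of_real s) * (z0 + of_real s))"
    have "((\<lambda>z. (I z - I z0) / (z - z0)) \<longlongrightarrow> (LINT s|\<nu>. ?D z0 s)) (at z0 within ball z0 d)"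
      unfolding tendsto_at_iff_sequentially comp_def
    proof (intro allI impI)
      fix X assume X: "\<forall>i. X i \<in> ball z0 d - {z0}" "X \<longlonglongrightarrow> z0"
      then have Xd: "dist (X i) z0 < d" "X i \<noteq> z0" for i by (auto simp: dist_commute)
      have q: "(I (X i) - I z0) / (X i - z0) = (LINT s|\<nu>. ?D (X i) s)" for i
      proof -
        have "I (X i) - I z0 = (LINT s|\<nu>. complex_of_real (1 + s) / (X i + of_real s)
            - complex_of_real (1 + s) / (z0 + of_real s))"
          unfolding I_def using int[OF Xd(1)] int[of z0] d
          by (intro Bochner_Integration.integral_diff[symmetric]) auto
        also have "\<dots> = (LINT s|\<nu>. (X i - z0) * ?D (X i) s)"
        proof (rule Bochner_Integration.integral_cong[OF refl])
          fix s assume "s \<in> space \<nu>"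
          then have s: "0 < s" by (simp add: space_\<nu>)
          have "X i + of_real s \<noteq> 0" using b[OF Xd(1) s, of i] d by auto
          then show "complex_of_real (1 + s) / (X i + of_real s) - complex_of_real (1 + s) / (z0 + of_real s)
              = (X i - z0) * ?D (X i) s"
            using b0(2)[OF s] by (simp add: divide_simps) (simp add: algebra_simps)
        qed
        also have "\<dots> = (X i - z0) * (LINT s|\<nu>. ?D (X i) s)" by (rule integral_mult_right_zero)
        finally show ?thesis using Xd(2)[of i] by (simp add: field_simps)
      qed
      show "(\<lambda>i. (I (X i) - I z0) / (X i - z0)) \<longlonglongrightarrow> (LINT s|\<nu>. ?D z0 s)"
        unfolding q
      proof (rule integral_dominated_convergence[where w="\<lambda>_. C / d"])
        show "?D z0 \<in> borel_measurable \<nu>" "?D (X i) \<in> borel_measurable \<nu>" for i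
          using \<nu>_ident by measurable
        show "integrable \<nu> (\<lambda>_. C / d)" using finite_\<nu> by (simp add: finite_measure.integrable_const)
        show "AE s in \<nu>. (\<lambda>i. ?D (X i) s) \<longlonglongrightarrow> ?D z0 s"
        proof (rule AE_I2)
          fix s assume "s \<in> space \<nu>"
          then have s: "0 < s" by (simp add: space_\<nu>)
          show "(\<lambda>i. ?D (X i) s) \<longlonglongrightarrow> ?D z0 s"
            using b0(2)[OF s] by (intro tendsto_intros X) auto
        qed
        show "AE s in \<nu>. norm (?D (X i) s) \<le> C / d" for i
        proof (rule AE_I2)
          fix s assume "s \<in> space \<nu>"
          then have s: "0 < s" by (simp add: space_\<nu>)
          have x: "1 + s \<le> C * cmod (X i + of_real s)" "0 < cmod (X i + of_real s)"
            using b[OF Xd(1) s, of i] d by auto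
          have "norm (?D (X i) s) = ((1 + s) / cmod (X i + of_real s)) / cmod (z0 + of_real s)"
            using s by (simp add: norm_divide norm_mult norm_of_real del: of_real_add)
          also have "\<dots> \<le> C / d"
            using x b0(1)[OF s] d s by (intro frac_le) (auto simp: pos_divide_le_eq)
          finally show "norm (?D (X i) s) \<le> C / d" .
        qed
      qed
    qed
    then have "(I has_field_derivative (LINT s|\<nu>. ?D z0 s)) (at z0)"
      unfolding has_field_derivative_iff using d by (simp add: at_within_open[of z0 "ball z0 d"])
    then show ?thesis
      using field_differentiable_at_within field_differentiable_def by blast
  qed
  then have I: "I holomorphic_on (- \<real>\<^sub>\<le>\<^sub>0)" by (simp add: holomorphic_on_def)
  have "F0 = (\<lambda>z. of_real c0 / z + of_real c1 + I z)" by (simp add: F0_def I_def fun_eq_iff)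
  moreover have "(\<lambda>z. of_real c0 / z + of_real c1 + I z) holomorphic_on (- \<real>\<^sub>\<le>\<^sub>0)"
    by (intro holomorphic_intros I) auto
  ultimately show ?thesis by simp
qed

text \<open>\<open>F0\<close> witnesses the choice in \<open>cut_plane_extension\<close>. On the
  half-plane of the calculus the chosen function equals \<open>F0\<close> by the identity theorem,
  as they agree on the positive reals, which accumulate at \<open>1\<close>.\<close>

lemma
  assumes f: "\<And>x. 0 < x \<Longrightarrow> f x = fS x"
  shows cut_plane_extension_holomorphic: "cut_plane_extension f holomorphic_on {z. 0 < Re z}"
    and cut_plane_extension_eq: "0 < Re z \<Longrightarrow> cut_plane_extension f z = F0 z"
proof -
  have "F0 holomorphic_on (- \<real>\<^sub>\<le>\<^sub>0) \<and> (\<forall>x>0. F0 (complex_of_real x) = complex_of_real (f x))"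
    using F0_holomorphic F0_of_real f by simp
  then have F: "cut_plane_extension f holomorphic_on (- \<real>\<^sub>\<le>\<^sub>0) \<and>
      (\<forall>x>0. cut_plane_extension f (complex_of_real x) = complex_of_real (f x))"
    unfolding cut_plane_extension_def
    by (rule someI[where P="\<lambda>F. F holomorphic_on (- \<real>\<^sub>\<le>\<^sub>0) \<and> (\<forall>x>0. F (complex_of_real x) = complex_of_real (f x))"])
  have sub: "{z. 0 < Re z} \<subseteq> - \<real>\<^sub>\<le>\<^sub>0" by (auto simp: complex_nonpos_Reals_iff)
  show hol: "cut_plane_extension f holomorphic_on {z. 0 < Re z}"
    using F sub holomorphic_on_subset by blast
  assume z: "0 < Re z"
  have "cut_plane_extension f z - F0 z = 0"
  proof (rule analytic_continuation[where f="\<lambda>z. cut_plane_extension f z - F0 z" and S="{z. 0 < Re z}" and U="complex_of_real ` {0<..}" and \<xi>=1])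
    show "(\<lambda>z. cut_plane_extension f z - F0 z) holomorphic_on {z. 0 < Re z}"
      using hol holomorphic_on_subset[OF F0_holomorphic sub] by (rule holomorphic_on_diff)
    show "connected {z. 0 < Re z}" by (intro convex_connected convex_halfspace_Re_gt)
    show "(1::complex) islimpt complex_of_real ` {0<..}"
      unfolding islimpt_sequential
    proof (intro exI[of _ "\<lambda>i. complex_of_real (1 + 1 / real (Suc i))"] conjI allI)
      show "complex_of_real (1 + 1 / real (Suc i)) \<in> complex_of_real ` {0<..} - {1}" for i
        by (auto simp: of_real_eq_1_iff add_pos_pos simp del: of_real_add of_real_divide of_nat_Suc)
      have "(\<lambda>i. 1 + inverse (real (Suc i))) \<longlonglongrightarrow> 1 + 0"
        by (intro tendsto_intros LIMSEQ_inverse_real_of_nat)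
      then have "(\<lambda>i. complex_of_real (1 + inverse (real (Suc i)))) \<longlonglongrightarrow> complex_of_real (1 + 0)"
        by (rule tendsto_of_real)
      then show "(\<lambda>i. complex_of_real (1 + 1 / real (Suc i))) \<longlonglongrightarrow> 1"
        by (simp add: inverse_eq_divide)
    qed
    show "cut_plane_extension f z - F0 z = 0" if "z \<in> complex_of_real ` {0<..}" for z
      using that F F0_of_real f by auto
  qed (use z in \<open>auto simp: open_halfspace_Re_gt\<close>)
  then show "cut_plane_extension f z = F0 z" by simp
qed

end

section \<open>An admissible regularizer\<close>

definition exp_measure :: "real measure"
  where "exp_measure = distr (density lborel (\<lambda>r. ennreal (indicator {0..} r * exp (- r))))
    (restrict_space borel {0..}) (max 0)"

text \<open>The pair \<open>exp_measure\<close>, \<open>exp_density K\<close> represents the measure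
  \<open>K(t) dt\<close>. Lebesgue measure is not finite, so \<open>exp (- t) dt\<close> is the
  reference measure and the density carries the factor \<open>exp t\<close>.\<close>

definition exp_density :: "(real \<Rightarrow> complex) \<Rightarrow> real \<Rightarrow> complex"
  where "exp_density K t = exp t *\<^sub>R (indicator {0..} t *\<^sub>R K t)"

lemma max_measurable: "max 0 \<in> measurable lborel (restrict_space borel {0::real..})"
  by (rule measurable_restrict_space2) auto

lemma sets_exp_measure: "sets exp_measure = sets (restrict_space borel {0..})"
  by (simp add: exp_measure_def)

text \<open>The self-referential shape expected by \<open>sint_transfer\<close>.\<close>

lemma exp_measure_eq:
  "exp_measure = distr (density lborel (\<lambda>r. ennreal (indicator {0..} r * exp (- r)))) exp_measure (max 0)"
  unfolding exp_measure_def by (rule distr_cong) auto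

lemma
  fixes g :: "real \<Rightarrow> complex"
  assumes g: "g \<in> borel_measurable (restrict_space borel {0..})"
  shows exp_measure_integrable: "integrable exp_measure g \<longleftrightarrow> integrable lborel (\<lambda>r. indicator {0..} r *\<^sub>R (exp (- r) *\<^sub>R g r))"
    and exp_measure_integral: "(LINT r|exp_measure. g r) = (LBINT r. indicator {0..} r *\<^sub>R (exp (- r) *\<^sub>R g r))"
proof -
  have gm: "(\<lambda>r. g (max 0 r)) \<in> borel_measurable borel"
    using measurable_compose[OF max_measurable g] by simp
  have m: "max 0 \<in> measurable (density lborel (\<lambda>r. ennreal (indicator {0..} r * exp (- r)))) (restrict_space borel {0::real..})"
    using max_measurable by simp
  have eq: "(indicator {0..} r * exp (- r)) *\<^sub>R g (max 0 r) = indicator {0..} r *\<^sub>R (exp (- r) *\<^sub>R g r)" for r :: real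
    by (auto simp: indicator_def max_def)
  show "integrable exp_measure g \<longleftrightarrow> integrable lborel (\<lambda>r. indicator {0..} r *\<^sub>R (exp (- r) *\<^sub>R g r))"
    unfolding exp_measure_def
    by (subst integrable_distr_eq[OF m g], subst integrable_density) (auto simp: gm eq)
  show "(LINT r|exp_measure. g r) = (LBINT r. indicator {0..} r *\<^sub>R (exp (- r) *\<^sub>R g r))"
    unfolding exp_measure_def
    by (subst integral_distr[OF m g], subst integral_density) (auto simp: gm eq)
qed

lemma finite_exp_measure: "finite_measure exp_measure"
  unfolding exp_measure_def
proof (rule finite_measure.finite_measure_distr)
  show "finite_measure (density lborel (\<lambda>r. ennreal (indicator {0..} r * exp (- r :: real))))"
  proof
    have "(\<integral>\<^sup>+ r. ennreal (indicator {0..} r * exp (- (r::real))) \<partial>lborel) < \<infinity>"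
      using integrable_exp_minus[of 1] by (simp add: integrable_iff_bounded abs_mult)
    then show "emeasure (density lborel (\<lambda>r. ennreal (indicator {0..} r * exp (- r :: real))))
        (space (density lborel (\<lambda>r. ennreal (indicator {0..} r * exp (- r))))) \<noteq> \<infinity>"
      by (simp add: emeasure_density)
  qed
  show "max 0 \<in> measurable (density lborel (\<lambda>r. ennreal (indicator {0..} r * exp (- r)))) (restrict_space borel {0::real..})"
    using max_measurable by simp
qed

lemma exp_density_measurable:
  assumes "integrable lborel (\<lambda>r. indicator {0..} r *\<^sub>R K r)"
  shows "exp_density K \<in> borel_measurable borel"
proof -
  have "(\<lambda>r. indicator {0..} r *\<^sub>R K r) \<in> borel_measurable borel"
    using borel_measurable_integrable[OF assms] by simp
  from borel_measurable_scaleR[OF _ this, of exp] show ?thesis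
    unfolding exp_density_def[abs_def] by measurable
qed

lemma exp_density_eq:
  "indicator {0..} r *\<^sub>R (exp (- r) *\<^sub>R exp_density K r) = indicator {0..} r *\<^sub>R K r"
  by (simp add: exp_density_def indicator_def exp_add[symmetric])

lemma bounded_radon_exp_density:
  assumes K: "integrable lborel (\<lambda>r. indicator {0..} r *\<^sub>R K r)"
  shows "bounded_radon_measure exp_measure (exp_density K)"
proof -
  have m: "exp_density K \<in> borel_measurable (restrict_space borel {0..})"
    by (rule measurable_restrict_space1[OF exp_density_measurable[OF K]])
  show ?thesis
    unfolding bounded_radon_measure_def exp_measure_integrable[OF m] exp_density_eq
    using finite_exp_measure sets_exp_measure K by simp
qed

lemma laplace_exp_density:
  assumes K: "integrable lborel (\<lambda>r. indicator {0..} r *\<^sub>R K r)"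
  shows "(LINT t|exp_measure. exp (- (complex_of_real t * z)) * exp_density K t)
    = (LBINT r. indicator {0..} r *\<^sub>R (exp (- (z * of_real r)) * K r))"
proof -
  note [measurable] = exp_density_measurable[OF K]
  have m: "(\<lambda>t. exp (- (complex_of_real t * z)) * exp_density K t) \<in> borel_measurable (restrict_space borel {0..})"
    by (rule measurable_restrict_space1) measurable
  show ?thesis
    unfolding exp_measure_integral[OF m]
    by (rule Bochner_Integration.integral_cong)
      (auto simp: exp_density_def indicator_def exp_add[symmetric] mult.commute scaleR_scaleR)
qed

context C0_semigroup
begin

lemma hp_operator_exp_density:
  assumes K: "integrable lborel (\<lambda>r. indicator {0..} r *\<^sub>R K r)"
  shows "hp_operator T exp_measure (exp_density K) u = sint lborel (\<lambda>r. indicator {0..} r *\<^sub>R (K r *\<^sub>C T r u))"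
proof -
  have "hp_operator T exp_measure (exp_density K) u = sint exp_measure (\<lambda>t. exp_density K t *\<^sub>C T t u)"
    by (simp add: hp_operator_def sint_def)
  also have "\<dots> = sint lborel (\<lambda>r. (indicator {0..} r * exp (- r)) *\<^sub>R (exp_density K (max 0 r) *\<^sub>C T (max 0 r) u))"
  proof (rule sint_transfer(2)[symmetric, OF exp_measure_eq _ refl])
    show "max 0 \<in> measurable lborel exp_measure"
      using max_measurable measurable_cong_sets[OF refl sets_exp_measure] by blast
    show "sintegrable exp_measure (\<lambda>t. exp_density K t *\<^sub>C T t u)"
      by (rule sintegrable_radon[OF bounded_radon_exp_density[OF K] T_continuous, where C="M0 * norm u"])
         (rule norm_T)
  qed auto
  also have "\<dots> = sint lborel (\<lambda>r. indicator {0..} r *\<^sub>R (K r *\<^sub>C T r u))"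
  proof (rule sint_cong)
    fix r :: real
    have "(indicator {0..} r * exp (- r)) *\<^sub>R (exp_density K r *\<^sub>C T r u) = indicator {0..} r *\<^sub>R (K r *\<^sub>C T r u)"
      unfolding scaleR_scaleR[symmetric] scaleC.scaleR_left[symmetric] exp_density_eq ..
    then show "(indicator {0..} r * exp (- r)) *\<^sub>R (exp_density K (max 0 r) *\<^sub>C T (max 0 r) u)
        = indicator {0..} r *\<^sub>R (K r *\<^sub>C T r u)"
      by (cases "0 \<le> r") (auto simp: indicator_def)
  qed
  finally show ?thesis .
qed

end

text \<open>The regularizer is \<open>z / (z\<^sup>2 + 2 z + 2)\<close>, with the non-real poles \<open>- 1 \<plusminus> \<i>\<close>. They stay away
  from the poles \<open>- s\<close> of the Stieltjes kernel, so that the partial fraction decomposition of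
  \<open>z / (z\<^sup>2 + 2 z + 2) / (z + s)\<close> is bounded uniformly in \<open>s\<close>.\<close>

abbreviation (input) pole1 :: complex where "pole1 \<equiv> 1 + \<i>"
abbreviation (input) pole2 :: complex where "pole2 \<equiv> 1 - \<i>"

definition reg_denom :: "complex \<Rightarrow> complex"
  where "reg_denom z = z\<^sup>2 + 2 * z + 2"

text \<open>This is \<open>exp (- r) * sin r\<close>, with Laplace transform
  \<open>1 / reg_denom z\<close>.\<close>

definition reg0 :: "real \<Rightarrow> complex"
  where "reg0 r = (exp (- (pole2 * of_real r)) - exp (- (pole1 * of_real r))) / (2 * \<i>)"

text \<open>The derivative of \<open>reg0\<close>, that is
  \<open>exp (- r) * (cos r - sin r)\<close>. As \<open>reg0 0 = 0\<close>, its Laplace transform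
  gains exactly the factor \<open>z\<close>.\<close>

definition reg1 :: "real \<Rightarrow> complex"
  where "reg1 r = (pole1 * exp (- (pole1 * of_real r)) - pole2 * exp (- (pole2 * of_real r))) / (2 * \<i>)"

lemma reg_denom_factor: "reg_denom z = (z + pole1) * (z + pole2)"
  by (simp add: reg_denom_def power2_eq_square algebra_simps)

lemma reg_poles:
  assumes "0 \<le> Re z"
  shows "0 < Re (z + pole1)" "0 < Re (z + pole2)" "z + pole1 \<noteq> 0" "z + pole2 \<noteq> 0" "reg_denom z \<noteq> 0"
proof -
  show p: "0 < Re (z + pole1)" "0 < Re (z + pole2)" using assms by auto
  show "z + pole1 \<noteq> 0" "z + pole2 \<noteq> 0" using p by (metis less_irrefl zero_complex.simps(1))+
  then show "reg_denom z \<noteq> 0" by (simp only: reg_denom_factor mult_eq_0_iff) simp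
qed

lemma
  assumes z: "0 \<le> Re z"
  shows integrable_reg0: "integrable lborel (\<lambda>r. indicator {0..} r *\<^sub>R (exp (- (z * of_real r)) * reg0 r))"
    and integral_reg0: "(LBINT r. indicator {0..} r *\<^sub>R (exp (- (z * of_real r)) * reg0 r)) = 1 / reg_denom z"
    and integrable_reg1: "integrable lborel (\<lambda>r. indicator {0..} r *\<^sub>R (exp (- (z * of_real r)) * reg1 r))"
    and integral_reg1: "(LBINT r. indicator {0..} r *\<^sub>R (exp (- (z * of_real r)) * reg1 r)) = z / reg_denom z"
proof -
  note p = reg_poles[OF z]
  let ?E = "\<lambda>w r. indicator {0..} r *\<^sub>R exp (- (w * complex_of_real r))"
  note i = integrable_cexp_minus[OF p(1)] integrable_cexp_minus[OF p(2)]
  note v = integral_cexp_minus[OF p(1)] integral_cexp_minus[OF p(2)]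
  have eq0: "(\<lambda>r. indicator {0..} r *\<^sub>R (exp (- (z * of_real r)) * reg0 r))
      = (\<lambda>r. (?E (z + pole2) r - ?E (z + pole1) r) / (2 * \<i>))"
    by (simp add: fun_eq_iff reg0_def indicator_def exp_add[symmetric] algebra_simps)
  have eq1: "(\<lambda>r. indicator {0..} r *\<^sub>R (exp (- (z * of_real r)) * reg1 r))
      = (\<lambda>r. (pole1 * ?E (z + pole1) r - pole2 * ?E (z + pole2) r) / (2 * \<i>))"
  proof
    fix r :: real
    have "exp (- (z * of_real r)) * exp (- (w * of_real r)) = exp (- ((z + w) * of_real r))" for w
      by (simp add: exp_add[symmetric] algebra_simps)
    note e = this[of pole1] this[of pole2]
    have "exp (- (z * of_real r)) * reg1 r = (pole1 * (exp (- (z * of_real r)) * exp (- (pole1 * of_real r)))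
        - pole2 * (exp (- (z * of_real r)) * exp (- (pole2 * of_real r)))) / (2 * \<i>)"
      unfolding reg1_def by (simp only: times_divide_eq_right right_diff_distrib mult.left_commute)
    then show "indicator {0..} r *\<^sub>R (exp (- (z * of_real r)) * reg1 r)
      = (pole1 * ?E (z + pole1) r - pole2 * ?E (z + pole2) r) / (2 * \<i>)"
      unfolding e by (simp add: indicator_def)
  qed
  show "integrable lborel (\<lambda>r. indicator {0..} r *\<^sub>R (exp (- (z * of_real r)) * reg0 r))"
    unfolding eq0 by (intro integrable_divide Bochner_Integration.integrable_diff i)
  show "integrable lborel (\<lambda>r. indicator {0..} r *\<^sub>R (exp (- (z * of_real r)) * reg1 r))"
    unfolding eq1 by (intro integrable_divide Bochner_Integration.integrable_diff integrable_mult_right i)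
  have "(LBINT r. indicator {0..} r *\<^sub>R (exp (- (z * of_real r)) * reg0 r))
      = (1 / (z + pole2) - 1 / (z + pole1)) / (2 * \<i>)"
    unfolding eq0 integral_divide_zero Bochner_Integration.integral_diff[OF i(2,1)] v ..
  also have "\<dots> = 1 / reg_denom z"
  proof -
    have "1 * (z + pole1) - 1 * (z + pole2) = 2 * \<i>" by simp
    then show ?thesis
      unfolding reg_denom_factor diff_frac_eq[OF p(4,3)] by (simp only: mult.commute) simp
  qed
  finally show "(LBINT r. indicator {0..} r *\<^sub>R (exp (- (z * of_real r)) * reg0 r)) = 1 / reg_denom z" .
  have "(LBINT r. indicator {0..} r *\<^sub>R (exp (- (z * of_real r)) * reg1 r))
      = (pole1 * (1 / (z + pole1)) - pole2 * (1 / (z + pole2))) / (2 * \<i>)"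
    unfolding eq1 integral_divide_zero
      Bochner_Integration.integral_diff[OF integrable_mult_right[OF i(1)] integrable_mult_right[OF i(2)]]
      integral_mult_right_zero v ..
  also have "\<dots> = z / reg_denom z"
  proof -
    have num: "pole1 * (z + pole2) - pole2 * (z + pole1) = z * (2 * \<i>)" by (simp add: algebra_simps)
    have cancel: "w * c / d / c = w / d" if "c \<noteq> 0" for w c d :: complex using that by simp
    show ?thesis
      unfolding reg_denom_factor times_divide_eq_right mult_1_right diff_frac_eq[OF p(3,4)] num
      by (rule cancel) simp
  qed
  finally show "(LBINT r. indicator {0..} r *\<^sub>R (exp (- (z * of_real r)) * reg1 r)) = z / reg_denom z" .
qed

lemma integrable_reg: "integrable lborel (\<lambda>r. indicator {0..} r *\<^sub>R reg0 r)"
  "integrable lborel (\<lambda>r. indicator {0..} r *\<^sub>R reg1 r)"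
  using integrable_reg0[of 0] integrable_reg1[of 0] by simp_all

section \<open>Inverse Laplace transform of the regularized Stieltjes function\<close>

context stieltjes_data
begin

text \<open>The denominator is \<open>reg_denom (- s)\<close>. Hence \<open>- weight s * s\<close>
  is the residue at \<open>z = - s\<close> of
  \<open>z (1 + s) / (reg_denom z (z + s))\<close>.\<close>

definition weight :: "real \<Rightarrow> real"
  where "weight s = (1 + s) / ((s - 1)\<^sup>2 + 1)"

lemma weight_bounds:
  assumes "0 < s" shows "0 < weight s" "weight s \<le> 3" "weight s * s \<le> 4"
proof -
  have q: "0 < (s - 1)\<^sup>2 + 1" by (simp add: add_nonneg_pos)
  show "0 < weight s" using assms q by (simp add: weight_def)
  have "3 * ((s - 1)\<^sup>2 + 1) - (1 + s) = 3 * (s - 7 / 6)\<^sup>2 + 11 / 12"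
    by (simp add: power2_eq_square algebra_simps)
  then have "1 + s \<le> 3 * ((s - 1)\<^sup>2 + 1)" using zero_le_power2[of "s - 7 / 6"] by linarith
  then show "weight s \<le> 3" using q by (simp add: weight_def pos_divide_le_eq)
  have "4 * ((s - 1)\<^sup>2 + 1) - (1 + s) * s = 3 * (s - 3 / 2)\<^sup>2 + 5 / 4"
    by (simp add: power2_eq_square algebra_simps)
  then have "(1 + s) * s \<le> 4 * ((s - 1)\<^sup>2 + 1)" using zero_le_power2[of "s - 3 / 2"] by linarith
  then show "weight s * s \<le> 4" using q by (simp add: weight_def pos_divide_le_eq)
qed

lemma weight_measurable [measurable]: "weight \<in> borel_measurable borel"
  unfolding weight_def[abs_def] by measurable

text \<open>The contribution of the poles \<open>- s\<close>: a superposition of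
  \<open>exp (- s r)\<close> with the negated residues as coefficients.\<close>

definition tail :: "real \<Rightarrow> complex"
  where "tail r = (LINT s|\<nu>. of_real (weight s * s) * exp (- (of_real s * of_real r)))"

text \<open>Fubini. The factor \<open>s\<close>, which stems from the numerator \<open>z\<close> of
  the regularizer, cancels the mass \<open>1 / s\<close> of \<open>exp (- s r)\<close>; what remains
  is at most \<open>weight s\<close>, which is bounded. This includes \<open>Re z = 0\<close>, so
  \<open>tail\<close> itself is integrable.\<close>

lemma
  assumes z: "0 \<le> Re z"
  shows integrable_tail: "integrable lborel (\<lambda>r. indicator {0..} r *\<^sub>R (exp (- (z * of_real r)) * tail r))"
    and integral_tail: "(LBINT r. indicator {0..} r *\<^sub>R (exp (- (z * of_real r)) * tail r))
      = (LINT s|\<nu>. of_real (weight s * s) / (z + of_real s))"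
proof -
  interpret N: finite_measure \<nu> by (rule finite_\<nu>)
  interpret P: pair_sigma_finite \<nu> lborel
    by (intro pair_sigma_finite.intro N.sigma_finite_measure_axioms sigma_finite_lborel)
  define f where "f s r = indicator {0..} r *\<^sub>R (exp (- (z * of_real r))
    * (complex_of_real (weight s * s) * exp (- (of_real s * of_real r))))" for s r :: real
  have fst: "(\<lambda>p. fst p) \<in> borel_measurable (\<nu> \<Otimes>\<^sub>M lborel :: (real \<times> real) measure)"
    using measurable_compose[OF measurable_fst \<nu>_ident] .
  have snd: "(\<lambda>p. snd p) \<in> borel_measurable (\<nu> \<Otimes>\<^sub>M lborel :: (real \<times> real) measure)"
    using measurable_compose[OF measurable_snd, of "\<lambda>x. x" lborel borel \<nu>] by simp
  have meas: "case_prod f \<in> borel_measurable (\<nu> \<Otimes>\<^sub>M lborel)"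
    unfolding f_def case_prod_beta using fst snd by measurable
  have inner: "integrable lborel (f s)" "(LBINT r. f s r) = of_real (weight s * s) / (z + of_real s)"
      "(LBINT r. norm (f s r)) \<le> weight s"
    if s: "0 < s" for s
  proof -
    have re: "0 < Re (z + of_real s)" "0 < Re z + s" using z s by auto
    have f_eq: "f s = (\<lambda>r. of_real (weight s * s) * (indicator {0..} r *\<^sub>R exp (- ((z + of_real s) * of_real r))))"
      by (simp add: fun_eq_iff f_def indicator_def exp_add[symmetric] algebra_simps)
    show "integrable lborel (f s)"
      unfolding f_eq by (intro integrable_mult_right integrable_cexp_minus re)
    show "(LBINT r. f s r) = of_real (weight s * s) / (z + of_real s)"
      unfolding f_eq integral_mult_right_zero integral_cexp_minus[OF re(1)] by simp
    have "(\<lambda>r. norm (f s r)) = (\<lambda>r. (weight s * s) * (indicator {0..} r * exp (- ((Re z + s) * r))))"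
      using weight_bounds(1)[OF s] s
      by (simp add: fun_eq_iff f_eq norm_mult norm_exp_eq_Re indicator_def abs_mult)
    then have "(LBINT r. norm (f s r)) = weight s * s * (1 / (Re z + s))"
      unfolding integral_mult_right_zero by (simp add: integral_exp_minus[OF re(2)])
    also have "\<dots> \<le> weight s"
      using weight_bounds(1)[OF s] s z re by (simp add: pos_divide_le_eq algebra_simps)
    finally show "(LBINT r. norm (f s r)) \<le> weight s" .
  qed
  have int: "integrable (\<nu> \<Otimes>\<^sub>M lborel) (case_prod f)"
  proof (rule P.Fubini_integrable[OF meas])
    have m: "(\<lambda>s. LBINT r. norm (f s r)) \<in> borel_measurable \<nu>"
      using meas by (intro lborel.borel_measurable_lebesgue_integral) (simp add: case_prod_beta)
    show "integrable \<nu> (\<lambda>s. LBINT r. norm (case (s, r) of (s, r) \<Rightarrow> f s r))"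
    proof (rule \<nu>_integrable_bounded[where C=3])
      show "(\<lambda>s. LBINT r. norm (case (s, r) of (s, r) \<Rightarrow> f s r)) \<in> borel_measurable \<nu>" using m by simp
      fix s :: real assume s: "0 < s"
      have "0 \<le> (LBINT r. norm (f s r))" by simp
      then show "norm (LBINT r. norm (case (s, r) of (s, r) \<Rightarrow> f s r)) \<le> 3"
        using inner(3)[OF s] weight_bounds(2)[OF s] by simp
    qed
    show "AE s in \<nu>. integrable lborel (\<lambda>r. case (s, r) of (s, r) \<Rightarrow> f s r)"
      by (rule AE_I2) (use inner(1) space_\<nu> in auto)
  qed
  have tail_eq: "(\<lambda>r. LINT s|\<nu>. f s r) = (\<lambda>r. indicator {0..} r *\<^sub>R (exp (- (z * of_real r)) * tail r))"
    unfolding f_def tail_def integral_scaleR_right integral_mult_right_zero ..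
  show "integrable lborel (\<lambda>r. indicator {0..} r *\<^sub>R (exp (- (z * of_real r)) * tail r))"
    using P.integrable_snd[OF int] unfolding tail_eq .
  have "(LBINT r. indicator {0..} r *\<^sub>R (exp (- (z * of_real r)) * tail r)) = (LINT s|\<nu>. (LBINT r. f s r))"
    unfolding tail_eq[symmetric] by (rule P.Fubini_integral[OF int])
  also have "\<dots> = (LINT s|\<nu>. of_real (weight s * s) / (z + of_real s))"
    by (rule Bochner_Integration.integral_cong) (use inner(2) space_\<nu> in auto)
  finally show "(LBINT r. indicator {0..} r *\<^sub>R (exp (- (z * of_real r)) * tail r))
      = (LINT s|\<nu>. of_real (weight s * s) / (z + of_real s))" .
qed

text \<open>The residue at \<open>- s\<close> is split off; what is left has a numerator linear in
  \<open>z\<close> over \<open>reg_denom z\<close>. All coefficients are bounded in \<open>s\<close>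
  by \<open>weight_bounds\<close>, so the pieces can be integrated separately.\<close>

lemma reg_kernel_partial_fractions:
  assumes z: "0 < Re z" and s: "0 < s"
  shows "z / reg_denom z * (of_real (1 + s) / (z + of_real s))
    = (of_real (weight s * s) * z + of_real (2 * weight s)) / reg_denom z - of_real (weight s * s) / (z + of_real s)"
proof -
  define S where "S = complex_of_real s"
  define q where "q = (S - 1)\<^sup>2 + 1"
  have "(s - 1)\<^sup>2 + 1 \<noteq> 0" by (smt (verit) zero_le_power2)
  moreover have qr: "q = of_real ((s - 1)\<^sup>2 + 1)" by (simp add: q_def S_def)
  ultimately have q: "q \<noteq> 0" by (simp only: of_real_eq_0_iff) simp
  have w: "complex_of_real (weight s) = (1 + S) / q"
    unfolding weight_def qr S_def by simp
  have zs: "z + S \<noteq> 0" using z s by (auto simp: S_def complex_eq_iff)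
  have D: "reg_denom z \<noteq> 0" using reg_poles(5)[of z] z by simp
  \<comment> \<open>The residue condition in polynomial form: \<open>q\<close> is
    \<open>reg_denom (- S)\<close>, and both sides agree at \<open>z = - S\<close>.\<close>
  have key: "z * q = (S * z + 2) * (z + S) - S * reg_denom z"
    unfolding q_def reg_denom_def by (simp add: power2_eq_square algebra_simps)
  have "(of_real (weight s * s) * z + of_real (2 * weight s)) / reg_denom z - of_real (weight s * s) / (z + of_real s)
      = (1 + S) / q * ((S * z + 2) / reg_denom z - S / (z + S))"
    unfolding of_real_mult w S_def[symmetric] by (simp add: algebra_simps add_divide_distrib)
  also have "(S * z + 2) / reg_denom z - S / (z + S) = z * q / (reg_denom z * (z + S))"
    unfolding key diff_frac_eq[OF D zs] ..
  also have "(1 + S) / q * (z * q / (reg_denom z * (z + S))) = z / reg_denom z * ((1 + S) / (z + S))"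
    using q by simp
  finally show ?thesis by (simp add: S_def)
qed

text \<open>Inverted term by term: \<open>z / reg_denom z\<close> turns \<open>c0 / z\<close> into
  \<open>c0 / reg_denom z\<close>, the transform of \<open>c0 * reg0\<close>, and \<open>c1\<close>
  into that of \<open>c1 * reg1\<close>; the integrated partial fractions supply the rest.\<close>

definition reg_product :: "real \<Rightarrow> complex"
  where "reg_product r = of_real (c0 + (LINT s|\<nu>. 2 * weight s)) * reg0 r
    + of_real (c1 + (LINT s|\<nu>. weight s * s)) * reg1 r - tail r"

lemma
  assumes z: "0 \<le> Re z"
  shows integrable_reg_product: "integrable lborel (\<lambda>r. indicator {0..} r *\<^sub>R (exp (- (z * of_real r)) * reg_product r))"
    and integral_reg_product: "0 < Re z \<Longrightarrow>
      (LBINT r. indicator {0..} r *\<^sub>R (exp (- (z * of_real r)) * reg_product r)) = z / reg_denom z * F0 z"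
proof -
  define p0 where "p0 = complex_of_real (c0 + (LINT s|\<nu>. 2 * weight s))"
  define p1 where "p1 = complex_of_real (c1 + (LINT s|\<nu>. weight s * s))"
  have eq: "(\<lambda>r. indicator {0..} r *\<^sub>R (exp (- (z * of_real r)) * reg_product r))
    = (\<lambda>r. p0 * (indicator {0..} r *\<^sub>R (exp (- (z * of_real r)) * reg0 r))
        + p1 * (indicator {0..} r *\<^sub>R (exp (- (z * of_real r)) * reg1 r))
        - indicator {0..} r *\<^sub>R (exp (- (z * of_real r)) * tail r))"
    unfolding reg_product_def p0_def[symmetric] p1_def[symmetric] by (simp add: fun_eq_iff indicator_def algebra_simps)
  note i = integrable_mult_right[OF integrable_reg0[OF z], of p0]
    integrable_mult_right[OF integrable_reg1[OF z], of p1] integrable_tail[OF z]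
  show "integrable lborel (\<lambda>r. indicator {0..} r *\<^sub>R (exp (- (z * of_real r)) * reg_product r))"
    unfolding eq by (intro Bochner_Integration.integrable_diff Bochner_Integration.integrable_add i)
  assume z': "0 < Re z"
  have D: "reg_denom z \<noteq> 0" using reg_poles(5)[OF z] .
  have val: "(LBINT r. indicator {0..} r *\<^sub>R (exp (- (z * of_real r)) * reg_product r))
    = p0 * (1 / reg_denom z) + p1 * (z / reg_denom z) - (LINT s|\<nu>. of_real (weight s * s) / (z + of_real s))"
    unfolding eq Bochner_Integration.integral_diff[OF Bochner_Integration.integrable_add[OF i(1,2)] i(3)]
      Bochner_Integration.integral_add[OF i(1,2)] integral_mult_right_zero
      integral_reg0[OF z] integral_reg1[OF z] integral_tail[OF z] ..
  have wm: "(\<lambda>s. weight s) \<in> borel_measurable \<nu>" using measurable_compose[OF \<nu>_ident weight_measurable] .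
  have w1: "integrable \<nu> (\<lambda>s. complex_of_real (weight s * s))"
  proof (rule \<nu>_integrable_bounded[where C=4])
    show "(\<lambda>s. complex_of_real (weight s * s)) \<in> borel_measurable \<nu>" using wm \<nu>_ident by measurable
    show "norm (complex_of_real (weight s * s)) \<le> 4" if "0 < s" for s
      using weight_bounds[OF that] that unfolding norm_of_real by simp
  qed
  have w0: "integrable \<nu> (\<lambda>s. complex_of_real (2 * weight s))"
  proof (rule \<nu>_integrable_bounded[where C=6])
    show "(\<lambda>s. complex_of_real (2 * weight s)) \<in> borel_measurable \<nu>" using wm by measurable
    show "norm (complex_of_real (2 * weight s)) \<le> 6" if "0 < s" for s
      using weight_bounds[OF that] unfolding norm_of_real by simp
  qed
  have w2: "integrable \<nu> (\<lambda>s. of_real (weight s * s) / (z + of_real s))"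
  proof (rule \<nu>_integrable_bounded[where C="4 / Re z"])
    show "(\<lambda>s. of_real (weight s * s) / (z + of_real s)) \<in> borel_measurable \<nu>"
      using wm \<nu>_ident by measurable
    fix s :: real assume s: "0 < s"
    have "Re z \<le> cmod (z + of_real s)"
      using complex_Re_le_cmod[of "z + of_real s"] s by simp
    then show "norm (complex_of_real (weight s * s) / (z + of_real s)) \<le> 4 / Re z"
      unfolding norm_divide norm_of_real using weight_bounds[OF s] s z' by (intro frac_le) auto
  qed
  have "z / reg_denom z * (LINT s|\<nu>. of_real (1 + s) / (z + of_real s))
    = (LINT s|\<nu>. z / reg_denom z * (of_real (1 + s) / (z + of_real s)))"
    by (rule integral_mult_right_zero[symmetric])
  also have "\<dots> = (LINT s|\<nu>. (of_real (weight s * s) * z + of_real (2 * weight s)) / reg_denom z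
      - of_real (weight s * s) / (z + of_real s))"
    by (rule Bochner_Integration.integral_cong) (use reg_kernel_partial_fractions[OF z'] space_\<nu> in auto)
  also have "\<dots> = ((LINT s|\<nu>. complex_of_real (weight s * s)) * z + (LINT s|\<nu>. complex_of_real (2 * weight s))) / reg_denom z
      - (LINT s|\<nu>. of_real (weight s * s) / (z + of_real s))"
    unfolding Bochner_Integration.integral_diff[OF
        integrable_divide[OF Bochner_Integration.integrable_add[OF integrable_mult_left[OF w1] w0]] w2]
      integral_divide_zero Bochner_Integration.integral_add[OF integrable_mult_left[OF w1] w0]
      integral_mult_left_zero ..
  finally have I: "z / reg_denom z * (LINT s|\<nu>. of_real (1 + s) / (z + of_real s))
    = (of_real (LINT s|\<nu>. weight s * s) * z + of_real (LINT s|\<nu>. 2 * weight s)) / reg_denom z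
      - (LINT s|\<nu>. of_real (weight s * s) / (z + of_real s))"
    unfolding integral_complex_of_real .
  have z0: "z \<noteq> 0" using z' by auto
  have "z / reg_denom z * F0 z = of_real c0 / reg_denom z + z / reg_denom z * of_real c1
      + z / reg_denom z * (LINT s|\<nu>. of_real (1 + s) / (z + of_real s))"
    unfolding F0_def using z0 by (simp add: distrib_left)
  also have "\<dots> = p0 * (1 / reg_denom z) + p1 * (z / reg_denom z)
      - (LINT s|\<nu>. of_real (weight s * s) / (z + of_real s))"
    unfolding I unfolding p0_def p1_def of_real_add by (simp add: algebra_simps add_divide_distrib)
  finally show "(LBINT r. indicator {0..} r *\<^sub>R (exp (- (z * of_real r)) * reg_product r)) = z / reg_denom z * F0 z"
    using val by simp
qed

lemma
  shows laplace_reg1: "laplace_transform_of exp_measure (exp_density reg1) (\<lambda>z. z / reg_denom z)"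
    and laplace_reg_product: "laplace_transform_of exp_measure (exp_density reg_product) (\<lambda>z. z / reg_denom z * F0 z)"
proof -
  \<comment> \<open>At \<open>z = 0\<close> the exponential factor is \<open>1\<close>, so this is
    the boundedness of the representing measure.\<close>
  have p: "integrable lborel (\<lambda>r. indicator {0..} r *\<^sub>R reg_product r)"
    using integrable_reg_product[of 0] by simp
  show "laplace_transform_of exp_measure (exp_density reg1) (\<lambda>z. z / reg_denom z)"
    unfolding laplace_transform_of_def laplace_exp_density[OF integrable_reg(2)]
    by (simp add: bounded_radon_exp_density[OF integrable_reg(2)] integral_reg1)
  show "laplace_transform_of exp_measure (exp_density reg_product) (\<lambda>z. z / reg_denom z * F0 z)"
    unfolding laplace_transform_of_def laplace_exp_density[OF p]
    by (simp add: bounded_radon_exp_density[OF p] integral_reg_product)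
qed

end

section \<open>The regularizer applied to \<open>A\<close>: resolvents at the two poles\<close>

lemma laplace_transform_ofD:
  "laplace_transform_of m h g \<Longrightarrow> 0 < Re z \<Longrightarrow> (LINT t|m. exp (- (complex_of_real t * z)) * h t) = g z"
  by (simp add: laplace_transform_of_def)

lemma (in C0_semigroup) hp_operator_reg1:
  "hp_operator T exp_measure (exp_density reg1) u
    = (1 / (2 * \<i>)) *\<^sub>C (pole1 *\<^sub>C Rs pole1 u - pole2 *\<^sub>C Rs pole2 u)"
proof -
  let ?F = "\<lambda>l r. indicator {0..} r *\<^sub>R (exp (- (l * of_real r)) *\<^sub>C T r u)"
  have F: "sintegrable lborel (\<lambda>r. c *\<^sub>C ?F l r)" "sint lborel (\<lambda>r. c *\<^sub>C ?F l r) = c *\<^sub>C Rs l u"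
    if "0 < Re l" for l c
    unfolding Rs_def
    by (rule sintegrable_bounded_linear[OF bounded_linear_scaleC Rs_integrable[OF that]],
        rule sint_bounded_linear[OF bounded_linear_scaleC Rs_integrable[OF that]])
  have re: "0 < Re pole1" "0 < Re pole2" by auto
  have "hp_operator T exp_measure (exp_density reg1) u
      = sint lborel (\<lambda>r. (1 / (2 * \<i>)) *\<^sub>C (pole1 *\<^sub>C ?F pole1 r - pole2 *\<^sub>C ?F pole2 r))"
    unfolding hp_operator_exp_density[OF integrable_reg(2)]
  proof (rule sint_cong)
    fix r :: real
    have "reg1 r *\<^sub>C T r u = (1 / (2 * \<i>)) *\<^sub>C (pole1 *\<^sub>C (exp (- (pole1 * of_real r)) *\<^sub>C T r u)
      - pole2 *\<^sub>C (exp (- (pole2 * of_real r)) *\<^sub>C T r u))"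
      unfolding reg1_def scaleC_scaleC scaleC.diff_left[symmetric] by (simp only: times_divide_eq_left mult_1_left)
    then show "indicator {0..} r *\<^sub>R (reg1 r *\<^sub>C T r u)
        = (1 / (2 * \<i>)) *\<^sub>C (pole1 *\<^sub>C ?F pole1 r - pole2 *\<^sub>C ?F pole2 r)"
      by (cases "0 \<le> r") auto
  qed
  also have "\<dots> = (1 / (2 * \<i>)) *\<^sub>C (pole1 *\<^sub>C Rs pole1 u - pole2 *\<^sub>C Rs pole2 u)"
    unfolding sint_bounded_linear[OF bounded_linear_scaleC sintegrable_diff[OF F(1)[OF re(1)] F(1)[OF re(2)]]]
      sint_diff[OF F(1)[OF re(1)] F(1)[OF re(2)]] F(2)[OF re(1)] F(2)[OF re(2)] ..
  finally show ?thesis .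
qed

text \<open>If \<open>u\<close> is in the kernel, then \<open>y = p Rs p u\<close> is the same for both poles \<open>p\<close>, and \<open>T\<close> has generator
  value \<open>p (y - u)\<close> at \<open>y\<close>. Hence \<open>y = u\<close> is in the kernel of the generator.\<close>
lemma (in C0_semigroup) hp_operator_reg1_inj:
  assumes dense: "closure (Range (semigroup_generator T)) = UNIV"
  shows "inj (hp_operator T exp_measure (exp_density reg1))"
proof (rule injI)
  fix u v assume "hp_operator T exp_measure (exp_density reg1) u = hp_operator T exp_measure (exp_density reg1) v"
  then have "(2 * \<i>) *\<^sub>C ((1 / (2 * \<i>)) *\<^sub>C (pole1 *\<^sub>C Rs pole1 u - pole2 *\<^sub>C Rs pole2 u))
    = (2 * \<i>) *\<^sub>C ((1 / (2 * \<i>)) *\<^sub>C (pole1 *\<^sub>C Rs pole1 v - pole2 *\<^sub>C Rs pole2 v))"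
    unfolding hp_operator_reg1 by simp
  then have eq: "pole1 *\<^sub>C Rs pole1 u - pole2 *\<^sub>C Rs pole2 u = pole1 *\<^sub>C Rs pole1 v - pole2 *\<^sub>C Rs pole2 v"
    by (simp add: scaleC_scaleC scaleC_one)
  define d where "d = u - v"
  define y where "y = pole1 *\<^sub>C Rs pole1 d"
  have re: "0 < Re pole1" "0 < Re pole2" by auto
  have y2: "y = pole2 *\<^sub>C Rs pole2 d"
    using eq unfolding y_def d_def Rs_diff[OF re(1)] Rs_diff[OF re(2)] scaleC.diff_right
    by (simp add: algebra_simps)
  have g: "(p *\<^sub>C Rs p d, p *\<^sub>C (p *\<^sub>C Rs p d - d)) \<in> semigroup_generator T" if "0 < Re p" for p
    by (rule generator_scaleC[OF Rs_generator[OF that]])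
  have g1: "(y, pole1 *\<^sub>C (y - d)) \<in> semigroup_generator T" using g[OF re(1)] unfolding y_def .
  have g2: "(y, pole2 *\<^sub>C (y - d)) \<in> semigroup_generator T" using g[OF re(2)] unfolding y2 .
  have "pole1 *\<^sub>C (y - d) - pole2 *\<^sub>C (y - d) = 0" using generator_unique[OF g1 g2] by simp
  then have "(pole1 - pole2) *\<^sub>C (y - d) = 0" by (simp only: scaleC.diff_left)
  then have "norm ((pole1 - pole2) *\<^sub>C (y - d)) = 0" by simp
  then have "cmod (pole1 - pole2) * norm (y - d) = 0" by (simp only: norm_scaleC)
  then have yd: "y = d" by simp
  then have "(d, 0) \<in> semigroup_generator T" using g1 by simp
  from generator_injective[OF dense this] show "u = v" by (simp add: d_def)
qed

section \<open>The norm estimate\<close>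

context stieltjes_semigroup
begin

text \<open>Membership in the graph hides an unknown regularizer with unknown measures.
  \<open>hp_operator_fA\<close> holds for that very pair, and injectivity of \<open>e(A)\<close>
  cancels it; conversely the explicit regularizer proves membership. Independence of
  \<open>e\<close> over the range of \<open>A\<close> is thus a by-product.\<close>

lemma hp_calculus_iff:
  assumes dense: "closure (Range (semigroup_generator T)) = UNIV"
    and f: "\<And>z. 0 < z \<Longrightarrow> f z = fS z" and w: "(w, - x) \<in> semigroup_generator T"
  shows "(x, y) \<in> hp_calculus T (cut_plane_extension f) \<longleftrightarrow> y = fA w x"
proof
  assume "(x, y) \<in> hp_calculus T (cut_plane_extension f)"
  then obtain e m h n k where
    e: "laplace_transform_of m h e" and ef: "laplace_transform_of n k (\<lambda>z. e z * cut_plane_extension f z)"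
    and inj: "inj (hp_operator T m h)" and eq: "hp_operator T n k x = hp_operator T m h y"
    unfolding hp_calculus_def by blast
  have "hp_operator T n k x = hp_operator T m h (fA w x)"
  proof (rule hp_operator_fA[OF _ _ _ w])
    show "bounded_radon_measure m h" "bounded_radon_measure n k"
      using e ef by (auto simp: laplace_transform_of_def)
    fix z :: real assume z: "0 < z"
    then have re: "0 < Re (of_real z)" by simp
    have "cut_plane_extension f (of_real z) = of_real (fS z)"
      using cut_plane_extension_eq[OF f re] F0_of_real[OF z] by simp
    then show "(LINT t|n. exp (- (complex_of_real t * of_real z)) * k t)
        = (LINT t|m. exp (- (complex_of_real t * of_real z)) * h t) * of_real (fS z)"
      unfolding laplace_transform_ofD[OF e re] laplace_transform_ofD[OF ef re] by simp
  qed
  then show "y = fA w x" using eq inj by (simp add: inj_eq)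
next
  assume y: "y = fA w x"
  have ef: "laplace_transform_of exp_measure (exp_density reg_product)
      (\<lambda>z. z / reg_denom z * cut_plane_extension f z)"
    using laplace_reg_product cut_plane_extension_eq[OF f] by (simp add: laplace_transform_of_def)
  have "hp_operator T exp_measure (exp_density reg_product) x = hp_operator T exp_measure (exp_density reg1) y"
    unfolding y
  proof (rule hp_operator_fA[OF _ _ _ w])
    show "bounded_radon_measure exp_measure (exp_density reg1)"
      "bounded_radon_measure exp_measure (exp_density reg_product)"
      using laplace_reg1 laplace_reg_product by (auto simp: laplace_transform_of_def)
    fix z :: real assume z: "0 < z"
    then have re: "0 < Re (of_real z)" by simp
    show "(LINT t|exp_measure. exp (- (complex_of_real t * of_real z)) * exp_density reg_product t)
        = (LINT t|exp_measure. exp (- (complex_of_real t * of_real z)) * exp_density reg1 t) * of_real (fS z)"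
      unfolding laplace_transform_ofD[OF laplace_reg1 re] laplace_transform_ofD[OF laplace_reg_product re]
        F0_of_real[OF z] ..
  qed
  then show "(x, y) \<in> hp_calculus T (cut_plane_extension f)"
    unfolding hp_calculus_def
    using cut_plane_extension_holomorphic[OF f] laplace_reg1 ef hp_operator_reg1_inj[OF dense] by blast
qed

lemma fA_add:
  assumes "(w, - x) \<in> semigroup_generator T" "(w', - x') \<in> semigroup_generator T"
  shows "fA (w + w') (x + x') = fA w x + fA w' x'"
proof -
  have "sint \<nu> (\<lambda>s. (1 + s) *\<^sub>R Rs (of_real s) (x + x'))
    = sint \<nu> (\<lambda>s. (1 + s) *\<^sub>R Rs (of_real s) x + (1 + s) *\<^sub>R Rs (of_real s) x')"
    by (rule sint_cong) (auto simp: space_\<nu> Rs_add scaleR_add_right)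
  then show ?thesis
    unfolding fA_def using sint_add[OF fA_integrable[OF assms(1)] fA_integrable[OF assms(2)]]
    by (simp add: scaleR_add_right)
qed

lemma fA_scaleC:
  assumes "(w, - x) \<in> semigroup_generator T"
  shows "fA (c *\<^sub>C w) (c *\<^sub>C x) = c *\<^sub>C fA w x"
proof -
  have R: "r *\<^sub>R (c *\<^sub>C u) = c *\<^sub>C (r *\<^sub>R u)" for r and u :: 'a
    by (simp add: scaleR_scaleC scaleC_scaleC mult.commute)
  have "sint \<nu> (\<lambda>s. (1 + s) *\<^sub>R Rs (of_real s) (c *\<^sub>C x)) = sint \<nu> (\<lambda>s. c *\<^sub>C ((1 + s) *\<^sub>R Rs (of_real s) x))"
    by (rule sint_cong) (auto simp: space_\<nu> Rs_scaleC R)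
  then show ?thesis
    unfolding fA_def using sint_bounded_linear[OF bounded_linear_scaleC fA_integrable[OF assms]]
    by (simp add: scaleC_add_right R)
qed

text \<open>The resolvent bounds, proportional to \<open>a / s\<close> and to \<open>b\<close>,
  balance at \<open>s = a / b\<close>, whence the argument of \<open>fS\<close>. For
  \<open>s \<ge> a / b\<close> one has \<open>2 s \<ge> a / b + s\<close>, otherwise
  \<open>2 a / b \<ge> a / b + s\<close>; this is the factor \<open>2\<close>.\<close>

lemma norm_fA_le:
  assumes w: "(w, - x) \<in> semigroup_generator T" and a: "0 < a" and b: "0 < b"
    and wN: "norm w \<le> b * N" and xN: "norm x \<le> a * N"
  shows "norm (fA w x) \<le> 2 * (1 + M0) * a * fS (a / b) * N"
proof -
  define C where "C = 2 * (1 + M0) * a * N"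
  have ab: "0 < a / b" using a b by simp
  have N: "0 \<le> N" using order_trans[OF norm_ge_zero xN] a by (simp add: zero_le_mult_iff)
  \<comment> \<open>As \<open>2 * (1 + M0) \<ge> 1\<close>, the constant of the integral term also
    covers the terms with \<open>c0\<close> and \<open>c1\<close>.\<close>
  have aNC: "a * N \<le> C"
  proof -
    have "a * N * 1 \<le> a * N * (2 * (1 + M0))" using a N M0_nonneg by (intro mult_left_mono) auto
    then show ?thesis by (simp add: C_def mult_ac)
  qed
  have C0: "0 \<le> C" using a N M0_nonneg by (simp add: C_def)
  have mono: "C / u \<le> C / v" if "0 < v" "v \<le> u" for u v
    using C0 that by (intro divide_left_mono) auto
  have R: "norm (Rs (of_real s) x) \<le> C / (a / b + s)" if s: "0 < s" for s
  proof (cases "a / b \<le> s")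
    case True
    have "norm (Rs (of_real s) x) \<le> M0 * norm x / s" using norm_Rs[of "of_real s" x] s by simp
    also have "\<dots> \<le> (1 + M0) * (a * N) / s"
      using xN M0_nonneg s a N by (intro divide_right_mono mult_mono) auto
    also have "\<dots> = C / (2 * s)" using s by (simp add: C_def field_simps)
    also have "\<dots> \<le> C / (a / b + s)" by (rule mono) (use True s ab in linarith)+
    finally show ?thesis .
  next
    case False
    have "norm (Rs (of_real s) x) \<le> (1 + M0) * norm w" by (rule norm_Rs_range[OF w s])
    also have "\<dots> \<le> (1 + M0) * (b * N)" using wN M0_nonneg by (intro mult_left_mono) auto
    also have "\<dots> = C / (2 * (a / b))" using a b by (simp add: C_def field_simps)
    also have "\<dots> \<le> C / (a / b + s)" by (rule mono) (use False s ab in linarith)+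
    finally show ?thesis .
  qed
  have "norm (sint \<nu> (\<lambda>s. (1 + s) *\<^sub>R Rs (of_real s) x)) \<le> (LINT s|\<nu>. (1 + s) / (a / b + s) * C)"
  proof (rule norm_sint_le[OF sintegrable_smeas[OF fA_integrable[OF w]]])
    show "integrable \<nu> (\<lambda>s. (1 + s) / (a / b + s) * C)"
      by (intro integrable_mult_left kernel_integrable ab)
    fix s assume "s \<in> space \<nu>"
    then have s: "0 < s" by (simp add: space_\<nu>)
    have "(1 + s) * norm (Rs (of_real s) x) \<le> (1 + s) * (C / (a / b + s))"
      using s by (intro mult_left_mono R) auto
    then show "norm ((1 + s) *\<^sub>R Rs (of_real s) x) \<le> (1 + s) / (a / b + s) * C"
      using s by simp
  qed
  then have n3: "norm (sint \<nu> (\<lambda>s. (1 + s) *\<^sub>R Rs (of_real s) x)) \<le> (LINT s|\<nu>. (1 + s) / (a / b + s)) * C"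
    unfolding integral_mult_left_zero .
  have n1: "norm (c0 *\<^sub>R w) \<le> c0 / (a / b) * C"
  proof -
    have "c0 * norm w \<le> c0 * (b * N)" using c wN by (intro mult_left_mono) auto
    also have "\<dots> = c0 / (a / b) * (a * N)" using a b by simp
    also have "\<dots> \<le> c0 / (a / b) * C" by (intro mult_left_mono aNC divide_nonneg_pos c ab)
    finally show ?thesis using c by simp
  qed
  have n2: "norm (c1 *\<^sub>R x) \<le> c1 * C"
    using c xN aNC by (auto intro!: mult_left_mono)
  have "norm (fA w x) \<le> c0 / (a / b) * C + c1 * C + (LINT s|\<nu>. (1 + s) / (a / b + s)) * C"
    unfolding fA_def by (intro norm_triangle_mono n1 n2 n3)
  also have "\<dots> = 2 * (1 + M0) * a * fS (a / b) * N"
    unfolding fS_def C_def by (simp only: distrib_left distrib_right mult_ac)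
  finally show ?thesis .
qed

end

theorem theorem6p12:
  fixes A :: "('a::complex_banach \<times> 'a) set"
    and T :: "real \<Rightarrow> 'a \<Rightarrow> 'a"
    and B :: "'a \<Rightarrow> 'a"
    and f :: "real \<Rightarrow> real"
    and a b M0 :: real
  assumes "bounded_C0_semigroup T"
    and "op_uminus A = semigroup_generator T"
    and "closure (Range A) = UNIV"
    and "bounded_clinear B"
    and "bounded_op_comp (A\<inverse>) B"
    and "a = onorm B"
    and "b = onorm (op_comp (A\<inverse>) B)"
    and "M0 = (SUP t\<in>{0..}. onorm (T t))"
    and "stieltjes f"
  shows "bounded_op_comp (hp_calculus T (cut_plane_extension f)) B \<and>
    onorm (op_comp (hp_calculus T (cut_plane_extension f)) B) \<le> 2 * (1 + M0) * a * f (a / b)"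
proof -
  obtain c0 c1 \<nu> where data: "stieltjes_data c0 c1 \<nu>"
    and f: "\<And>z. 0 < z \<Longrightarrow> f z = stieltjes_data.fS c0 c1 \<nu> z"
    using stieltjes_obtain[OF assms(9)] by blast
  interpret S: stieltjes_semigroup T c0 c1 \<nu>
    by (intro stieltjes_semigroup.intro C0_semigroup.intro assms(1) data)
  have M0: "M0 = S.M0" unfolding assms(8) S.M0_def ..
  have gen: "(w, x) \<in> A \<longleftrightarrow> (w, - x) \<in> semigroup_generator T" for w x
    unfolding assms(2)[symmetric] op_uminus_def by (auto intro: exI[of _ x])
  have dense: "closure (Range (semigroup_generator T)) = UNIV"
  proof -
    have "Range (semigroup_generator T) = uminus ` Range A"
      unfolding assms(2)[symmetric] op_uminus_def by (auto simp: image_iff Range_iff)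
    moreover have "y \<in> closure (uminus ` Range A)" for y
      unfolding closure_approachable
    proof (intro allI impI)
      fix e :: real assume "0 < e"
      moreover have "- y \<in> closure (Range A)" using assms(3) by simp
      ultimately obtain r where "r \<in> Range A" "dist r (- y) < e"
        unfolding closure_approachable by blast
      then show "\<exists>z\<in>uminus ` Range A. dist z y < e"
        by (intro bexI[of _ "- r"]) (auto simp: dist_norm norm_minus_commute add.commute)
    qed
    ultimately show ?thesis by auto
  qed
  define C where "C = op_comp (A\<inverse>) B"
  have C: "bounded_clinear C" and ran: "range B \<subseteq> Domain (A\<inverse>)"
    using assms(5) by (auto simp: bounded_op_comp_def C_def)
  \<comment> \<open>\<open>C v\<close> is a definite description. Density of the range makes
    \<open>A\<close> injective, so the preimage of \<open>B v\<close> is unique and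
    \<open>C v\<close> is it; the sign appears because \<open>T\<close> is generated by
    \<open>- A\<close>.\<close>
  have CB: "(C v, - B v) \<in> semigroup_generator T" for v
  proof -
    obtain y where y: "(y, B v) \<in> A" using ran by blast
    have unique: "y' = y" if "(y', B v) \<in> A" for y'
      using S.generator_injective[OF dense, of "y' - y"] S.generator_diff[of y' "- B v" y "- B v"] y that
      by (simp add: gen)
    have "(B v, THE y. (B v, y) \<in> A\<inverse>) \<in> A\<inverse>"
      by (rule theI[of _ y]) (use y unique in blast)+
    then have "(C v, B v) \<in> A" unfolding C_def op_comp_def by blast
    then show ?thesis by (simp add: gen)
  qed
  let ?R = "hp_calculus T (cut_plane_extension f)"
  define G where "G v = S.fA (C v) (B v)" for v
  have R: "(B v, y) \<in> ?R \<longleftrightarrow> y = G v" for v y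
    unfolding G_def by (rule S.hp_calculus_iff[OF dense f CB])
  \<comment> \<open>Over each \<open>B v\<close> the graph contains exactly one point, so the
    description in \<open>op_comp\<close> picks it.\<close>
  have RG: "op_comp ?R B = G"
    by (rule ext) (simp add: op_comp_def R)
  have Bl: "bounded_linear B" and Cl: "bounded_linear C"
    using assms(4) C by (auto simp: bounded_clinear_def)
  have a0: "0 \<le> a" and b0: "0 \<le> b"
    unfolding assms(6,7) C_def[symmetric] by (auto intro: onorm_pos_le Bl Cl)
  have Ble: "norm (B v) \<le> a * norm v" and Cle: "norm (C v) \<le> b * norm v" for v
    unfolding assms(6,7) C_def[symmetric] by (auto intro: onorm Bl Cl)
  have G_scaleC: "G (c *\<^sub>C v) = c *\<^sub>C G v" for c v
    using S.fA_scaleC[OF CB, of c v] assms(4) C by (simp add: G_def bounded_clinear_def)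
  have G_add: "G (u + v) = G u + G v" for u v
    using S.fA_add[OF CB CB, of u v] linear_add[OF bounded_linear.linear[OF Bl], of u v]
      linear_add[OF bounded_linear.linear[OF Cl], of u v]
    by (simp add: G_def)
  have G0: "G v = 0" if "B v = 0" "C v = 0" for v
    using S.fA_scaleC[OF CB, of 0 v] that by (simp add: G_def)
  have G_le: "norm (G v) \<le> 2 * (1 + M0) * a * f (a / b) * norm v" for v
  \<comment> \<open>If \<open>a\<close> or \<open>b\<close> vanishes, then \<open>a / b = 0\<close>,
    by convention for \<open>b = 0\<close>, and a Stieltjes function has no prescribed value at
    \<open>0\<close>. So \<open>a = 0\<close> must make the right-hand side vanish, and
    \<open>G v = 0\<close> is shown directly.\<close>
  proof (cases "b = 0")
    case True
    have Cv: "C v = 0" using Cle[of v] True by simp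
    have "(0, - B v) \<in> semigroup_generator T" using CB[of v] Cv by simp
    moreover have "(0, 0) \<in> semigroup_generator T"
      using S.generator_scaleC[OF CB, of 0 v] by simp
    ultimately have "B u = 0" for u
    proof -
      have "C u = 0" using Cle[of u] True by simp
      then have "(0, - B u) \<in> semigroup_generator T" using CB[of u] by simp
      from S.generator_unique[OF this \<open>(0, 0) \<in> semigroup_generator T\<close>] show ?thesis by simp
    qed
    then have "a = 0" and "B v = 0"
      unfolding assms(6) by (auto simp: onorm_zero fun_eq_iff intro!: onorm_eq_0[OF Bl, THEN iffD2])
    then show ?thesis using G0 Cv by simp
  next
    case False
    then have b: "0 < b" using b0 by simp
    show ?thesis
    proof (cases "a = 0")
      case True
      have "B v = 0" using Ble[of v] True by simp
      then have "C v = 0"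
        using S.generator_injective[OF dense, of "C v"] CB[of v] by simp
      then show ?thesis using G0 \<open>B v = 0\<close> True by simp
    next
      case False
      then have a: "0 < a" using a0 by simp
      show ?thesis
        using S.norm_fA_le[OF CB a b Cle Ble, of v] f[of "a / b"] a b
        by (simp add: G_def M0)
    qed
  qed
  \<comment> \<open>The operator norm estimate asks for a nonnegative bound. Unless both
    \<open>a\<close> and \<open>b\<close> are positive, \<open>a = 0\<close>, because
    \<open>b = 0\<close> forces \<open>B = 0\<close>.\<close>
  have bound_nonneg: "0 \<le> 2 * (1 + M0) * a * f (a / b)"
  proof (cases "0 < a \<and> 0 < b")
    case True
    then show ?thesis using S.fS_nonneg[of "a / b"] f[of "a / b"] S.M0_nonneg by (simp add: M0)
  next
    case False
    show ?thesis
    proof (cases "a = 0")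
      case False
      then obtain v where "B v \<noteq> 0"
        unfolding assms(6) using onorm_eq_0[OF Bl] by auto
      have "b = 0" using \<open>\<not> (0 < a \<and> 0 < b)\<close> a0 b0 False by auto
      then have "C v = 0" using Cle[of v] by simp
      then have "(0, - B v) \<in> semigroup_generator T" using CB[of v] by simp
      moreover have "(0, 0) \<in> semigroup_generator T"
        using S.generator_scaleC[OF CB, of 0 v] by simp
      ultimately have "B v = 0" using S.generator_unique by fastforce
      with \<open>B v \<noteq> 0\<close> show ?thesis by simp
    qed simp
  qed
  have Gl: "bounded_linear G"
  proof (rule bounded_linear_intro)
    show "G (r *\<^sub>R v) = r *\<^sub>R G v" for r v
      using G_scaleC[of "of_real r" v] by (simp add: scaleR_scaleC)
    show "norm (G v) \<le> norm v * (2 * (1 + M0) * a * f (a / b))" for v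
      using G_le[of v] by (simp add: mult.commute)
  qed (rule G_add)
  have "bounded_clinear G" using Gl G_scaleC by (simp add: bounded_clinear_def)
  moreover have "range B \<subseteq> Domain ?R" using R by blast
  moreover have "onorm G \<le> 2 * (1 + M0) * a * f (a / b)"
    by (rule onorm_bound[OF bound_nonneg G_le])
  ultimately show ?thesis by (simp add: bounded_op_comp_def RG)
qed

end
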